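(* Let $\chi:[0,\infty)\to[0,\infty)$ be a smooth cut-off function with $\chi=1$ on $[0,1]$, $\chi=0$ on $[2,\infty)$ and $-\chi'=\eta^2$ for some $\eta\in C^\infty_c((1,2))$. Let $\mathbf v$ be a Hamiltonian stationary Legendrian varifold (HSLV) on $\mathbb H^2$. For $q\in\mathbb H^2$ and $a>0$ let $$\begin{aligned}\Theta^\chi(q,a):=&-\int_{G}\frac{|\nabla^{\mathcal P}\mathfrak r_q|^2}{\mathfrak r_q}\,a^{-1}\chi'(\mathfrak r_q/a)\,d\mathbf v(\mathcal P,p)-\int_{G}\frac{2\varphi_q}{\mathfrak r_q^3}\,a^{-1}\chi'(\mathfrak r_q/a)\arctan\sigma_q\,d\mathbf v(\mathcal P,p)\\&+\frac14\int_{G}\mathfrak r_q^4\,\nabla^{\mathcal P}\arctan\sigma_q\cdot\nabla^{\mathcal P}\big[\mathfrak r_q^{-3}a^{-1}\chi'(\mathfrak r_q/a)\arctan\sigma_q\big]\,d\mathbf v(\mathcal P,p).\end{aligned}$$ Then for every $q\in\mathbb H^2$: $$0\le\Theta^\chi(q,a)\le\Theta^\chi(q,b)\qquad\text{for all }0<a<b;$$ the limit $\theta^\chi(q):=\lim_{\varepsilon\to0}\Theta^\chi(q,\varepsilon)$ exists in $[0,\infty)$; and for every $b>0$ $$\theta^\chi(q)+\int_{\{0<\mathfrak r_q<b\}}|\nabla^{\mathcal P}\arctan\sigma_q|^2\,d\mathbf v(\mathcal P,p)\le C\,b^{-2}\,|\mathbf v|\big(B^{\mathfrak r}_{2b}(q)\setminus\overline{B}^{\mathfrak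 r}_b(q)\big),$$ where $C>0$ is a constant depending only on $\chi$.
   Context: $\mathbb H^2=\mathbb C^2\times\mathbb R$ has coordinates $(z_1,\dots,z_4,\varphi)$ and group law $(z,\varphi)*(z',\varphi')=(z+z',\varphi+\varphi'+\sum_{j=1}^2(z_{2j-1}z'_{2j}-z_{2j}z'_{2j-1}))$. Put $X_j=\partial_{z_{2j-1}}-z_{2j}\partial_\varphi$, $Y_j=\partial_{z_{2j}}+z_{2j-1}\partial_\varphi$ ($j=1,2$), $H=\mathrm{span}\{X_1,Y_1,X_2,Y_2\}=\ker\alpha$ with $\alpha=-d\varphi+\sum_{j}(z_{2j-1}dz_{2j}-z_{2j}dz_{2j-1})$; the Riemannian metric on $\mathbb H^2$ makes $(X_1,Y_1,X_2,Y_2,\partial_\varphi)$ orthonormal; $J_HX_j=Y_j$, $J_HY_j=-X_j$ on $H$. $\rho=|z|$, $\mathfrak r=(\rho^4+4\varphi^2)^{1/4}$, $\sigma=2\varphi/\rho^2$; $\arctan\sigma$ extends to a smooth function on $\mathbb H^2\setminus\{0\}$ (equal to $\mathrm{sgn}(\varphi)\pi/2$ where $z=0$). For $q\in\mathbb H^2$: $\mathfrak r_q(x)=\mathfrak r(q^{-1}*x)$, $\varphi_q(x)=\varphi(q^{-1}*x)$, $\sigma_q(x)=\sigma(q^{-1}*x)$, and $B^{\mathfrak r}_s(q)=\{\mathfrak r_q<s\}$. For a smooth function $F$, the Hamiltonian vector field $W_F$ is $2W_F=J_H\nabla^HF-2F\partial_\varphi$, with $\nabla^HF$ the orthogonal projection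 of $\nabla F$ onto $H$. $\Pi:G\to\mathbb H^2$ is the Grassmannian bundle of Legendrian $2$-planes: pairs $(\mathcal P,p)$ with $\mathcal P\subset H_p$ two-dimensional and $d\alpha|_{\mathcal P}=0$. For $(\mathcal P,p)\in G$ with orthonormal basis $Z_1,Z_2$ of $\mathcal P$: $\nabla^{\mathcal P}f$ is the orthogonal projection of $\nabla f(p)$ onto $\mathcal P$, and $\mathrm{div}_{\mathcal P}W=\sum_j\langle\nabla_{Z_j}W,Z_j\rangle$ (Levi-Civita connection). A HSLV on an open set $U\subseteq\mathbb H^2$ is a Radon measure $\mathbf v$ on $\Pi^{-1}(U)$ with $\int\mathrm{div}_{\mathcal P}W_F\,d\mathbf v(\mathcal P,p)=0$ for all $F\in C^\infty_c(U)$. Its weight is $|\mathbf v|=\Pi_*\mathbf v$. A domain of integration written in $\mathbb H^2$ means its preimage under $\Pi$. *)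

theory Defs
  imports "HOL-Analysis.Analysis"
begin

primrec Ck_on :: "nat \<Rightarrow> 'a::euclidean_space set \<Rightarrow> ('a \<Rightarrow> 'b::real_normed_vector) \<Rightarrow> bool" where
  "Ck_on 0 S f \<longleftrightarrow> continuous_on S f"
| "Ck_on (Suc k) S f \<longleftrightarrow> (\<forall>x\<in>S. f differentiable (at x)) \<and>
     (\<forall>v. Ck_on k S (\<lambda>x. frechet_derivative f (at x) v))"

text \<open>Meant for open \<open>S\<close>, since the derivatives are two-sided.\<close>

definition smooth_on :: "'a::euclidean_space set \<Rightarrow> ('a \<Rightarrow> 'b::real_normed_vector) \<Rightarrow> bool" where
  "smooth_on S f \<longleftrightarrow> (\<forall>k. Ck_on k S f)"

text \<open>\<open>C\<^sub>c\<^sup>\<infinity>(U)\<close>, its elements being extended by zero to the whole space.\<close>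

definition test_functions :: "'a::euclidean_space set \<Rightarrow> ('a \<Rightarrow> real) set" where
  "test_functions U =
     {F. smooth_on UNIV F \<and> compact (closure {x. F x \<noteq> 0}) \<and> closure {x. F x \<noteq> 0} \<subseteq> U}"

section \<open>The Heisenberg group\<close>

text \<open>The point \<open>(z, \<phi>)\<close> of \<open>\<complex>\<^sup>2 \<times> \<real>\<close> has real coordinates \<open>z $ 1, \<dots>, z $ 4\<close>. Tangent
  vectors at any point are given by their components in these coordinates, so they have the
  same type.\<close>

type_synonym heis = "(real ^ 4) \<times> real"

definition omega :: "real ^ 4 \<Rightarrow> real ^ 4 \<Rightarrow> real" where
  "omega z w = (z $ 1 * w $ 2 - z $ 2 * w $ 1) + (z $ 3 * w $ 4 - z $ 4 * w $ 3)"

definition hmult :: "heis \<Rightarrow> heis \<Rightarrow> heis" where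
  "hmult p q = (fst p + fst q, snd p + snd q + omega (fst p) (fst q))"

definition hinv :: "heis \<Rightarrow> heis" where
  "hinv p = (- fst p, - snd p)"

definition X1 :: "heis \<Rightarrow> heis" where "X1 p = (axis 1 1, - fst p $ 2)"
definition Y1 :: "heis \<Rightarrow> heis" where "Y1 p = (axis 2 1, fst p $ 1)"
definition X2 :: "heis \<Rightarrow> heis" where "X2 p = (axis 3 1, - fst p $ 4)"
definition Y2 :: "heis \<Rightarrow> heis" where "Y2 p = (axis 4 1, fst p $ 3)"
definition dphi :: "heis" where "dphi = (0, 1)"

definition horiz :: "heis \<Rightarrow> heis set" where
  "horiz p = span {X1 p, Y1 p, X2 p, Y2 p}"

definition alpha :: "heis \<Rightarrow> heis \<Rightarrow> real" where
  "alpha p v = - snd v + omega (fst p) (fst v)"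

definition ext_deriv :: "(heis \<Rightarrow> heis \<Rightarrow> real) \<Rightarrow> heis \<Rightarrow> heis \<Rightarrow> heis \<Rightarrow> real" where
  "ext_deriv \<theta> p v w =
     frechet_derivative (\<lambda>x. \<theta> x w) (at p) v - frechet_derivative (\<lambda>x. \<theta> x v) (at p) w"

text \<open>The components of \<open>v\<close> in the frame \<open>X1, Y1, X2, Y2, dphi\<close> are
  \<open>v $ 1, \<dots>, v $ 4\<close> and \<open>- alpha p v\<close>.\<close>

definition hmetric :: "heis \<Rightarrow> heis \<Rightarrow> heis \<Rightarrow> real" where
  "hmetric p v w = fst v \<bullet> fst w + alpha p v * alpha p w"

definition JH :: "heis \<Rightarrow> heis \<Rightarrow> heis" where
  "JH p v = fst v $ 1 *\<^sub>R Y1 p - fst v $ 2 *\<^sub>R X1 p + fst v $ 3 *\<^sub>R Y2 p - fst v $ 4 *\<^sub>R X2 p"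

definition grad :: "(heis \<Rightarrow> real) \<Rightarrow> heis \<Rightarrow> heis" where
  "grad f p = (THE v. \<forall>w. hmetric p v w = frechet_derivative f (at p) w)"

definition oproj :: "heis \<Rightarrow> heis set \<Rightarrow> heis \<Rightarrow> heis" where
  "oproj p S v = (THE u. u \<in> S \<and> (\<forall>w\<in>S. hmetric p (v - u) w = 0))"

text \<open>The Levi-Civita connection in the global chart: \<open>christoffel p x y\<close> is the vector
  \<open>\<Sum>i j k. \<Gamma>\<^bsup>k\<^esup>\<^bsub>ij\<^esub>(p) x\<^sub>i y\<^sub>j e\<^sub>k\<close>, and \<open>cov_deriv W p x\<close> is \<open>\<nabla>\<^sub>x W\<close> at \<open>p\<close>.\<close>

definition christoffel :: "heis \<Rightarrow> heis \<Rightarrow> heis \<Rightarrow> heis" where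
  "christoffel p x y = (THE c. \<forall>z. hmetric p c z =
     (frechet_derivative (\<lambda>q. hmetric q y z) (at p) x
      + frechet_derivative (\<lambda>q. hmetric q x z) (at p) y
      - frechet_derivative (\<lambda>q. hmetric q x y) (at p) z) / 2)"

definition cov_deriv :: "(heis \<Rightarrow> heis) \<Rightarrow> heis \<Rightarrow> heis \<Rightarrow> heis" where
  "cov_deriv W p x = frechet_derivative W (at p) x + christoffel p x (W p)"

definition ham_field :: "(heis \<Rightarrow> real) \<Rightarrow> heis \<Rightarrow> heis" where
  "ham_field F p = (1 / 2) *\<^sub>R (JH p (oproj p (horiz p) (grad F p)) - (2 * F p) *\<^sub>R dphi)"

definition hnorm :: "heis \<Rightarrow> real" where
  "hnorm p = root 4 (norm (fst p) ^ 4 + 4 * (snd p)\<^sup>2)"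

text \<open>The extension of \<open>arctan \<sigma>\<close>, \<open>\<sigma> = 2 \<phi> / \<rho>\<^sup>2\<close>, across the vertical axis.\<close>

definition arctan_sigma :: "heis \<Rightarrow> real" where
  "arctan_sigma p =
     (if fst p = 0 then sgn (snd p) * (pi / 2) else arctan (2 * snd p / (norm (fst p))\<^sup>2))"

definition hnorm_at :: "heis \<Rightarrow> heis \<Rightarrow> real" where
  "hnorm_at q x = hnorm (hmult (hinv q) x)"

definition phi_at :: "heis \<Rightarrow> heis \<Rightarrow> real" where
  "phi_at q x = snd (hmult (hinv q) x)"

definition arctan_sigma_at :: "heis \<Rightarrow> heis \<Rightarrow> real" where
  "arctan_sigma_at q x = arctan_sigma (hmult (hinv q) x)"

definition hball :: "heis \<Rightarrow> real \<Rightarrow> heis set" where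
  "hball q s = {x. hnorm_at q x < s}"

section \<open>Legendrian planes and Hamiltonian stationary Legendrian varifolds\<close>

definition grass :: "heis set \<Rightarrow> (heis set \<times> heis) set" where
  "grass U = {(P, p). p \<in> U \<and> subspace P \<and> P \<subseteq> horiz p \<and> dim P = 2 \<and>
     (\<forall>v\<in>P. \<forall>w\<in>P. ext_deriv alpha p v w = 0)}"

text \<open>The bundle topology: a plane is identified with the orthogonal projection onto it.\<close>

definition grass_topology :: "heis set \<Rightarrow> (heis set \<times> heis) topology" where
  "grass_topology U =
     pullback_topology (grass U) (\<lambda>(P, p). (Blinfun (oproj p P), p)) euclidean"

text \<open>A Radon measure is a Borel measure that is finite on compact sets; regularity is then
  automatic, as the bundle over an open set is locally compact and second countable.\<close>

definition radon_on_grass :: "heis set \<Rightarrow> (heis set \<times> heis) measure \<Rightarrow> bool" where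
  "radon_on_grass U v \<longleftrightarrow> space v = grass U \<and>
     sets v = sigma_sets (grass U) {A. openin (grass_topology U) A} \<and>
     (\<forall>K. compactin (grass_topology U) K \<longrightarrow> emeasure v K < \<infinity>)"

definition is_onb :: "heis \<Rightarrow> heis set \<Rightarrow> heis \<Rightarrow> heis \<Rightarrow> bool" where
  "is_onb p P Z1 Z2 \<longleftrightarrow> span {Z1, Z2} = P \<and>
     hmetric p Z1 Z1 = 1 \<and> hmetric p Z2 Z2 = 1 \<and> hmetric p Z1 Z2 = 0"

text \<open>The value does not depend on the orthonormal basis that is selected.\<close>

definition div_plane :: "heis set \<Rightarrow> heis \<Rightarrow> (heis \<Rightarrow> heis) \<Rightarrow> real" where
  "div_plane P p W = (SOME d. \<exists>Z1 Z2. is_onb p P Z1 Z2 \<and>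
     d = hmetric p (cov_deriv W p Z1) Z1 + hmetric p (cov_deriv W p Z2) Z2)"

definition plane_grad :: "heis set \<Rightarrow> heis \<Rightarrow> (heis \<Rightarrow> real) \<Rightarrow> heis" where
  "plane_grad P p f = oproj p P (grad f p)"

definition HSLV :: "heis set \<Rightarrow> (heis set \<times> heis) measure \<Rightarrow> bool" where
  "HSLV U v \<longleftrightarrow> open U \<and> radon_on_grass U v \<and>
     (\<forall>F\<in>test_functions U. (\<integral>(P, p). div_plane P p (ham_field F) \<partial>v) = 0)"

definition weight :: "heis set \<Rightarrow> (heis set \<times> heis) measure \<Rightarrow> heis measure" where
  "weight U v = distr v (restrict_space borel U) snd"

text \<open>The integrands vanish where \<open>hnorm_at q p = 0\<close>, since division by zero yields zero there;
  this is the intended value because the derivative of \<open>chi\<close> vanishes near \<open>0\<close>.\<close>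

definition Theta ::
    "(real \<Rightarrow> real) \<Rightarrow> (heis set \<times> heis) measure \<Rightarrow> heis \<Rightarrow> real \<Rightarrow> real" where
  "Theta chi v q a =
     - (\<integral>(P, p). hmetric p (plane_grad P p (hnorm_at q)) (plane_grad P p (hnorm_at q))
            / hnorm_at q p * (1 / a) * deriv chi (hnorm_at q p / a) \<partial>v)
     - (\<integral>(P, p). 2 * phi_at q p / hnorm_at q p ^ 3 * (1 / a) * deriv chi (hnorm_at q p / a)
            * arctan_sigma_at q p \<partial>v)
     + 1 / 4 * (\<integral>(P, p). hnorm_at q p ^ 4 *
          hmetric p (plane_grad P p (arctan_sigma_at q))
            (plane_grad P p (\<lambda>x. 1 / hnorm_at q x ^ 3 * (1 / a) * deriv chi (hnorm_at q x / a)
               * arctan_sigma_at q x)) \<partial>v)"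

section \<open>Consistency of the explicit formulas\<close>

lemma linear_omega: "linear (\<lambda>z. omega z w)"
  by (rule linearI) (simp_all add: omega_def algebra_simps)

lemma has_derivative_alpha: "((\<lambda>x. alpha x v) has_derivative (\<lambda>u. omega (fst u) (fst v))) (at p)"
proof -
  have "bounded_linear (\<lambda>u::heis. omega (fst u) (fst v))"
    using linear_compose[OF linear_fst linear_omega[of "fst v"]]
    by (simp add: o_def linear_linear)
  then have "((\<lambda>u::heis. omega (fst u) (fst v)) has_derivative (\<lambda>u. omega (fst u) (fst v))) (at p)"
    by (rule bounded_linear_imp_has_derivative)
  from has_derivative_add[OF has_derivative_const this, of "- snd v"]
  show ?thesis by (simp add: alpha_def)
qed

lemma ext_deriv_alpha: "ext_deriv alpha p v w = 2 * omega (fst v) (fst w)"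
  by (simp add: ext_deriv_def frechet_derivative_at[OF has_derivative_alpha, symmetric]
      omega_def)

lemma frame_orthonormal:
  fixes p :: heis
  defines "E \<equiv> [X1 p, Y1 p, X2 p, Y2 p, dphi]"
  assumes "i < 5" "j < 5"
  shows "hmetric p (E ! i) (E ! j) = (if i = j then 1 else 0)"
proof -
  have "i \<in> {0, 1, 2, 3, 4}" "j \<in> {0, 1, 2, 3, 4}" using assms by auto
  then show ?thesis
    unfolding E_def
    by (auto simp: hmetric_def alpha_def omega_def X1_def Y1_def X2_def Y2_def dphi_def
        inner_axis_axis) (auto simp: axis_def)
qed

lemma metric_nondegenerate:
  assumes "\<And>w. hmetric p u w = hmetric p v w"
  shows "u = v"
proof -
  have "hmetric p (u - v) (u - v) = 0"
    using assms[of "u - v"] by (simp add: hmetric_def alpha_def omega_def algebra_simps)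
  then have "fst (u - v) = 0" "alpha p (u - v) = 0"
    unfolding hmetric_def by (auto simp: add_nonneg_eq_0_iff)
  then show ?thesis by (auto simp: alpha_def omega_def prod_eq_iff)
qed

lemma metric_JH: "hmetric p (JH p v) w = omega (fst v) (fst w)"
  by (simp add: hmetric_def JH_def alpha_def omega_def X1_def Y1_def X2_def Y2_def inner_vec_def
      sum_4 axis_def)

lemma has_derivative_metric:
  "((\<lambda>q. hmetric q y z) has_derivative
     (\<lambda>x. omega (fst x) (fst y) * alpha p z + alpha p y * omega (fst x) (fst z))) (at p)"
proof -
  note d = has_derivative_add[OF has_derivative_const
      has_derivative_mult[OF has_derivative_alpha[of y p] has_derivative_alpha[of z p]]]
  show ?thesis
    unfolding hmetric_def by (rule has_derivative_eq_rhs[OF d]) (simp add: fun_eq_iff)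
qed

lemma christoffel_eq: "christoffel p x y = alpha p y *\<^sub>R JH p x + alpha p x *\<^sub>R JH p y"
proof -
  have lin: "hmetric p (a *\<^sub>R u + b *\<^sub>R v) z = a * hmetric p u z + b * hmetric p v z" for a b u v z
    by (simp add: hmetric_def alpha_def omega_def algebra_simps)
  have *: "hmetric p (alpha p y *\<^sub>R JH p x + alpha p x *\<^sub>R JH p y) z =
     (frechet_derivative (\<lambda>q. hmetric q y z) (at p) x
      + frechet_derivative (\<lambda>q. hmetric q x z) (at p) y
      - frechet_derivative (\<lambda>q. hmetric q x y) (at p) z) / 2" for z
    unfolding lin metric_JH frechet_derivative_at[OF has_derivative_metric, symmetric]
    by (simp add: omega_def field_simps)
  show ?thesis
    unfolding christoffel_def by (rule the_equality) (use * metric_nondegenerate in metis)+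
qed

lemma cov_deriv_torsion_free: "christoffel p x y = christoffel p y x"
  by (simp add: christoffel_eq)

lemma cov_deriv_metric:
  assumes V: "V differentiable (at p)" and W: "W differentiable (at p)"
  shows "((\<lambda>q. hmetric q (V q) (W q)) has_derivative
     (\<lambda>x. hmetric p (cov_deriv V p x) (W p) + hmetric p (V p) (cov_deriv W p x))) (at p)"
proof -
  define V' where "V' = frechet_derivative V (at p)"
  define W' where "W' = frechet_derivative W (at p)"
  have dV: "(V has_derivative V') (at p)" and dW: "(W has_derivative W') (at p)"
    using V W by (auto simp: V'_def W'_def frechet_derivative_works)
  have cov: "cov_deriv V p x = V' x + christoffel p x (V p)"
    "cov_deriv W p x = W' x + christoffel p x (W p)" for x
    by (simp_all add: cov_deriv_def V'_def W'_def)
  show ?thesis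
    unfolding hmetric_def alpha_def omega_def inner_vec_def sum_4 cov christoffel_eq
    apply (rule derivative_eq_intros dV dW has_derivative_fst has_derivative_snd refl
        bounded_linear.has_derivative[OF bounded_linear_vec_nth])+
    apply (simp add: fun_eq_iff JH_def X1_def Y1_def X2_def Y2_def alpha_def omega_def axis_def
        inner_vec_def sum_4)
    apply (simp add: algebra_simps)
    done
qed

end

(* Taking q = 0 for simplicity, arctan sigma is the argument of w = rho^2 + 2 i phi = r^2 exp (i arctan sigma),
   and F = arctan sigma satisfies div_P W_F = - |grad^P F|^2. This F is singular at q, so w is
   replaced by w + e with e > 0: then F_e = chi (r_e / a) * arctan (2 phi / (rho^2 + e)) is a
   test function, and
     div_P W_{F_e} = (regularised integrand of Theta) - chi (r_e / a) * S_e,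
   where S_e >= |grad^P arctan sigma_e|^2 by Bessel's inequality. Stationarity therefore gives
     Theta_e (a) = integral of chi (r_e / a) * S_e >= 0, increasing in a.
   The integrand of Theta lives on a < r_e < 2 a, where it is bounded by C / a^2, so
   Theta_e (a) tends to Theta (a) by dominated convergence; Fatou's lemma turns
   Theta_e (b) - Theta_e (a) into the Dirichlet integral of arctan sigma. *)
theory Submission
  imports Defs
begin

section \<open>Smooth functions\<close>


text \<open>Adding e to the real part changes neither differential of w, so the same formulas in u
  and t serve e > 0 and e = 0. It moves w into the open right half plane, where the argument is the
  arctangent of a quotient and r_e has no zero. It also has the right sign: with y the horizontal
  displacement from q, the plane gradients of u and t are projections of 2 y and 2 J y, so their
  squared lengths sum to at most 4 |y|^2 \<le> 4 u, and S_e - |grad^P arctan sigma_e|^2 equals (4 u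
  - that sum) / (2 r_e^4). The bound on S_e near q is of order 1 / e and is lost in the limit, and
  \<open>v\<close> may charge the fibre over q. So the Dirichlet integral is treated as a
  nonnegative integral, over {2 a \<le> r < b} at first, where chi (r / b) - chi (r / a) is 1; a
  tends to 0 afterwards. A Bochner integral of a non-integrable function is 0, so stationarity says
  something about Theta_e only when all terms are known to be integrable over the bundle. This calls
  for compactness of the bundle over compact sets and for integrands in a visibly measurable
  form.\<close>

lemma Ck_on_cong:
  assumes "open S" "\<And>x. x \<in> S \<Longrightarrow> f x = g x" "Ck_on k S f"
  shows "Ck_on k S g"
  using assms
proof (induction k arbitrary: f g)
  case 0
  then show ?case using continuous_on_cong[of S S f g] by simp
next
  case (Suc k)
  have d: "(g has_derivative frechet_derivative f (at x)) (at x)" if "x \<in> S" for x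
  proof (rule has_derivative_transform_within_open[OF _ \<open>open S\<close> that])
    show "(f has_derivative frechet_derivative f (at x)) (at x)"
      using Suc.prems that by (simp add: frechet_derivative_works)
  qed (use Suc.prems in auto)
  have "Ck_on k S (\<lambda>x. frechet_derivative g (at x) v)" for v
  proof (rule Suc.IH[of "\<lambda>x. frechet_derivative f (at x) v"])
    show "frechet_derivative f (at x) v = frechet_derivative g (at x) v" if "x \<in> S" for x
      using frechet_derivative_at[OF d[OF that]] by simp
  qed (use Suc.prems in auto)
  moreover have "g differentiable (at x)" if "x \<in> S" for x
    using d[OF that] by (rule differentiableI)
  ultimately show ?case by simp
qed

text \<open>\<open>Ck_on\<close> recurses through \<open>frechet_derivative\<close>, which does not
  compute. With an explicit derivative in its place, the closure properties below become inductions
  on \<open>k\<close>.\<close>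

lemma Ck_on_Suc_iff:
  assumes "open S" "\<And>x. x \<in> S \<Longrightarrow> (f has_derivative f' x) (at x)"
  shows "Ck_on (Suc k) S f \<longleftrightarrow> (\<forall>v. Ck_on k S (\<lambda>x. f' x v))"
proof -
  have e: "frechet_derivative f (at x) = f' x" if "x \<in> S" for x
    using frechet_derivative_at assms(2)[OF that] by metis
  have "Ck_on k S (\<lambda>x. frechet_derivative f (at x) v) \<longleftrightarrow> Ck_on k S (\<lambda>x. f' x v)" for v
    using Ck_on_cong[OF \<open>open S\<close>, of "\<lambda>x. frechet_derivative f (at x) v" "\<lambda>x. f' x v" k]
      Ck_on_cong[OF \<open>open S\<close>, of "\<lambda>x. f' x v" "\<lambda>x. frechet_derivative f (at x) v" k] e
    by auto
  moreover have "\<forall>x\<in>S. f differentiable (at x)"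
    using assms(2) by (auto intro: differentiableI)
  ultimately show ?thesis by simp
qed

lemma Ck_on_SucD: "Ck_on (Suc k) S f \<Longrightarrow> Ck_on k S f"
proof (induction k arbitrary: f)
  case 0
  then show ?case
    using differentiable_imp_continuous_within continuous_at_imp_continuous_on
    by (metis Ck_on.simps)
next
  case (Suc k)
  then show ?case by auto
qed

lemma Ck_on_const [simp]: "Ck_on k S (\<lambda>x. c)"
proof (induction k arbitrary: c)
  case (Suc k)
  then show ?case by (simp add: frechet_derivative_const)
qed simp

lemma Ck_on_bounded_linear: "bounded_linear f \<Longrightarrow> Ck_on k S f"
proof (cases k)
  case (Suc j)
  assume f: "bounded_linear f"
  then have "frechet_derivative f (at x) = f" for x
    using frechet_derivative_at[OF bounded_linear_imp_has_derivative] by metis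
  then show ?thesis using f Suc by (simp add: bounded_linear_imp_differentiable)
qed (simp add: linear_continuous_on)

lemma Ck_on_add:
  assumes "open S" "Ck_on k S f" "Ck_on k S g"
  shows "Ck_on k S (\<lambda>x. f x + g x)"
  using assms(2,3)
proof (induction k arbitrary: f g)
  case 0
  then show ?case by (simp add: continuous_on_add)
next
  case (Suc k)
  have "((\<lambda>x. f x + g x) has_derivative
      (\<lambda>v. frechet_derivative f (at x) v + frechet_derivative g (at x) v)) (at x)"
    if "x \<in> S" for x
    using Suc.prems that
    by (intro has_derivative_add) (simp_all add: frechet_derivative_works)
  from Ck_on_Suc_iff[OF \<open>open S\<close> this] show ?case using Suc by simp
qed

lemma Ck_on_mult:
  fixes f g :: "'a::euclidean_space \<Rightarrow> real"
  assumes "open S" "Ck_on k S f" "Ck_on k S g"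
  shows "Ck_on k S (\<lambda>x. f x * g x)"
  using assms(2,3)
proof (induction k arbitrary: f g)
  case 0
  then show ?case by (simp add: continuous_on_mult)
next
  case (Suc k)
  have "((\<lambda>x. f x * g x) has_derivative
      (\<lambda>v. f x * frechet_derivative g (at x) v + frechet_derivative f (at x) v * g x)) (at x)"
    if "x \<in> S" for x
    using Suc.prems that
    by (intro has_derivative_mult) (simp_all add: frechet_derivative_works)
  from Ck_on_Suc_iff[OF \<open>open S\<close> this] show ?case
    using Suc.prems Suc.prems[THEN Ck_on_SucD]
    by (auto intro!: Ck_on_add[OF \<open>open S\<close>] Suc.IH simp del: Ck_on.simps(1))
qed

lemma Ck_on_deriv:
  fixes h :: "real \<Rightarrow> real"
  assumes "open T" "Ck_on (Suc k) T h"
  shows "\<And>t. t \<in> T \<Longrightarrow> (h has_real_derivative deriv h t) (at t)" "Ck_on k T (deriv h)"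
proof -
  show d: "(h has_real_derivative deriv h t) (at t)" if "t \<in> T" for t
  proof -
    have "h differentiable (at t)" using assms that by simp
    then obtain D where "(h has_real_derivative D) (at t)"
      by (auto simp: real_differentiable_def)
    then show ?thesis by (simp add: DERIV_imp_deriv)
  qed
  have "(h has_derivative (*) (deriv h t)) (at t)" if "t \<in> T" for t
    using d[OF that] by (simp add: has_field_derivative_def)
  from Ck_on_Suc_iff[OF \<open>open T\<close> this, of k]
  have "Ck_on k T (\<lambda>x. deriv h x * 1)" using assms(2) by blast
  then show "Ck_on k T (deriv h)" by simp
qed

lemma Ck_on_Suc_real:
  fixes h :: "real \<Rightarrow> real"
  assumes "open T" "\<And>t. t \<in> T \<Longrightarrow> (h has_real_derivative h' t) (at t)" "Ck_on k T h'"
  shows "Ck_on (Suc k) T h"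
proof -
  have "(h has_derivative (*) (h' t)) (at t)" if "t \<in> T" for t
    using assms(2)[OF that] by (simp add: has_field_derivative_def)
  from Ck_on_Suc_iff[OF \<open>open T\<close> this, of k] show ?thesis
    using Ck_on_mult[OF assms(1,3) Ck_on_const] by blast
qed

lemma Ck_on_compose:
  fixes f :: "'a::euclidean_space \<Rightarrow> real" and h :: "real \<Rightarrow> real"
  assumes "open S" "open T" "f ` S \<subseteq> T" "Ck_on k T h" "Ck_on k S f"
  shows "Ck_on k S (\<lambda>x. h (f x))"
  using assms(4,5)
proof (induction k arbitrary: h)
  case 0
  then show ?case using assms(3) by (auto intro: continuous_on_compose2)
next
  case (Suc k)
  have "((\<lambda>x. h (f x)) has_derivative
      (\<lambda>v. deriv h (f x) * frechet_derivative f (at x) v)) (at x)" if "x \<in> S" for x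
  proof -
    have "(f has_derivative frechet_derivative f (at x)) (at x)"
      using Suc.prems that by (simp add: frechet_derivative_works)
    moreover have "(h has_derivative (\<lambda>v. deriv h (f x) * v)) (at (f x))"
      using Ck_on_deriv(1)[OF \<open>open T\<close> Suc.prems(1)] that assms(3)
      by (auto simp: has_field_derivative_def)
    ultimately show ?thesis
      by (rule has_derivative_compose)
  qed
  from Ck_on_Suc_iff[OF \<open>open S\<close> this] show ?case
    using Suc.prems(2) Suc.IH[OF Ck_on_deriv(2)[OF \<open>open T\<close> Suc.prems(1)] Ck_on_SucD[OF Suc.prems(2)]]
    by (auto intro!: Ck_on_mult[OF \<open>open S\<close>])
qed

text \<open>The factor \<open>c\<close> and the free exponent make the family closed under
  differentiation, so that the induction closes. Reciprocals and roots are the exponents -1 and 1 /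
  n.\<close>

lemma Ck_on_powr: "Ck_on k {0<..} (\<lambda>x::real. c * x powr p)"
proof (induction k arbitrary: c p)
  case 0
  have "continuous_on {0<..} (\<lambda>x::real. c * x powr p)"
    by (intro continuous_intros) auto
  then show ?case by simp
next
  case (Suc k)
  have "((\<lambda>x. c * x powr p) has_real_derivative (c * p) * t powr (p - 1)) (at t)" if "t \<in> {0<..}" for t
    using DERIV_cmult[OF DERIV_powr[OF DERIV_ident, of t "\<lambda>_. p" 0], of c] that
    by (simp add: powr_diff algebra_simps)
  from Ck_on_Suc_real[OF _ this Suc[of "c * p" "p - 1"]] show ?case by simp
qed

lemma Ck_on_inverse: "Ck_on k {0<..} (inverse :: real \<Rightarrow> real)"
  by (rule Ck_on_cong[OF _ _ Ck_on_powr[of k 1 "-1"]]) (auto simp: powr_minus)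

lemma Ck_on_root: "0 < n \<Longrightarrow> Ck_on k {0<..} (root n)"
  by (rule Ck_on_cong[OF _ _ Ck_on_powr[of k 1 "1 / n"]]) (auto simp: root_powr_inverse)

lemma Ck_on_arctan: "Ck_on k UNIV arctan"
proof (cases k)
  case 0
  then show ?thesis by (simp add: continuous_on_arctan continuous_on_id)
next
  case (Suc j)
  have "Ck_on j UNIV (\<lambda>x::real. inverse (1 + x * x))"
    by (rule Ck_on_compose[OF _ _ _ Ck_on_inverse], simp_all add: add_pos_nonneg image_subset_iff)
      (intro Ck_on_add Ck_on_mult Ck_on_const Ck_on_bounded_linear bounded_linear_ident open_UNIV)
  then have "Ck_on (Suc j) UNIV arctan"
    by (intro Ck_on_Suc_real[of _ _ "\<lambda>x. inverse (1 + x * x)"])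
      (auto intro!: derivative_eq_intros simp: power2_eq_square)
  then show ?thesis using Suc by simp
qed

section \<open>Legendrian planes\<close>


definition JR :: "real ^ 4 \<Rightarrow> real ^ 4" where
  "JR w = (\<chi> i. if i = 1 then - w $ 2 else if i = 2 then w $ 1 else if i = 3 then - w $ 4 else w $ 3)"

lemma JR_nth [simp]:
  "JR w $ 1 = - w $ 2" "JR w $ 2 = w $ 1" "JR w $ 3 = - w $ 4" "JR w $ 4 = w $ 3"
  by (simp_all add: JR_def)

lemma inner_4: "(v :: real ^ 4) \<bullet> w = v $ 1 * w $ 1 + v $ 2 * w $ 2 + v $ 3 * w $ 3 + v $ 4 * w $ 4"
  by (simp add: inner_vec_def sum_4)

lemma vec4_eq_iff: "(v :: real ^ 4) = w \<longleftrightarrow> v $ 1 = w $ 1 \<and> v $ 2 = w $ 2 \<and> v $ 3 = w $ 3 \<and> v $ 4 = w $ 4"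
  by (simp add: vec_eq_iff forall_4)

lemma bounded_linear_JR: "bounded_linear JR"
  unfolding linear_conv_bounded_linear[symmetric]
  by (rule linearI) (simp_all add: vec4_eq_iff)

lemma inner_JR_JR [simp]: "JR v \<bullet> JR w = v \<bullet> w"
  by (simp add: inner_4)

text \<open>\<open>JR\<close> is multiplication by i on C^2, that is, \<open>JH\<close> read in the
  horizontal frame; \<open>omega\<close> is the corresponding Kaehler form.\<close>

lemma omega_eq_JR: "omega v w = JR v \<bullet> w"
  by (simp add: omega_def inner_4)

lemma inner_JR_right: "v \<bullet> JR w = - omega v w"
  by (simp add: omega_def inner_4)

lemma omega_skew: "omega v w = - omega w v"
  by (simp add: omega_def)

lemma omega_self [simp]: "omega v v = 0"
  by (simp add: omega_def)

lemma bounded_bilinear_omega: "bounded_bilinear omega"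
  unfolding omega_eq_JR
  by (rule bounded_bilinear.comp1[OF bounded_bilinear_inner bounded_linear_JR])

lemmas omega_simps = bounded_bilinear.add_left[OF bounded_bilinear_omega]
  bounded_bilinear.add_right[OF bounded_bilinear_omega]
  bounded_bilinear.diff_left[OF bounded_bilinear_omega]
  bounded_bilinear.diff_right[OF bounded_bilinear_omega]
  bounded_bilinear.scaleR_left[OF bounded_bilinear_omega]
  bounded_bilinear.scaleR_right[OF bounded_bilinear_omega]
  bounded_bilinear.minus_left[OF bounded_bilinear_omega]
  bounded_bilinear.minus_right[OF bounded_bilinear_omega]
  bounded_bilinear.zero_left[OF bounded_bilinear_omega]
  bounded_bilinear.zero_right[OF bounded_bilinear_omega]

lemma alpha_add [simp]: "alpha p (v + w) = alpha p v + alpha p w"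
  and alpha_scaleR [simp]: "alpha p (c *\<^sub>R v) = c * alpha p v"
  and alpha_diff [simp]: "alpha p (v - w) = alpha p v - alpha p w"
  and alpha_minus [simp]: "alpha p (- v) = - alpha p v"
  and alpha_zero [simp]: "alpha p 0 = 0"
  by (simp_all add: alpha_def omega_simps algebra_simps)

lemma hmetric_simps:
  "hmetric p (u + v) w = hmetric p u w + hmetric p v w"
  "hmetric p w (u + v) = hmetric p w u + hmetric p w v"
  "hmetric p (u - v) w = hmetric p u w - hmetric p v w"
  "hmetric p w (u - v) = hmetric p w u - hmetric p w v"
  "hmetric p (c *\<^sub>R v) w = c * hmetric p v w"
  "hmetric p w (c *\<^sub>R v) = c * hmetric p w v"
  "hmetric p 0 w = 0" "hmetric p w 0 = 0"
  by (simp_all add: hmetric_def algebra_simps inner_simps)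

lemma hmetric_commute: "hmetric p v w = hmetric p w v"
  by (simp add: hmetric_def inner_commute mult.commute)

lemma hmetric_self_eq_0: "hmetric p v v = 0 \<longleftrightarrow> v = 0"
proof
  assume "hmetric p v v = 0"
  then have "fst v = 0" "alpha p v = 0"
    unfolding hmetric_def by (auto simp: add_nonneg_eq_0_iff)
  then show "v = 0" by (auto simp: alpha_def omega_def prod_eq_iff)
qed (simp add: hmetric_simps)

lemma hmetric_self_nonneg: "hmetric p v v \<ge> 0"
  by (simp add: hmetric_def)

lemma horiz_eq: "horiz p = {v. alpha p v = 0}"
proof
  have "subspace {v. alpha p v = 0}"
    by (simp add: subspace_def)
  moreover have "{X1 p, Y1 p, X2 p, Y2 p} \<subseteq> {v. alpha p v = 0}"
    by (simp add: X1_def Y1_def X2_def Y2_def alpha_def omega_def axis_def)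
  ultimately show "horiz p \<subseteq> {v. alpha p v = 0}"
    unfolding horiz_def by (intro span_minimal)
  show "{v. alpha p v = 0} \<subseteq> horiz p"
  proof
    fix v assume "v \<in> {v. alpha p v = 0}"
    then have "v = fst v $ 1 *\<^sub>R X1 p + fst v $ 2 *\<^sub>R Y1 p + fst v $ 3 *\<^sub>R X2 p + fst v $ 4 *\<^sub>R Y2 p"
      by (auto simp: prod_eq_iff vec4_eq_iff alpha_def omega_def X1_def Y1_def X2_def Y2_def axis_def
          algebra_simps)
    also have "\<dots> \<in> horiz p"
      unfolding horiz_def by (intro span_add span_scale span_base) auto
    finally show "v \<in> horiz p" .
  qed
qed

section \<open>Gradients and orthogonal projections as definite descriptions\<close>

lemma gradient_unique_exists:
  assumes "bounded_linear D"
  shows "\<exists>!v. \<forall>w. hmetric p v w = D w"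
proof -
  obtain g where g: "\<And>w. D w = g \<bullet> w"
  proof
    show "D w = adjoint D 1 \<bullet> w" for w
      using adjoint_works[OF bounded_linear.linear[OF assms], of w 1] by (simp add: inner_commute)
  qed
  \<comment> \<open>Riesz representation for \<open>hmetric\<close>: comparing the vertical
    components forces \<open>alpha p v = - snd g\<close>, and \<open>c\<close> compensates the part
    of \<open>alpha p w\<close> that depends on \<open>fst w\<close>.\<close>
  define c where "c = fst g + snd g *\<^sub>R JR (fst p)"
  define v where "v = (c, omega (fst p) c + snd g)"
  have "hmetric p v w = D w" for w
    by (simp add: g v_def hmetric_def alpha_def c_def omega_eq_JR inner_prod_def inner_simps algebra_simps)
  then show ?thesis
    by (intro ex1I[of _ v]) (auto intro: metric_nondegenerate[of p])
qed

lemma hmetric_grad: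
  assumes "(f has_derivative D) (at p)"
  shows "hmetric p (grad f p) w = D w"
proof -
  have "frechet_derivative f (at p) = D"
    using frechet_derivative_at[OF assms] by simp
  then have "\<forall>w. hmetric p (grad f p) w = D w"
    unfolding grad_def
    using theI'[OF gradient_unique_exists[OF has_derivative_bounded_linear[OF assms], of p]] by simp
  then show ?thesis by blast
qed

lemma oproj_eqI:
  assumes "subspace S" "u \<in> S" "\<And>w. w \<in> S \<Longrightarrow> hmetric p (v - u) w = 0"
  shows "oproj p S v = u"
  unfolding oproj_def
proof (rule the_equality)
  fix u' assume u': "u' \<in> S \<and> (\<forall>w\<in>S. hmetric p (v - u') w = 0)"
  then have "u' - u \<in> S" using assms subspace_diff by blast
  then have "hmetric p (v - u) (u' - u) = 0" "hmetric p (v - u') (u' - u) = 0"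
    using u' assms(3) by blast+
  then have "hmetric p (u' - u) (u' - u) = 0" by (simp add: hmetric_simps)
  then show "u' = u" by (simp add: hmetric_self_eq_0)
qed (use assms in blast)

lemma oproj_horiz: "oproj p (horiz p) v = (fst v, omega (fst p) (fst v))"
proof (rule oproj_eqI)
  show "subspace (horiz p)" by (simp add: horiz_def)
qed (auto simp: horiz_eq hmetric_def alpha_def)

text \<open>Inside a Legendrian plane all computations take place in R^4: \<open>alpha\<close>
  vanishes on horizontal vectors, so \<open>hmetric\<close> is the Euclidean product of the first
  components, and the condition on the exterior derivative of \<open>alpha\<close> becomes
  \<open>omega = 0\<close>.\<close>

locale legendrian_plane =
  fixes p :: heis and P :: "heis set" and Z1 Z2 :: heis
  assumes onb: "is_onb p P Z1 Z2" and horizontal: "P \<subseteq> horiz p"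
    and isotropic: "omega (fst Z1) (fst Z2) = 0"
begin

lemma P_eq: "P = span {Z1, Z2}" and Z_in: "Z1 \<in> P" "Z2 \<in> P"
  using onb by (auto simp: is_onb_def intro: span_base)

lemma alpha_Z [simp]: "alpha p Z1 = 0" "alpha p Z2 = 0"
  using Z_in horizontal by (auto simp: horiz_eq)

lemma inner_Z [simp]: "fst Z1 \<bullet> fst Z1 = 1" "fst Z2 \<bullet> fst Z2 = 1" "fst Z1 \<bullet> fst Z2 = 0"
  "fst Z2 \<bullet> fst Z1 = 0"
  using onb by (auto simp: is_onb_def hmetric_def inner_commute)

lemma oproj_P: "oproj p P v = hmetric p v Z1 *\<^sub>R Z1 + hmetric p v Z2 *\<^sub>R Z2"
proof (rule oproj_eqI)
  show "subspace P" by (simp add: P_eq)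
  show "hmetric p v Z1 *\<^sub>R Z1 + hmetric p v Z2 *\<^sub>R Z2 \<in> P"
    using Z_in \<open>subspace P\<close> by (intro subspace_add subspace_scale)
  fix w assume "w \<in> P"
  then have "w \<in> span {Z1, Z2}" using P_eq by simp
  then show "hmetric p (v - (hmetric p v Z1 *\<^sub>R Z1 + hmetric p v Z2 *\<^sub>R Z2)) w = 0"
  proof (induction rule: span_induct_alt)
    case base
    then show ?case by (simp add: hmetric_simps)
  next
    case (step c x y)
    then show ?case using onb by (auto simp: hmetric_simps is_onb_def hmetric_commute[of p Z2 Z1])
  qed
qed

lemma hmetric_plane_grad:
  assumes "(f has_derivative D) (at p)" "(g has_derivative E) (at p)"
  shows "hmetric p (plane_grad P p f) (plane_grad P p g) = D Z1 * E Z1 + D Z2 * E Z2"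
  using onb unfolding plane_grad_def oproj_P hmetric_grad[OF assms(1)] hmetric_grad[OF assms(2)]
  by (simp add: hmetric_simps is_onb_def hmetric_commute[of p Z2 Z1])

text \<open>Isotropy makes \<open>JR (fst Z1)\<close> orthogonal to \<open>fst Z2\<close> and vice
  versa, so \<open>fst Z1\<close>, \<open>fst Z2\<close> and their images under \<open>JR\<close>
  are orthonormal. The vector \<open>r\<close> is what remains of \<open>y\<close> after projecting
  onto them, and the defect of the inequality is its squared length.\<close>

lemma Bessel:
  "(y \<bullet> fst Z1)\<^sup>2 + (y \<bullet> fst Z2)\<^sup>2 + (omega y (fst Z1))\<^sup>2 + (omega y (fst Z2))\<^sup>2 \<le> y \<bullet> y"
proof -
  define a1 a2 b1 b2 where ab: "a1 = y \<bullet> fst Z1" "a2 = y \<bullet> fst Z2"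
    "b1 = y \<bullet> JR (fst Z1)" "b2 = y \<bullet> JR (fst Z2)"
  define r where "r = y - a1 *\<^sub>R fst Z1 - a2 *\<^sub>R fst Z2 - b1 *\<^sub>R JR (fst Z1) - b2 *\<^sub>R JR (fst Z2)"
  have J: "JR (fst Z1) \<bullet> fst Z1 = 0" "JR (fst Z2) \<bullet> fst Z2 = 0"
    "JR (fst Z1) \<bullet> fst Z2 = 0" "JR (fst Z2) \<bullet> fst Z1 = 0"
    using isotropic omega_skew[of "fst Z2" "fst Z1"] by (simp_all flip: omega_eq_JR)
  have o: "r \<bullet> fst Z1 = 0" "r \<bullet> fst Z2 = 0" "r \<bullet> JR (fst Z1) = 0" "r \<bullet> JR (fst Z2) = 0"
    using J by (simp_all add: r_def inner_simps ab inner_commute[of "fst Z1" "JR _"]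
        inner_commute[of "fst Z2" "JR _"])
  have "r \<bullet> r = r \<bullet> (y - a1 *\<^sub>R fst Z1 - a2 *\<^sub>R fst Z2 - b1 *\<^sub>R JR (fst Z1) - b2 *\<^sub>R JR (fst Z2))"
    by (simp only: r_def)
  also have "\<dots> = r \<bullet> y"
    by (simp add: inner_diff_right o)
  also have "\<dots> = y \<bullet> y - a1\<^sup>2 - a2\<^sup>2 - b1\<^sup>2 - b2\<^sup>2"
    by (simp add: r_def inner_simps ab power2_eq_square inner_commute[of "fst Z1" y]
        inner_commute[of "fst Z2" y] inner_commute[of "JR _" y])
  finally have "a1\<^sup>2 + a2\<^sup>2 + b1\<^sup>2 + b2\<^sup>2 \<le> y \<bullet> y"
    using inner_ge_zero[of r] by linarith
  then show ?thesis by (simp add: ab inner_JR_right)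
qed

end

text \<open>Gram-Schmidt for \<open>hmetric\<close>, applied to a basis of the plane. It gives
  access to the locale at every point of the bundle.\<close>

lemma ex_legendrian_plane:
  assumes "(P, p) \<in> grass U"
  obtains Z1 Z2 where "legendrian_plane p P Z1 Z2"
proof -
  have P: "subspace P" "P \<subseteq> horiz p" "dim P = 2" "\<And>v w. v \<in> P \<Longrightarrow> w \<in> P \<Longrightarrow> omega (fst v) (fst w) = 0"
    using assms by (auto simp: grass_def ext_deriv_alpha)
  obtain B where B: "B \<subseteq> P" "independent B" "P \<subseteq> span B" "card B = 2"
    using basis_exists[of P] P(3) by metis
  then obtain b1 b2 where b: "B = {b1, b2}" "b1 \<noteq> b2"
    by (auto simp: card_2_iff)
  have span: "span {b1, b2} = P" using B b P(1) by (metis span_subspace)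
  have bP: "b1 \<in> P" "b2 \<in> P" using B b by auto
  have b1: "b1 \<noteq> 0" using B(2) b(1) dependent_zero by blast
  define n where "n v = sqrt (hmetric p v v)" for v
  have n2: "n v * n v = hmetric p v v" for v by (simp add: n_def hmetric_self_nonneg)
  have n0: "n v \<noteq> 0" if "v \<noteq> 0" for v using that by (simp add: n_def hmetric_self_eq_0)
  define Z1 where "Z1 = (1 / n b1) *\<^sub>R b1"
  define w where "w = b2 - hmetric p b2 Z1 *\<^sub>R Z1"
  have w: "w \<noteq> 0"
  proof
    assume "w = 0"
    then have "b2 = (hmetric p b2 Z1 / n b1) *\<^sub>R b1" by (simp add: w_def Z1_def)
    then have "b2 \<in> span {b1}" by (metis span_base span_scale singletonI)
    moreover have "B - {b2} = {b1}" using b by auto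
    ultimately show False using B(2) b(1) unfolding dependent_def by auto
  qed
  define Z2 where "Z2 = (1 / n w) *\<^sub>R w"
  have o: "hmetric p Z1 Z1 = 1" "hmetric p Z2 Z2 = 1"
    using n0[OF b1] n0[OF w] by (simp_all add: Z1_def Z2_def hmetric_simps flip: n2)
  have o': "hmetric p Z1 Z2 = 0"
    using o(1) by (simp add: Z2_def w_def hmetric_simps hmetric_commute[of p b2 Z1])
  have ZP: "Z1 \<in> P" "Z2 \<in> P"
    using bP P(1) by (auto simp: Z1_def Z2_def w_def intro!: subspace_scale subspace_diff)
  have "b1 = n b1 *\<^sub>R Z1" using n0[OF b1] by (simp add: Z1_def)
  then have 1: "b1 \<in> span {Z1, Z2}" by (metis span_base span_scale insertI1)
  have "b2 = n w *\<^sub>R Z2 + hmetric p b2 Z1 *\<^sub>R Z1" using n0[OF w] by (simp add: Z2_def w_def)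
  then have 2: "b2 \<in> span {Z1, Z2}" by (metis span_base span_scale span_add insertI1 insertI2)
  have "span {Z1, Z2} = P"
  proof
    show "span {Z1, Z2} \<subseteq> P" using ZP P(1) by (intro span_minimal) auto
    show "P \<subseteq> span {Z1, Z2}" unfolding span[symmetric] using 1 2 by (intro span_minimal) auto
  qed
  then have "legendrian_plane p P Z1 Z2"
    using o o' P ZP by unfold_locales (auto simp: is_onb_def)
  then show ?thesis by (rule that)
qed

text \<open>\<open>div_plane\<close> selects its basis by \<open>SOME\<close>, so the locale has to
  accept every orthonormal basis of the plane.\<close>

lemma legendrian_plane_of_onb:
  assumes "(P, p) \<in> grass U" "is_onb p P Z1 Z2"
  shows "legendrian_plane p P Z1 Z2"
proof
  have "Z1 \<in> P" "Z2 \<in> P" using assms(2) by (auto simp: is_onb_def intro: span_base)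
  then show "omega (fst Z1) (fst Z2) = 0"
    using assms(1) by (auto simp: grass_def ext_deriv_alpha)
qed (use assms in \<open>auto simp: grass_def\<close>)

lemma fst_JH: "fst (JH p v) = JR (fst v)"
  by (simp add: JH_def vec4_eq_iff X1_def Y1_def X2_def Y2_def axis_def)

lemma snd_JH: "snd (JH p v) = omega (fst p) (JR (fst v))"
  by (simp add: JH_def omega_def X1_def Y1_def X2_def Y2_def algebra_simps)

section \<open>Divergence of Hamiltonian vector fields\<close>


definition usq :: "heis \<Rightarrow> heis \<Rightarrow> real" where
  "usq q x = (fst x - fst q) \<bullet> (fst x - fst q)"

definition tph :: "heis \<Rightarrow> heis \<Rightarrow> real" where
  "tph q x = 2 * phi_at q x"

definition Dusq :: "heis \<Rightarrow> heis \<Rightarrow> heis \<Rightarrow> real" where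
  "Dusq q x v = 2 * ((fst x - fst q) \<bullet> fst v)"

definition Dtph :: "heis \<Rightarrow> heis \<Rightarrow> heis \<Rightarrow> real" where
  "Dtph q x v = 2 * (snd v - omega (fst q) (fst v))"

lemma tph_eq: "tph q x = 2 * (snd x - snd q - omega (fst q) (fst x))"
  by (simp add: tph_def phi_at_def hmult_def hinv_def omega_simps)

lemma bounded_linear_omega_right: "bounded_linear (omega a)"
  using bounded_bilinear_omega by (rule bounded_bilinear.bounded_linear_right)

lemma has_derivative_usq: "(usq q has_derivative Dusq q x) (at x)"
  unfolding usq_def[abs_def] Dusq_def[abs_def]
  by (auto intro!: derivative_eq_intros simp: inner_commute)

lemma has_derivative_tph: "(tph q has_derivative Dtph q x) (at x)"
  unfolding tph_eq[abs_def] Dtph_def[abs_def]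
  by (auto intro!: derivative_eq_intros bounded_linear.has_derivative[OF bounded_linear_omega_right])

text \<open>With y = \<open>fst x - fst q\<close>, the differentials of \<open>usq\<close> and
  \<open>tph\<close> are 2 <y, .> and 2 <J y, .> on horizontal vectors. The two functions are thus
  conjugate, with horizontal gradients of equal length.\<close>

lemma Dtph_eq_omega:
  assumes "alpha x v = 0"
  shows "Dtph q x v = 2 * omega (fst x - fst q) (fst v)"
  using assms by (simp add: Dtph_def alpha_def omega_simps)

text \<open>\<open>Bessel\<close> for y = \<open>fst p - fst q\<close>, multiplied by 4. The
  Legendrian condition enters the estimates through this inequality.\<close>

lemma (in legendrian_plane) Bessel_Dusq_Dtph:
  "(Dusq q p Z1)\<^sup>2 + (Dusq q p Z2)\<^sup>2 + (Dtph q p Z1)\<^sup>2 + (Dtph q p Z2)\<^sup>2 \<le> 4 * usq q p"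
  using Bessel[of "fst p - fst q"]
  by (simp add: Dusq_def Dtph_eq_omega usq_def power_mult_distrib)

text \<open>The horizontal gradient of F is 2 a y + 2 b J y with y = \<open>fst x - fst q\<close>,
  so the rotation only exchanges the two directions, up to sign; half of the result is
  \<open>w\<close>.\<close>

lemma ham_field_eq:
  assumes "(F has_derivative (\<lambda>v. a * Dusq q x v + b * Dtph q x v)) (at x)"
  defines "w \<equiv> a *\<^sub>R JR (fst x - fst q) - b *\<^sub>R (fst x - fst q)"
  shows "ham_field F x = (w, omega (fst x) w - F x)"
proof -
  define y where "y = fst x - fst q"
  have "fst (grad F x) = (2 * a) *\<^sub>R y + (2 * b) *\<^sub>R JR y"
  proof -
    have "(fst (grad F x) - ((2 * a) *\<^sub>R y + (2 * b) *\<^sub>R JR y)) \<bullet> w = 0" for w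
    proof -
      have "fst (grad F x) \<bullet> w = hmetric x (grad F x) (w, omega (fst x) w)"
        by (simp add: hmetric_def alpha_def)
      also have "\<dots> = a * Dusq q x (w, omega (fst x) w) + b * Dtph q x (w, omega (fst x) w)"
        by (rule hmetric_grad[OF assms(1)])
      also have "\<dots> = ((2 * a) *\<^sub>R y + (2 * b) *\<^sub>R JR y) \<bullet> w"
        by (simp add: Dusq_def Dtph_def y_def inner_simps omega_simps flip: omega_eq_JR)
          (simp add: algebra_simps)
      finally show ?thesis by (simp add: inner_simps)
    qed
    then show ?thesis by (metis inner_eq_zero_iff eq_iff_diff_eq_0)
  qed
  then have J: "JR (fst (grad F x)) = 2 *\<^sub>R w"
    by (simp add: w_def y_def vec4_eq_iff algebra_simps)
  show ?thesis
    unfolding ham_field_def oproj_horiz prod_eq_iff fst_JH snd_JH fst_scaleR snd_scaleR fst_diff snd_diff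
    by (simp add: J fst_JH snd_JH dphi_def omega_simps algebra_simps)
qed

text \<open>For horizontal unit vectors Z, the Christoffel term and the term with
  \<open>g1 p\<close> both carry the factor \<open>JR (fst Z) \<bullet> fst Z = 0\<close>. What
  survives is the variation of the two coefficients, and \<open>- g2 p\<close> once for each basis
  vector. The basis obtained is the one that \<open>div_plane\<close> selects.\<close>

lemma div_plane_ham_field:
  assumes P: "(P, p) \<in> grass U"
    and F: "\<And>x. (F has_derivative (\<lambda>v. g1 x * Dusq q x v + g2 x * Dtph q x v)) (at x)"
    and g: "(g1 has_derivative G1) (at p)" "(g2 has_derivative G2) (at p)"
  obtains Z1 Z2 where "legendrian_plane p P Z1 Z2"
    "div_plane P p (ham_field F) = (G1 Z1 * Dtph q p Z1 - G2 Z1 * Dusq q p Z1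
       + G1 Z2 * Dtph q p Z2 - G2 Z2 * Dusq q p Z2) / 2 - 2 * g2 p"
proof -
  let ?W = "ham_field F"
  define w where "w x = g1 x *\<^sub>R JR (fst x - fst q) - g2 x *\<^sub>R (fst x - fst q)" for x
  define w' where "w' v = (G1 v *\<^sub>R JR (fst p - fst q) + g1 p *\<^sub>R JR (fst v))
      - (G2 v *\<^sub>R (fst p - fst q) + g2 p *\<^sub>R fst v)" for v
  have W: "?W x = (w x, omega (fst x) (w x) - F x)" for x
    using ham_field_eq[OF F] by (simp add: w_def)
  have dJ: "((\<lambda>x::heis. JR (fst x - fst q)) has_derivative (\<lambda>v. JR (fst v))) (at p)"
    by (rule bounded_linear.has_derivative[OF bounded_linear_JR]) (auto intro!: derivative_eq_intros)
  have dw: "(w has_derivative w') (at p)"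
    unfolding w_def[abs_def] w'_def[abs_def]
    by (auto intro!: derivative_eq_intros g dJ simp: algebra_simps)
  have "((\<lambda>x. (w x, omega (fst x) (w x) - F x)) has_derivative
    (\<lambda>v. (w' v, (omega (fst p) (w' v) + omega (fst v) (w p)) - (g1 p * Dusq q p v + g2 p * Dtph q p v)))) (at p)"
    by (intro has_derivative_Pair has_derivative_diff F dw
        bounded_bilinear.FDERIV[OF bounded_bilinear_omega] has_derivative_fst has_derivative_ident)
  then have dW: "fst (frechet_derivative ?W (at p) v) = w' v" for v
    by (simp add: W[abs_def] frechet_derivative_at[symmetric])
  have cov: "hmetric p (cov_deriv ?W p Z) Z = w' Z \<bullet> fst Z" if "alpha p Z = 0" for Z
  proof -
    have "hmetric p (cov_deriv ?W p Z) Z = fst (cov_deriv ?W p Z) \<bullet> fst Z"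
      using that by (simp add: hmetric_def)
    also have "\<dots> = w' Z \<bullet> fst Z + alpha p (?W p) * (JR (fst Z) \<bullet> fst Z)"
      using that by (simp add: cov_deriv_def christoffel_eq dW fst_JH inner_simps)
    also have "JR (fst Z) \<bullet> fst Z = 0" by (simp flip: omega_eq_JR)
    finally show ?thesis by simp
  qed
  obtain Z1' Z2' where "legendrian_plane p P Z1' Z2'" using ex_legendrian_plane[OF P] .
  then have "\<exists>d Z1 Z2. is_onb p P Z1 Z2 \<and>
     d = hmetric p (cov_deriv ?W p Z1) Z1 + hmetric p (cov_deriv ?W p Z2) Z2"
    unfolding legendrian_plane_def by blast
  from someI_ex[OF this] obtain Z1 Z2 where Z: "is_onb p P Z1 Z2"
    "div_plane P p ?W = hmetric p (cov_deriv ?W p Z1) Z1 + hmetric p (cov_deriv ?W p Z2) Z2"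
    unfolding div_plane_def by blast
  interpret legendrian_plane p P Z1 Z2 using P Z(1) by (rule legendrian_plane_of_onb)
  have *: "w' Z \<bullet> fst Z = (G1 Z * Dtph q p Z - G2 Z * Dusq q p Z) / 2 - g2 p"
    if "alpha p Z = 0" "fst Z \<bullet> fst Z = 1" for Z
    using that unfolding w'_def Dtph_eq_omega[OF that(1)] Dusq_def
    by (simp add: inner_simps omega_simps algebra_simps flip: omega_eq_JR)
  show ?thesis
    by (rule that[OF legendrian_plane_axioms]) (simp add: Z(2) cov * add_divide_distrib diff_divide_distrib)
qed

section \<open>The divergence identity for cut-off angle functions\<close>


text \<open>\<open>rad u t\<close> is the square root of \<open>\<bar>u + i t\<bar>\<close>, so \<open>hnorm\<close> is \<open>rad (\<rho>\<^sup>2) (2 \<phi>)\<close>.\<close>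

definition rad :: "real \<Rightarrow> real \<Rightarrow> real" where
  "rad u t = root 4 (u\<^sup>2 + t\<^sup>2)"

section \<open>Differentials of the modulus and the argument of w\<close>

lemma rad_pow4: "rad u t ^ 4 = u\<^sup>2 + t\<^sup>2"
  by (simp add: rad_def)

lemma rad_nonneg [simp]: "rad u t \<ge> 0"
  by (simp add: rad_def)

lemma rad_pos: "u \<noteq> 0 \<or> t \<noteq> 0 \<Longrightarrow> rad u t > 0"
  by (simp add: rad_def sum_power2_gt_zero_iff)

lemma has_derivative_rad:
  fixes u t :: "'a::real_normed_vector \<Rightarrow> real"
  assumes "(u has_derivative u') (at x)" "(t has_derivative t') (at x)" "u x \<noteq> 0 \<or> t x \<noteq> 0"
  shows "((\<lambda>x. rad (u x) (t x)) has_derivative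
    (\<lambda>v. (u x * u' v + t x * t' v) / (2 * rad (u x) (t x) ^ 3))) (at x)"
proof -
  have pos: "(u x)\<^sup>2 + (t x)\<^sup>2 > 0" using assms(3) by (simp add: sum_power2_gt_zero_iff)
  have "(root 4 has_real_derivative inverse (real 4 * root 4 ((u x)\<^sup>2 + (t x)\<^sup>2) ^ (4 - Suc 0)))
      (at ((u x)\<^sup>2 + (t x)\<^sup>2))"
    using DERIV_real_root[of 4, OF _ pos] by simp
  moreover have "inverse (real 4 * root 4 ((u x)\<^sup>2 + (t x)\<^sup>2) ^ (4 - Suc 0)) = 1 / (4 * rad (u x) (t x) ^ 3)"
    by (simp add: rad_def inverse_eq_divide)
  ultimately have "(root 4 has_derivative (\<lambda>d. 1 / (4 * rad (u x) (t x) ^ 3) * d)) (at ((u x)\<^sup>2 + (t x)\<^sup>2))"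
    by (simp only: has_field_derivative_def)
  moreover have "((\<lambda>x. (u x)\<^sup>2 + (t x)\<^sup>2) has_derivative (\<lambda>v. 2 * (u x * u' v) + 2 * (t x * t' v))) (at x)"
    unfolding power2_eq_square
    by (rule has_derivative_eq_rhs[OF has_derivative_add[OF has_derivative_mult[OF assms(1,1)]
          has_derivative_mult[OF assms(2,2)]]]) (simp add: fun_eq_iff)
  ultimately have d: "((\<lambda>x. root 4 ((u x)\<^sup>2 + (t x)\<^sup>2)) has_derivative
      (\<lambda>v. 1 / (4 * rad (u x) (t x) ^ 3) * (2 * (u x * u' v) + 2 * (t x * t' v)))) (at x)"
    by (intro has_derivative_compose[of "\<lambda>x. (u x)\<^sup>2 + (t x)\<^sup>2" _ x UNIV "root 4"])
  have "1 / (4 * c) * (2 * a + 2 * b) = (a + b) / (2 * c)" for a b c :: real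
    by (cases "c = 0") (simp_all add: divide_simps)
  then show ?thesis
    using d by (simp only: rad_def)
qed

text \<open>This is d arg w = Im (conj w dw) / |w|^2 with |w| = r^2. The result has no
  \<open>u\<close> in the denominator, which lets the same formula hold on the vertical
  axis.\<close>

lemma has_derivative_arctan_divide:
  fixes u t :: "'a::real_normed_vector \<Rightarrow> real"
  assumes "(u has_derivative u') (at x)" "(t has_derivative t') (at x)" "u x \<noteq> 0"
  shows "((\<lambda>x. arctan (t x / u x)) has_derivative
    (\<lambda>v. (u x * t' v - t x * u' v) / rad (u x) (t x) ^ 4)) (at x)"
proof -
  have "(arctan has_derivative (\<lambda>d. d / (1 + (t x / u x)\<^sup>2))) (at (t x / u x))"
    using DERIV_arctan[of "t x / u x"]
    unfolding has_field_derivative_def by (rule has_derivative_eq_rhs) (simp add: fun_eq_iff field_simps)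
  moreover have "((\<lambda>x. t x / u x) has_derivative (\<lambda>v. (t' v * u x - t x * u' v) / (u x * u x))) (at x)"
    using has_derivative_divide'[OF assms(2,1,3)] .
  ultimately have d: "((\<lambda>x. arctan (t x / u x)) has_derivative
      (\<lambda>v. ((t' v * u x - t x * u' v) / (u x * u x)) / (1 + (t x / u x)\<^sup>2))) (at x)"
    by (intro has_derivative_compose[of "\<lambda>x. t x / u x" _ x UNIV arctan])
  have e: "u x * u x * (1 + (t x / u x)\<^sup>2) = rad (u x) (t x) ^ 4"
    using assms(3) by (simp add: rad_pow4 power2_eq_square field_simps)
  show ?thesis
    using d unfolding divide_divide_eq_left e by (simp only: mult.commute[of "u x"])
qed

text \<open>Scalar products of the plane gradients of \<open>r = rad u t\<close> and \<open>A = arctan (t / u)\<close>, where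
  \<open>p11, p12, p22\<close> are the scalar products of those of \<open>u\<close> and \<open>t\<close>. In this form they are visibly
  measurable on the bundle.\<close>

definition gr_rr :: "real \<Rightarrow> real \<Rightarrow> real \<Rightarrow> real \<Rightarrow> real \<Rightarrow> real" where
  "gr_rr u t p11 p12 p22 = (u\<^sup>2 * p11 + 2 * u * t * p12 + t\<^sup>2 * p22) / (4 * rad u t ^ 6)"

definition gr_AA :: "real \<Rightarrow> real \<Rightarrow> real \<Rightarrow> real \<Rightarrow> real \<Rightarrow> real" where
  "gr_AA u t p11 p12 p22 = (u\<^sup>2 * p22 - 2 * u * t * p12 + t\<^sup>2 * p11) / rad u t ^ 8"

definition gr_rA :: "real \<Rightarrow> real \<Rightarrow> real \<Rightarrow> real \<Rightarrow> real \<Rightarrow> real" where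
  "gr_rA u t p11 p12 p22 = ((u\<^sup>2 - t\<^sup>2) * p12 + u * t * (p22 - p11)) / (2 * rad u t ^ 7)"

text \<open>Along the two vectors of an orthonormal basis, \<open>a1\<close>, \<open>a2\<close> and
  \<open>b1\<close>, \<open>b2\<close> are the derivatives of u and t, \<open>h1\<close>,
  \<open>h2\<close> those of r and \<open>k1\<close>, \<open>k2\<close> those of A.\<close>

lemma gr_eqs:
  assumes "r = rad u t"
    and "h1 = (u * a1 + t * b1) / (2 * r ^ 3)" "h2 = (u * a2 + t * b2) / (2 * r ^ 3)"
    and "k1 = (u * b1 - t * a1) / r ^ 4" "k2 = (u * b2 - t * a2) / r ^ 4"
    and "p11 = a1 * a1 + a2 * a2" "p12 = a1 * b1 + a2 * b2" "p22 = b1 * b1 + b2 * b2"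
  shows "gr_rr u t p11 p12 p22 = h1 * h1 + h2 * h2"
    and "gr_AA u t p11 p12 p22 = k1 * k1 + k2 * k2"
    and "gr_rA u t p11 p12 p22 = h1 * k1 + h2 * k2"
proof -
  have m: "x / (2 * r ^ 3) * (y / (2 * r ^ 3)) = x * y / (4 * r ^ 6)" "x / r ^ 4 * (y / r ^ 4) = x * y / r ^ 8"
    "x / (2 * r ^ 3) * (y / r ^ 4) = x * y / (2 * r ^ 7)" for x y
    by (simp_all add: eval_nat_numeral)
  show "gr_rr u t p11 p12 p22 = h1 * h1 + h2 * h2"
    unfolding assms(2,3) m add_divide_distrib[symmetric]
    unfolding gr_rr_def assms(1,6-8)
    by (simp add: power2_eq_square algebra_simps)
  show "gr_AA u t p11 p12 p22 = k1 * k1 + k2 * k2"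
    unfolding assms(4,5) m add_divide_distrib[symmetric]
    unfolding gr_AA_def assms(1,6-8)
    by (simp add: power2_eq_square algebra_simps)
  show "gr_rA u t p11 p12 p22 = h1 * k1 + h2 * k2"
    unfolding assms(2-5) m add_divide_distrib[symmetric]
    unfolding gr_rA_def assms(1,6-8)
    by (simp add: power2_eq_square algebra_simps)
qed

text \<open>The three integrands of \<open>Theta\<close>, with \<open>c1\<close> and \<open>c2\<close> the first two derivatives of
  \<open>r \<mapsto> chi (r / a)\<close>; \<open>dens\<close> is minus the divergence of the Hamiltonian field of \<open>arctan (t / u)\<close>.\<close>

definition th1 :: "real \<Rightarrow> real \<Rightarrow> real \<Rightarrow> real \<Rightarrow> real \<Rightarrow> real \<Rightarrow> real" where
  "th1 u t p11 p12 p22 c1 = gr_rr u t p11 p12 p22 / rad u t * c1"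

definition th2 :: "real \<Rightarrow> real \<Rightarrow> real \<Rightarrow> real \<Rightarrow> real" where
  "th2 u t A c1 = t / rad u t ^ 3 * c1 * A"

definition th3 :: "real \<Rightarrow> real \<Rightarrow> real \<Rightarrow> real \<Rightarrow> real \<Rightarrow> real \<Rightarrow> real \<Rightarrow> real \<Rightarrow> real" where
  "th3 u t A p11 p12 p22 c1 c2 = rad u t * c1 * gr_AA u t p11 p12 p22
     + A * (rad u t * c2 - 3 * c1) * gr_rA u t p11 p12 p22"

definition dens :: "real \<Rightarrow> real \<Rightarrow> real \<Rightarrow> real \<Rightarrow> real \<Rightarrow> real" where
  "dens u t p11 p12 p22 = 2 * u / rad u t ^ 4 - 4 * gr_rr u t p11 p12 p22 / (rad u t)\<^sup>2
     + (p11 + p22) / (2 * rad u t ^ 4)"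

definition p_uu :: "heis \<Rightarrow> heis set \<times> heis \<Rightarrow> real" where
  "p_uu q = (\<lambda>(P, p). hmetric p (plane_grad P p (usq q)) (plane_grad P p (usq q)))"
definition p_ut :: "heis \<Rightarrow> heis set \<times> heis \<Rightarrow> real" where
  "p_ut q = (\<lambda>(P, p). hmetric p (plane_grad P p (usq q)) (plane_grad P p (tph q)))"
definition p_tt :: "heis \<Rightarrow> heis set \<times> heis \<Rightarrow> real" where
  "p_tt q = (\<lambda>(P, p). hmetric p (plane_grad P p (tph q)) (plane_grad P p (tph q)))"

lemma (in legendrian_plane) p_eqs:
  "p_uu q (P, p) = Dusq q p Z1 * Dusq q p Z1 + Dusq q p Z2 * Dusq q p Z2"
  "p_ut q (P, p) = Dusq q p Z1 * Dtph q p Z1 + Dusq q p Z2 * Dtph q p Z2"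
  "p_tt q (P, p) = Dtph q p Z1 * Dtph q p Z1 + Dtph q p Z2 * Dtph q p Z2"
  by (simp_all add: p_uu_def p_ut_def p_tt_def
      hmetric_plane_grad[OF has_derivative_usq has_derivative_usq]
      hmetric_plane_grad[OF has_derivative_usq has_derivative_tph]
      hmetric_plane_grad[OF has_derivative_tph has_derivative_tph])

lemma usq_nonneg [simp]: "usq q x \<ge> 0"
  by (simp add: usq_def)

lemma has_derivative_DERIV_compose:
  fixes f :: "'a::real_normed_vector \<Rightarrow> real"
  assumes "(g has_real_derivative c) (at (f x))" "(f has_derivative f') (at x)"
  shows "((\<lambda>x. g (f x)) has_derivative (\<lambda>v. c * f' v)) (at x)"
  using has_derivative_compose[OF assms(2), of g "(*) c"] assms(1)
  by (simp add: has_field_derivative_def)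

text \<open>Here a, b, H, K are the derivatives of u, t, r, A along one basis vector, and
  \<open>c0\<close>, \<open>c1\<close>, \<open>c2\<close> are G and its first two derivatives at r.
  Once the terms are collected, u and t occur only in the combinations u b - t a and u a + t b,
  which the hypotheses express by K and H.\<close>

lemma test_identity:
  fixes r :: real
  assumes r: "r \<noteq> 0" and K: "u * b - t * a = r ^ 4 * K" and H: "u * a + t * b = 2 * r ^ 3 * H"
  shows "((c2 * H * u / (2 * r ^ 3) + c1 * a / (2 * r ^ 3)
       - 3 * c1 * u * H / (2 * r ^ 4)) * A + c1 * u / (2 * r ^ 3) * K
     - c1 * H * t / r ^ 4 - c0 * b / r ^ 4 + 4 * c0 * t * H / r ^ 5) * b
     - ((c2 * H * t / (2 * r ^ 3) + c1 * b / (2 * r ^ 3)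
       - 3 * c1 * t * H / (2 * r ^ 4)) * A + c1 * t / (2 * r ^ 3) * K
     + c1 * H * u / r ^ 4 + c0 * a / r ^ 4 - 4 * c0 * u * H / r ^ 5) * a
    = c2 * A * H * K * r / 2 - 3 / 2 * c1 * A * H * K + c1 * K * K * r / 2
      - 2 * c1 * H * H / r - c0 * (a * a + b * b) / r ^ 4 + 8 * c0 * H * H / r\<^sup>2" (is "?l = ?r")
proof -
  have "?l = c2 * H * A / 2 * ((u * b - t * a) / r ^ 3) - 3 * c1 * H * A / 2 * ((u * b - t * a) / r ^ 4)
      + c1 * K / 2 * ((u * b - t * a) / r ^ 3)
      + 4 * c0 * H * ((u * a + t * b) / r ^ 5) - c1 * H * ((u * a + t * b) / r ^ 4)
      - c0 * (a * a + b * b) / r ^ 4"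
    by (simp add: algebra_simps add_divide_distrib diff_divide_distrib)
  also have "\<dots> = ?r"
  proof -
    have e: "(u * b - t * a) / r ^ 3 = r * K" "(u * b - t * a) / r ^ 4 = K"
    "(u * a + t * b) / r ^ 5 = 2 * H / r\<^sup>2" "(u * a + t * b) / r ^ 4 = 2 * H / r"
      unfolding K H using r by (simp_all add: divide_simps eval_nat_numeral)
    show ?thesis unfolding e by (simp add: algebra_simps)
  qed
  finally show ?thesis .
qed

text \<open>Write d(G(r) A) = g1 du + g2 dt and apply \<open>div_plane_ham_field\<close>. The term
  \<open>- 2 * g2 p\<close> yields \<open>th2\<close> and the first term of \<open>dens\<close>.
  Summing \<open>id\<close> over the basis yields the rest: G' H H forms \<open>th1\<close>, the
  products containing K form \<open>th3\<close>, and the terms with G complete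
  \<open>dens\<close>.\<close>

lemma div_plane_test:
  fixes q :: heis
  assumes P: "(P, p) \<in> grass U" and e: "e > 0"
    and G: "\<And>r. r > 0 \<Longrightarrow> (G has_real_derivative G' r) (at r)"
      "\<And>r. r > 0 \<Longrightarrow> (G' has_real_derivative G'' r) (at r)"
  defines "u \<equiv> usq q p + e" and "t \<equiv> tph q p"
  defines "r \<equiv> rad u t" and "A \<equiv> arctan (t / u)"
  shows "div_plane P p (ham_field (\<lambda>x. G (rad (usq q x + e) (tph q x)) * arctan (tph q x / (usq q x + e))))
     = - th1 u t (p_uu q (P, p)) (p_ut q (P, p)) (p_tt q (P, p)) (G' r)
       - th2 u t A (G' r)
       + 1 / 4 * th3 u t A (p_uu q (P, p)) (p_ut q (P, p)) (p_tt q (P, p)) (G' r) (G'' r)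
       - G r * dens u t (p_uu q (P, p)) (p_ut q (P, p)) (p_tt q (P, p))"
proof -
  define uf where "uf x = usq q x + e" for x
  define rf where "rf x = rad (uf x) (tph q x)" for x
  define Af where "Af x = arctan (tph q x / uf x)" for x
  have u_pos: "uf x > 0" for x using e by (simp add: uf_def add_nonneg_pos)
  have r_pos: "rf x > 0" for x using u_pos[of x] by (simp add: rf_def rad_pos)
  have du: "(uf has_derivative Dusq q x) (at x)" for x
    unfolding uf_def[abs_def] using has_derivative_add[OF has_derivative_usq has_derivative_const] by simp
  note dt = has_derivative_tph
  have dr: "(rf has_derivative (\<lambda>v. (uf x * Dusq q x v + tph q x * Dtph q x v) / (2 * rf x ^ 3))) (at x)" for x
    unfolding rf_def[abs_def] using u_pos[of x] by (intro has_derivative_rad du dt) simp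
  have dA: "(Af has_derivative (\<lambda>v. (uf x * Dtph q x v - tph q x * Dusq q x v) / rf x ^ 4)) (at x)" for x
    unfolding Af_def[abs_def] rf_def using u_pos[of x] by (intro has_derivative_arctan_divide du dt) simp
  note dG = has_derivative_DERIV_compose[OF G(1)[OF r_pos] dr]
  note dG' = has_derivative_DERIV_compose[OF G(2)[OF r_pos] dr]
  \<comment> \<open>The coefficients come from dr = (u du + t dt) / (2 r^3) and dA = (u dt - t du) /
    r^4. The reciprocal powers stay separate factors, to be differentiated by \<open>i3\<close> and
    \<open>i4\<close>.\<close>
  define g1 where "g1 x = G' (rf x) * uf x * (1 / (2 * rf x ^ 3)) * Af x - G (rf x) * tph q x * (1 / rf x ^ 4)" for x
  define g2 where "g2 x = G' (rf x) * tph q x * (1 / (2 * rf x ^ 3)) * Af x + G (rf x) * uf x * (1 / rf x ^ 4)" for x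
  have F: "((\<lambda>x. G (rf x) * Af x) has_derivative (\<lambda>v. g1 x * Dusq q x v + g2 x * Dtph q x v)) (at x)" for x
    by (rule has_derivative_eq_rhs[OF has_derivative_mult[OF dG dA]])
      (auto simp: fun_eq_iff g1_def g2_def add_divide_distrib diff_divide_distrib algebra_simps)
  define h where "h v = (uf p * Dusq q p v + tph q p * Dtph q p v) / (2 * rf p ^ 3)" for v
  define k where "k v = (uf p * Dtph q p v - tph q p * Dusq q p v) / rf p ^ 4" for v
  have rf0: "rf p \<noteq> 0" using r_pos[of p] by simp
  note d = dr[of p, folded h_def] dA[of p, folded k_def] dG[of p, folded h_def] dG'[of p, folded h_def] du[of p] dt[of q p]
  have i3: "((\<lambda>y. 1 / (2 * y ^ 3)) has_real_derivative - 3 / (2 * rf p ^ 4)) (at (rf p))"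
    by (rule derivative_eq_intros refl | (use rf0 in simp; fail))+
      (use rf0 in \<open>simp add: field_simps eval_nat_numeral\<close>)
  have i4: "((\<lambda>y. 1 / y ^ 4) has_real_derivative - 4 / rf p ^ 5) (at (rf p))"
    by (rule derivative_eq_intros refl | (use rf0 in simp; fail))+
      (use rf0 in \<open>simp add: field_simps eval_nat_numeral\<close>)
  note di = has_derivative_DERIV_compose[OF i3 d(1)] has_derivative_DERIV_compose[OF i4 d(1)]
  define c0 c1 c2 where c: "c0 = G (rf p)" "c1 = G' (rf p)" "c2 = G'' (rf p)"
  define L1 where "L1 v = (c2 * h v * uf p / (2 * rf p ^ 3) + c1 * Dusq q p v / (2 * rf p ^ 3)
       - 3 * c1 * uf p * h v / (2 * rf p ^ 4)) * Af p + c1 * uf p / (2 * rf p ^ 3) * k v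
     - c1 * h v * tph q p / rf p ^ 4 - c0 * Dtph q p v / rf p ^ 4 + 4 * c0 * tph q p * h v / rf p ^ 5" for v
  define L2 where "L2 v = (c2 * h v * tph q p / (2 * rf p ^ 3) + c1 * Dtph q p v / (2 * rf p ^ 3)
       - 3 * c1 * tph q p * h v / (2 * rf p ^ 4)) * Af p + c1 * tph q p / (2 * rf p ^ 3) * k v
     + c1 * h v * uf p / rf p ^ 4 + c0 * Dusq q p v / rf p ^ 4 - 4 * c0 * uf p * h v / rf p ^ 5" for v
  have g1': "(g1 has_derivative L1) (at p)"
    unfolding g1_def[abs_def] L1_def[abs_def]
    by (rule has_derivative_eq_rhs, (rule has_derivative_add has_derivative_diff has_derivative_mult d di)+)
      (simp add: fun_eq_iff c algebra_simps add_divide_distrib diff_divide_distrib)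
  have g2': "(g2 has_derivative L2) (at p)"
    unfolding g2_def[abs_def] L2_def[abs_def]
    by (rule has_derivative_eq_rhs, (rule has_derivative_add has_derivative_diff has_derivative_mult d di)+)
      (simp add: fun_eq_iff c algebra_simps add_divide_distrib diff_divide_distrib)
  obtain Z1 Z2 where Z: "legendrian_plane p P Z1 Z2" and div:
    "div_plane P p (ham_field (\<lambda>x. G (rf x) * Af x)) = (L1 Z1 * Dtph q p Z1 - L2 Z1 * Dusq q p Z1
       + L1 Z2 * Dtph q p Z2 - L2 Z2 * Dusq q p Z2) / 2 - 2 * g2 p"
    by (rule div_plane_ham_field[OF P F g1' g2'])
  have id: "L1 v * Dtph q p v - L2 v * Dusq q p v
    = c2 * Af p * h v * k v * rf p / 2 - 3 / 2 * c1 * Af p * h v * k v + c1 * k v * k v * rf p / 2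
      - 2 * c1 * h v * h v / rf p - c0 * (Dusq q p v * Dusq q p v + Dtph q p v * Dtph q p v) / rf p ^ 4
      + 8 * c0 * h v * h v / (rf p)\<^sup>2" (is "_ = ?r") for v
    unfolding L1_def L2_def
    by (rule test_identity) (use rf0 in \<open>simp_all add: h_def k_def\<close>)
  interpret legendrian_plane p P Z1 Z2 by (rule Z)
  have g: "gr_rr (uf p) (tph q p) (p_uu q (P, p)) (p_ut q (P, p)) (p_tt q (P, p)) = h Z1 * h Z1 + h Z2 * h Z2"
    "gr_AA (uf p) (tph q p) (p_uu q (P, p)) (p_ut q (P, p)) (p_tt q (P, p)) = k Z1 * k Z1 + k Z2 * k Z2"
    "gr_rA (uf p) (tph q p) (p_uu q (P, p)) (p_ut q (P, p)) (p_tt q (P, p)) = h Z1 * k Z1 + h Z2 * k Z2"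
    using gr_eqs[OF rf_def h_def h_def k_def k_def p_eqs] .
  have ut: "u = uf p" "t = tph q p" "r = rf p" "A = Af p"
    by (simp_all add: u_def t_def r_def A_def uf_def rf_def Af_def)
  have rr: "rad (uf p) (tph q p) = rf p" by (simp add: rf_def)
  have "div_plane P p (ham_field (\<lambda>x. G (rf x) * Af x))
     = - th1 u t (p_uu q (P, p)) (p_ut q (P, p)) (p_tt q (P, p)) (G' r)
       - th2 u t A (G' r)
       + 1 / 4 * th3 u t A (p_uu q (P, p)) (p_ut q (P, p)) (p_tt q (P, p)) (G' r) (G'' r)
       - G r * dens u t (p_uu q (P, p)) (p_ut q (P, p)) (p_tt q (P, p))"
  proof -
    have "div_plane P p (ham_field (\<lambda>x. G (rf x) * Af x)) = ((L1 Z1 * Dtph q p Z1 - L2 Z1 * Dusq q p Z1)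
       + (L1 Z2 * Dtph q p Z2 - L2 Z2 * Dusq q p Z2)) / 2 - 2 * g2 p"
      by (simp add: div)
    also have "\<dots> = - th1 u t (p_uu q (P, p)) (p_ut q (P, p)) (p_tt q (P, p)) (G' r)
       - th2 u t A (G' r)
       + 1 / 4 * th3 u t A (p_uu q (P, p)) (p_ut q (P, p)) (p_tt q (P, p)) (G' r) (G'' r)
       - G r * dens u t (p_uu q (P, p)) (p_ut q (P, p)) (p_tt q (P, p))"
      unfolding id th1_def th2_def th3_def dens_def ut g rr g2_def c[symmetric]
      unfolding p_eqs
      by (simp add: algebra_simps add_divide_distrib diff_divide_distrib)
    finally show ?thesis .
  qed
  then show ?thesis by (simp add: uf_def rf_def Af_def)
qed

section \<open>Radon measures on the Legendrian Grassmannian\<close>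


definition grass_chart :: "heis set \<times> heis \<Rightarrow> (heis \<Rightarrow>\<^sub>L heis) \<times> heis" where
  "grass_chart = (\<lambda>(P, p). (Blinfun (oproj p P), p))"

lemma grass_topology_eq: "grass_topology U = pullback_topology (grass U) grass_chart euclidean"
  by (simp add: grass_topology_def grass_chart_def)

text \<open>Converse of \<open>ex_legendrian_plane\<close>: \<open>L\<close> is the isometry of R^4
  onto the horizontal space at p, so isotropic orthonormal pairs of R^4 lift to bases of Legendrian
  planes.\<close>

lemma hlift_legendrian_plane:
  fixes p :: heis
  defines "L \<equiv> \<lambda>w. (w, omega (fst p) w)"
  assumes "w1 \<bullet> w1 = 1" "w2 \<bullet> w2 = 1" "w1 \<bullet> w2 = 0" "omega w1 w2 = 0"
  shows "legendrian_plane p (span {L w1, L w2}) (L w1) (L w2)"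
    and "(span {L w1, L w2}, p) \<in> grass UNIV"
proof -
  have a [simp]: "alpha p (L w) = 0" for w by (simp add: alpha_def L_def)
  have h: "hmetric p (L v) (L w) = v \<bullet> w" for v w by (simp add: hmetric_def alpha_def L_def)
  have fL [simp]: "fst (L w) = w" for w by (simp add: L_def)
  have "span {L w1, L w2} \<subseteq> {v. alpha p v = 0}"
    by (rule span_minimal) (auto simp: subspace_def)
  then have hor: "span {L w1, L w2} \<subseteq> horiz p" by (simp add: horiz_eq)
  then show lp: "legendrian_plane p (span {L w1, L w2}) (L w1) (L w2)"
    using assms(2-5) by unfold_locales (auto simp: is_onb_def h)
  have "L w1 \<notin> span {L w2}"
  proof
    assume "L w1 \<in> span {L w2}"
    then obtain k where "L w1 = k *\<^sub>R L w2" by (auto simp: span_singleton)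
    then have k: "w1 = k *\<^sub>R w2" using fL by (metis fst_scaleR)
    then have "w1 \<bullet> w1 = 0" using assms(4) by simp
    then show False using assms(2) by simp
  qed
  moreover have "L w2 \<noteq> 0" using assms(3) fL[of w2] by (metis fst_zero inner_zero_left zero_neq_one)
  ultimately have "independent {L w1, L w2}" "card {L w1, L w2} = 2"
    by (auto simp: independent_insert card_insert_if intro: span_base)
  then have "dim (span {L w1, L w2}) = 2"
    by (metis dim_span dim_eq_card_independent)
  moreover have "omega (fst v) (fst w) = 0" if "v \<in> span {L w1, L w2}" "w \<in> span {L w1, L w2}" for v w
  proof -
    have 1: "omega (fst v) (fst z) = 0" if "z \<in> {L w1, L w2}" for z
    proof -
      have "span {L w1, L w2} \<subseteq> {v. omega (fst v) (fst z) = 0}"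
        using that assms(5) omega_skew[of w2 w1]
        by (intro span_minimal) (auto simp: subspace_def omega_simps)
      then show ?thesis using \<open>v \<in> _\<close> by auto
    qed
    have "span {L w1, L w2} \<subseteq> {w. omega (fst v) (fst w) = 0}"
      using 1[of "L w1"] 1[of "L w2"] by (intro span_minimal) (auto simp: subspace_def omega_simps)
    then show ?thesis using that by auto
  qed
  ultimately show "(span {L w1, L w2}, p) \<in> grass UNIV"
    using hor by (auto simp: grass_def ext_deriv_alpha)
qed

text \<open>\<open>Blinfun\<close> has a meaning only for bounded linear arguments, so the
  projection is exhibited as one. As \<open>alpha\<close> kills the basis, the metric product with
  \<open>Z1\<close> is the Euclidean product with \<open>(fst Z1, 0)\<close>; the formula therefore
  depends continuously on the basis.\<close>

lemma (in legendrian_plane) blinfun_oproj: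
  "blinfun_apply (Blinfun (oproj p P)) = oproj p P"
  "Blinfun (oproj p P) = (blinfun_scaleR_left Z1 o\<^sub>L blinfun_inner_left (fst Z1, 0))
     + (blinfun_scaleR_left Z2 o\<^sub>L blinfun_inner_left (fst Z2, 0))"
proof -
  let ?B = "(blinfun_scaleR_left Z1 o\<^sub>L blinfun_inner_left (fst Z1, 0))
     + (blinfun_scaleR_left Z2 o\<^sub>L blinfun_inner_left (fst Z2, 0))"
  have "oproj p P = blinfun_apply ?B"
    by (rule ext) (simp add: oproj_P hmetric_def blinfun.add_left inner_prod_def)
  then show "Blinfun (oproj p P) = ?B" by (simp add: blinfun_apply_inverse)
  then show "blinfun_apply (Blinfun (oproj p P)) = oproj p P"
    using \<open>oproj p P = blinfun_apply ?B\<close> by simp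
qed

text \<open>The bundle over \<open>K\<close> is a continuous image of the compact set of isotropic orthonormal pairs
  in \<open>\<real>\<^sup>4\<close>, lifted horizontally at the points of \<open>K\<close>.\<close>

lemma compactin_grass:
  assumes "compact K"
  shows "compactin (grass_topology UNIV) (grass K)"
proof -
  define S where "S = (sphere (0 :: real ^ 4) 1 \<times> sphere (0 :: real ^ 4) 1 \<times> K)
    \<inter> {(w1, w2, p). w1 \<bullet> w2 = 0 \<and> omega w1 w2 = 0}"
  define L where "L p w = (w, omega (fst p) w)" for p :: heis and w
  define g where "g = (\<lambda>(w1, w2, p). (span {L p w1, L p w2}, p))"
  have cont_omega: "continuous_on X (\<lambda>x. omega (f x) (h x))"
    if "continuous_on X f" "continuous_on X h" for f h and X :: "'x::topological_space set"
    using that by (rule bounded_bilinear.continuous_on[OF bounded_bilinear_omega])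
  have "closed {x :: (real ^ 4) \<times> (real ^ 4) \<times> heis. fst x \<bullet> fst (snd x) = 0 \<and> omega (fst x) (fst (snd x)) = 0}"
    by (intro closed_Collect_conj closed_Collect_eq continuous_intros cont_omega)
  then have S: "compact S"
    unfolding S_def using assms
    by (intro compact_Int_closed compact_Times) (auto simp: case_prod_unfold)
  have lp: "legendrian_plane p (span {L p w1, L p w2}) (L p w1) (L p w2)"
    "(span {L p w1, L p w2}, p) \<in> grass UNIV" if "(w1, w2, p) \<in> S" for w1 w2 p
    using hlift_legendrian_plane[of w1 w2 p] that by (auto simp: S_def L_def norm_eq_1)
  define h where "h = (\<lambda>(w1, w2, p). ((blinfun_scaleR_left (L p w1) o\<^sub>L blinfun_inner_left (w1, 0 :: real))
     + (blinfun_scaleR_left (L p w2) o\<^sub>L blinfun_inner_left (w2, 0 :: real)), p :: heis))"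
  have "grass_chart (g x) = h x" if "x \<in> S" for x
    using that legendrian_plane.blinfun_oproj(2)[OF lp(1)]
    by (cases x) (auto simp: grass_chart_def g_def h_def L_def)
  moreover have "continuous_on S h"
    unfolding h_def L_def case_prod_unfold
    by (intro continuous_intros cont_omega bounded_bilinear.continuous_on[OF bounded_bilinear_blinfun_compose]
        bounded_linear.continuous_on[OF bounded_linear_blinfun_scaleR_left]
        bounded_linear.continuous_on[OF bounded_linear_blinfun_inner_left])
  ultimately have "continuous_on S (grass_chart \<circ> g)"
    by (simp cong: continuous_on_cong)
  then have "continuous_map (top_of_set S) (grass_topology UNIV) g"
    unfolding grass_topology_eq
    by (intro continuous_map_pullback') (auto simp: g_def lp)
  moreover have "compactin (top_of_set S) S" using S by (simp add: compactin_subtopology)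
  ultimately have "compactin (grass_topology UNIV) (g ` S)"
    by (rule image_compactin[rotated])
  moreover have "g ` S = grass K"
  proof
    show "g ` S \<subseteq> grass K"
      using lp by (force simp: g_def grass_def S_def)
    show "grass K \<subseteq> g ` S"
    proof safe
      fix P p assume P: "(P, p) \<in> grass K"
      obtain Z1 Z2 where "legendrian_plane p P Z1 Z2" using ex_legendrian_plane[OF P] .
      then interpret legendrian_plane p P Z1 Z2 .
      have Z: "L p (fst Z1) = Z1" "L p (fst Z2) = Z2"
        using alpha_Z by (auto simp: L_def alpha_def prod_eq_iff)
      have "(fst Z1, fst Z2, p) \<in> S"
        using P isotropic by (auto simp: S_def norm_eq_1 grass_def)
      moreover have "g (fst Z1, fst Z2, p) = (P, p)"
        by (simp add: g_def Z P_eq)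
      ultimately show "(P, p) \<in> g ` S" by force
    qed
  qed
  ultimately show ?thesis by simp
qed

lemma test_functionI:
  assumes "compact K" "{x. F x \<noteq> 0} \<subseteq> K" "smooth_on UNIV F"
  shows "F \<in> test_functions UNIV"
  using assms by (auto simp: test_functions_def intro: compact_closure[THEN iffD2] bounded_subset[OF compact_imp_bounded])

section \<open>Measurability and local finiteness on the bundle\<close>

locale grass_radon =
  fixes v :: "(heis set \<times> heis) measure"
  assumes radon: "radon_on_grass UNIV v"
begin

lemma space_v: "space v = grass UNIV"
  using radon by (simp add: radon_on_grass_def)

lemma sets_v: "openin (grass_topology UNIV) A \<Longrightarrow> A \<in> sets v"
  using radon by (auto simp: radon_on_grass_def)

lemma measurable_grass_chart: "grass_chart \<in> borel_measurable v"
proof (rule borel_measurableI)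
  fix S :: "((heis \<Rightarrow>\<^sub>L heis) \<times> heis) set" assume "open S"
  then show "grass_chart -` S \<inter> space v \<in> sets v"
    by (intro sets_v) (auto simp: space_v grass_topology_eq openin_pullback_topology)
qed

lemma measurable_snd_v: "snd \<in> borel_measurable v"
proof -
  have "(\<lambda>x. snd (grass_chart x)) \<in> borel_measurable v"
    by (rule measurable_compose[OF measurable_grass_chart])
      (auto intro!: borel_measurable_continuous_onI continuous_intros)
  then show ?thesis by (simp add: grass_chart_def case_prod_unfold)
qed

lemma measurable_base:
  fixes f :: "heis \<Rightarrow> real"
  assumes "continuous_on UNIV f"
  shows "(\<lambda>x. f (snd x)) \<in> borel_measurable v"
  using measurable_compose[OF measurable_snd_v borel_measurable_continuous_onI[OF assms]] .

text \<open>On the bundle \<open>oproj p P\<close> is the linear map \<open>B\<close> that the chart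
  records, and the pairing is a continuous function of \<open>B\<close> and p.\<close>

lemma measurable_oproj_pairing:
  assumes "continuous_on UNIV V" "continuous_on UNIV W"
  shows "(\<lambda>(P, p). hmetric p (oproj p P (V p)) (oproj p P (W p))) \<in> borel_measurable v"
proof -
  define H where "H = (\<lambda>(B :: heis \<Rightarrow>\<^sub>L heis, p). hmetric p (B (V p)) (B (W p)))"
  have c: "continuous_on UNIV (\<lambda>x :: (heis \<Rightarrow>\<^sub>L heis) \<times> heis. V (snd x))"
    "continuous_on UNIV (\<lambda>x :: (heis \<Rightarrow>\<^sub>L heis) \<times> heis. W (snd x))"
    using assms[THEN continuous_on_compose2, OF continuous_on_snd[OF continuous_on_id]] by auto
  have "continuous_on UNIV H"
    unfolding H_def case_prod_unfold hmetric_def alpha_def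
    by (intro continuous_intros c bounded_bilinear.continuous_on[OF bounded_bilinear_omega])
  then have "(\<lambda>x. H (grass_chart x)) \<in> borel_measurable v"
    by (intro measurable_compose[OF measurable_grass_chart] borel_measurable_continuous_onI)
  moreover have "H (grass_chart x) = (\<lambda>(P, p). hmetric p (oproj p P (V p)) (oproj p P (W p))) x"
    if "x \<in> space v" for x
  proof -
    obtain P p where Pair: "x = (P, p)" by (cases x) auto
    then have "(P, p) \<in> grass UNIV" using that by (simp add: space_v)
    then obtain Z1 Z2 where "legendrian_plane p P Z1 Z2" by (rule ex_legendrian_plane)
    then show ?thesis
      using legendrian_plane.blinfun_oproj(1) by (simp add: Pair H_def grass_chart_def)
  qed
  ultimately show ?thesis by (simp cong: measurable_cong)
qed

lemma finite_measure_over_compact: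
  assumes "compact K"
  shows "emeasure v (snd -` K \<inter> space v) < \<infinity>"
proof -
  have "snd -` K \<inter> space v = grass K"
    by (auto simp: space_v grass_def)
  then show ?thesis
    using radon compactin_grass[OF assms] by (simp add: radon_on_grass_def)
qed

end

lemma grad_eqI:
  assumes "(f has_derivative D) (at p)" "\<And>w. hmetric p g w = D w"
  shows "grad f p = g"
  by (rule metric_nondegenerate[of p]) (simp add: hmetric_grad[OF assms(1)] assms(2))

lemma grad_usq: "grad (usq q) p = (2 *\<^sub>R (fst p - fst q), omega (fst p) (2 *\<^sub>R (fst p - fst q)))"
  by (rule grad_eqI[OF has_derivative_usq]) (simp add: hmetric_def alpha_def Dusq_def)

lemma grad_tph: "grad (tph q) p = (2 *\<^sub>R JR (fst p - fst q), omega (fst p) (2 *\<^sub>R JR (fst p - fst q)) + 2)"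
  by (rule grad_eqI[OF has_derivative_tph])
    (simp add: hmetric_def alpha_def Dtph_def omega_simps flip: omega_eq_JR)

context grass_radon
begin

lemma measurable_p:
  "p_uu q \<in> borel_measurable v" "p_ut q \<in> borel_measurable v" "p_tt q \<in> borel_measurable v"
proof -
  note cJ = bounded_linear.continuous_on[OF bounded_linear_JR]
    and co = bounded_bilinear.continuous_on[OF bounded_bilinear_omega]
  have c: "continuous_on UNIV (grad (usq q))" "continuous_on UNIV (grad (tph q))"
    unfolding grad_usq[abs_def] grad_tph[abs_def] by (intro continuous_intros cJ co)+
  show "p_uu q \<in> borel_measurable v" "p_ut q \<in> borel_measurable v" "p_tt q \<in> borel_measurable v"
    unfolding p_uu_def p_ut_def p_tt_def plane_grad_def
    by (intro measurable_oproj_pairing c)+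
qed

end

section \<open>Bounds and derivatives of the gauge and the angle\<close>


text \<open>All bounds rest on |grad r|^2 + r^2 / 4 |grad A|^2 = (puu + ptt) / (4 r^2) \<le> u / r^2
  \<le> 1. The lower bound on \<open>dens\<close> uses the same inequality puu + ptt \<le> 4 u;
  there e \<ge> 0 only enlarges u.\<close>

lemma (in legendrian_plane) gr_bounds:
  fixes q :: heis
  assumes e: "e \<ge> 0"
  defines "u \<equiv> usq q p + e" and "t \<equiv> tph q p"
  defines "r \<equiv> rad u t"
  defines "puu \<equiv> p_uu q (P, p)" and "put \<equiv> p_ut q (P, p)" and "ptt \<equiv> p_tt q (P, p)"
  assumes r: "r > 0"
  shows "0 \<le> gr_rr u t puu put ptt" "gr_rr u t puu put ptt \<le> 1"
    "0 \<le> gr_AA u t puu put ptt" "gr_AA u t puu put ptt \<le> 4 / r\<^sup>2"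
    "\<bar>gr_rA u t puu put ptt\<bar> \<le> 1 / r"
    "gr_AA u t puu put ptt \<le> dens u t puu put ptt" "dens u t puu put ptt \<le> 4 / r\<^sup>2"
proof -
  define h where "h v = (u * Dusq q p v + t * Dtph q p v) / (2 * r ^ 3)" for v
  define k where "k v = (u * Dtph q p v - t * Dusq q p v) / r ^ 4" for v
  have g: "gr_rr u t puu put ptt = h Z1 * h Z1 + h Z2 * h Z2"
    "gr_AA u t puu put ptt = k Z1 * k Z1 + k Z2 * k Z2"
    "gr_rA u t puu put ptt = h Z1 * k Z1 + h Z2 * k Z2"
    using gr_eqs[OF r_def[THEN meta_eq_to_obj_eq] h_def h_def k_def k_def p_eqs] unfolding puu_def put_def ptt_def .
  have N: "r ^ 4 = u\<^sup>2 + t\<^sup>2" by (simp add: r_def rad_pow4)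
  have u: "usq q p \<le> u" "0 \<le> u" using e by (auto simp: u_def)
  have ur: "u \<le> r\<^sup>2"
    by (rule power2_le_imp_le) (use N in \<open>simp_all flip: power_mult\<close>)
  \<comment> \<open>As d log w = 2 dr / r + i dA, both sides are |dw|^2 / (4 r^2) along v.\<close>
  have sq: "h v * h v + r\<^sup>2 / 4 * (k v * k v) = (Dusq q p v * Dusq q p v + Dtph q p v * Dtph q p v) / (4 * r\<^sup>2)" for v
  proof -
    define a b where ab: "a = Dusq q p v" "b = Dtph q p v"
    have "h v * h v + r\<^sup>2 / 4 * (k v * k v) = ((u * a + t * b)\<^sup>2 + (u * b - t * a)\<^sup>2) / (4 * r ^ 6)"
      using r unfolding h_def k_def ab[symmetric] by (simp add: field_simps eval_nat_numeral)
    also have "(u * a + t * b)\<^sup>2 + (u * b - t * a)\<^sup>2 = r ^ 4 * (a * a + b * b)"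
      unfolding N by (simp add: power2_eq_square algebra_simps)
    also have "r ^ 4 * (a * a + b * b) / (4 * r ^ 6) = (a * a + b * b) / (4 * r\<^sup>2)"
      using r by (simp add: divide_simps eval_nat_numeral)
    finally show ?thesis by (simp add: ab)
  qed
  have p: "puu + ptt \<le> 4 * u"
    using Bessel_Dusq_Dtph[of q] u(1) by (simp add: puu_def ptt_def p_eqs power2_eq_square)
  have S: "gr_rr u t puu put ptt + r\<^sup>2 / 4 * gr_AA u t puu put ptt = (puu + ptt) / (4 * r\<^sup>2)"
    using sq[of Z1] sq[of Z2] unfolding g by (simp add: puu_def ptt_def p_eqs add_divide_distrib algebra_simps)
  also have "\<dots> \<le> 1"
    using p ur r by (simp add: divide_le_eq)
  finally have S1: "gr_rr u t puu put ptt + r\<^sup>2 / 4 * gr_AA u t puu put ptt \<le> 1" .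
  show rr: "0 \<le> gr_rr u t puu put ptt" and AA: "0 \<le> gr_AA u t puu put ptt"
    unfolding g by simp_all
  then have "0 \<le> r\<^sup>2 / 4 * gr_AA u t puu put ptt" by simp
  with S1 show "gr_rr u t puu put ptt \<le> 1" by linarith
  have "r\<^sup>2 / 4 * gr_AA u t puu put ptt \<le> 1" using S1 rr by linarith
  then show "gr_AA u t puu put ptt \<le> 4 / r\<^sup>2" using r by (simp add: field_simps)
  \<comment> \<open>The weight r / 2 is chosen so that the right-hand side is the combination
    bounded in \<open>S1\<close>.\<close>
  have hk: "r * \<bar>h v * k v\<bar> \<le> h v * h v + r\<^sup>2 / 4 * (k v * k v)" for v
  proof -
    have "0 \<le> (\<bar>h v\<bar> - r / 2 * \<bar>k v\<bar>)\<^sup>2" by simp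
    also have "\<dots> = h v * h v + r\<^sup>2 / 4 * (k v * k v) - r * \<bar>h v * k v\<bar>"
      by (simp add: power2_eq_square algebra_simps abs_mult)
    finally show ?thesis by simp
  qed
  have "r * \<bar>gr_rA u t puu put ptt\<bar> \<le> r * \<bar>h Z1 * k Z1\<bar> + r * \<bar>h Z2 * k Z2\<bar>"
    unfolding g distrib_left[symmetric] using r by (intro mult_left_mono abs_triangle_ineq) simp
  also have "\<dots> \<le> 1" using hk[of Z1] hk[of Z2] S1 unfolding g by (simp add: algebra_simps)
  finally show "\<bar>gr_rA u t puu put ptt\<bar> \<le> 1 / r" using r by (simp add: field_simps)
  \<comment> \<open>The excess of \<open>dens\<close> over \<open>gr_AA\<close> is a multiple of the
    defect 4 u - (puu + ptt), which \<open>p\<close> shows to be nonnegative.\<close>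
  have d: "dens u t puu put ptt = gr_AA u t puu put ptt + (4 * u - (puu + ptt)) / (2 * r ^ 4)"
  proof -
    have "gr_AA u t puu put ptt = (puu + ptt) / r ^ 4 - 4 * gr_rr u t puu put ptt / r\<^sup>2"
    proof -
      have "gr_AA u t puu put ptt = 4 / r\<^sup>2 * (r\<^sup>2 / 4 * gr_AA u t puu put ptt)" using r by simp
      also have "r\<^sup>2 / 4 * gr_AA u t puu put ptt = (puu + ptt) / (4 * r\<^sup>2) - gr_rr u t puu put ptt"
        using S by linarith
      also have "4 / r\<^sup>2 * \<dots> = (puu + ptt) / r ^ 4 - 4 * gr_rr u t puu put ptt / r\<^sup>2"
        using r by (simp add: field_simps eval_nat_numeral)
      finally show ?thesis .
    qed
    then show ?thesis
      unfolding dens_def r_def[symmetric] by (simp add: add_divide_distrib diff_divide_distrib)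
  qed
  show "gr_AA u t puu put ptt \<le> dens u t puu put ptt"
    unfolding d using p r by simp
  have "dens u t puu put ptt \<le> 2 * u / r ^ 4 + (puu + ptt) / (2 * r ^ 4)"
    unfolding dens_def r_def[symmetric] using rr by simp
  also have "\<dots> \<le> 2 * u / r ^ 4 + 4 * u / (2 * r ^ 4)"
    using p r by (intro add_left_mono divide_right_mono) auto
  also have "\<dots> = 4 * (u / r ^ 4)" by simp
  also have "\<dots> \<le> 4 * (r\<^sup>2 / r ^ 4)"
    using ur r by (intro mult_left_mono divide_right_mono) auto
  also have "\<dots> = 4 / r\<^sup>2" using r by (simp add: field_simps eval_nat_numeral)
  finally show "dens u t puu put ptt \<le> 4 / r\<^sup>2" .
qed

lemma abs_t_le_rad: "\<bar>t\<bar> \<le> (rad u t)\<^sup>2"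
  by (rule power2_le_imp_le) (use rad_pow4[of u t] in \<open>simp_all flip: power_mult\<close>)

lemma rad_mono: "0 \<le> u \<Longrightarrow> u \<le> u' \<Longrightarrow> rad u t \<le> rad u' t"
  by (simp add: rad_def power_mono)

lemma hnorm_at_eq: "hnorm_at q x = rad (usq q x) (tph q x)"
proof -
  have "norm (fst (hmult (hinv q) x)) ^ 4 = (usq q x)\<^sup>2"
    by (simp add: usq_def hmult_def hinv_def power2_norm_eq_inner[symmetric] flip: power_mult)
  then show ?thesis by (simp add: hnorm_at_def hnorm_def rad_def tph_def phi_at_def power2_eq_square)
qed

section \<open>The angle across the vertical axis\<close>

lemma arctan_sigma_at_eq1:
  assumes "usq q x \<noteq> 0"
  shows "arctan_sigma_at q x = arctan (tph q x / usq q x)"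
proof -
  have "fst (hmult (hinv q) x) = fst x - fst q" by (simp add: hmult_def hinv_def)
  then show ?thesis
    using assms by (auto simp: arctan_sigma_at_def arctan_sigma_def usq_def tph_def phi_at_def
        power2_norm_eq_inner)
qed

text \<open>Passing to the complementary angle puts \<open>t\<close> into the denominator, which is
  harmless on the vertical axis away from the centre.\<close>

lemma arctan_divide_eq:
  assumes "u > 0" "t \<noteq> 0"
  shows "arctan (t / u) = sgn t * pi / 2 - arctan (u / t)"
proof (cases "t > 0")
  case True
  then show ?thesis using arctan_inverse[of "u / t"] assms by simp
next
  case False
  then show ?thesis using arctan_inverse[of "u / (- t)"] assms by (simp add: arctan_minus divide_pos_neg)
qed

lemma arctan_sigma_at_eq2:
  assumes "tph q x \<noteq> 0"
  shows "arctan_sigma_at q x = sgn (tph q x) * pi / 2 - arctan (usq q x / tph q x)"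
proof (cases "usq q x = 0")
  case True
  then have "fst (hmult (hinv q) x) = 0" by (simp add: usq_def hmult_def hinv_def)
  then show ?thesis
    using True by (simp add: arctan_sigma_at_def arctan_sigma_def tph_def phi_at_def sgn_mult)
next
  case False
  then have "usq q x > 0" using usq_nonneg[of q x] by linarith
  then show ?thesis using assms arctan_sigma_at_eq1[OF False] arctan_divide_eq by simp
qed

text \<open>The regions \<open>usq q x \<noteq> 0\<close> and \<open>tph q x \<noteq> 0\<close>
  cover everything but the centre. Exchanging u and t flips the sign of the numerator and fixes
  \<open>rad\<close>, so the complementary angle has the same derivative formula.\<close>

lemma has_derivative_arctan_sigma_at:
  assumes "hnorm_at q p > 0"
  shows "(arctan_sigma_at q has_derivative
    (\<lambda>v. (usq q p * Dtph q p v - tph q p * Dusq q p v) / rad (usq q p) (tph q p) ^ 4)) (at p)"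
proof (cases "usq q p = 0")
  case False
  have c: "continuous_on UNIV (usq q)"
    using has_derivative_usq has_derivative_continuous_on by blast
  show ?thesis
  proof (rule has_derivative_transform_within_open)
    show "((\<lambda>x. arctan (tph q x / usq q x)) has_derivative
      (\<lambda>v. (usq q p * Dtph q p v - tph q p * Dusq q p v) / rad (usq q p) (tph q p) ^ 4)) (at p)"
      using has_derivative_arctan_divide[OF has_derivative_usq has_derivative_tph False] .
    show "open {x. usq q x \<noteq> 0}"
      by (intro open_Collect_neq c continuous_on_const)
  qed (use False arctan_sigma_at_eq1 in auto)
next
  case True
  have t: "tph q p \<noteq> 0" using assms True by (auto simp: hnorm_at_eq rad_def)
  have c: "continuous_on UNIV (tph q)"
    using has_derivative_tph has_derivative_continuous_on by blast
  show ?thesis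
  proof (rule has_derivative_transform_within_open)
    have r: "rad (tph q p) (usq q p) = rad (usq q p) (tph q p)" by (simp add: rad_def add.commute)
    have "((\<lambda>x. sgn (tph q p) * pi / 2 - arctan (usq q x / tph q x)) has_derivative
       (\<lambda>v. 0 - (tph q p * Dusq q p v - usq q p * Dtph q p v) / rad (tph q p) (usq q p) ^ 4)) (at p)"
      by (intro has_derivative_diff has_derivative_const
          has_derivative_arctan_divide[OF has_derivative_tph has_derivative_usq t])
    moreover have "0 - (x - y) / z = (y - x) / z" for x y z :: real
      by (simp add: diff_divide_distrib)
    ultimately show "((\<lambda>x. sgn (tph q p) * pi / 2 - arctan (usq q x / tph q x)) has_derivative
      (\<lambda>v. (usq q p * Dtph q p v - tph q p * Dusq q p v) / rad (usq q p) (tph q p) ^ 4)) (at p)"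
      by (simp only: r)
    \<comment> \<open>On this neighbourhood of p the sign of \<open>tph\<close> is constant, and so
      is the jump term of the complementary angle.\<close>
    show "open {x. tph q x * tph q p > 0}"
      by (intro open_Collect_less continuous_intros c)
    show "p \<in> {x. tph q x * tph q p > 0}" using t by (auto simp: zero_less_mult_iff)
    fix x assume x: "x \<in> {x. tph q x * tph q p > 0}"
    then have "sgn (tph q x) = sgn (tph q p)" "tph q x \<noteq> 0" by (auto simp: zero_less_mult_iff)
    then show "sgn (tph q p) * pi / 2 - arctan (usq q x / tph q x) = arctan_sigma_at q x"
      by (simp add: arctan_sigma_at_eq2)
  qed
qed

lemma has_derivative_hnorm_at:
  assumes "hnorm_at q p > 0"
  shows "(hnorm_at q has_derivative
    (\<lambda>v. (usq q p * Dusq q p v + tph q p * Dtph q p v) / (2 * rad (usq q p) (tph q p) ^ 3))) (at p)"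
  unfolding hnorm_at_eq[abs_def]
  by (rule has_derivative_rad[OF has_derivative_usq has_derivative_tph])
    (use assms in \<open>auto simp: hnorm_at_eq rad_def\<close>)

lemma tendsto_arctan_regularised:
  assumes "hnorm_at q p > 0" "e \<longlonglongrightarrow> 0" "\<And>n. e n > 0"
  shows "(\<lambda>n. arctan (tph q p / (usq q p + e n))) \<longlonglongrightarrow> arctan_sigma_at q p"
proof (cases "usq q p = 0")
  case False
  have "(\<lambda>n. arctan (tph q p / (usq q p + e n))) \<longlonglongrightarrow> arctan (tph q p / (usq q p + 0))"
    by (intro tendsto_intros assms) (use False in auto)
  then show ?thesis using arctan_sigma_at_eq1[OF False] by simp
next
  \<comment> \<open>On the axis the quotient itself diverges; the complementary angle
    converges.\<close>
  case True
  have t: "tph q p \<noteq> 0" using assms True by (auto simp: hnorm_at_eq rad_def)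
  have "(\<lambda>n. sgn (tph q p) * pi / 2 - arctan ((usq q p + e n) / tph q p)) \<longlonglongrightarrow>
     sgn (tph q p) * pi / 2 - arctan ((usq q p + 0) / tph q p)"
    by (intro tendsto_intros assms t)
  moreover have "arctan (tph q p / (usq q p + e n)) = sgn (tph q p) * pi / 2 - arctan ((usq q p + e n) / tph q p)" for n
    using arctan_divide_eq[OF _ t, of "usq q p + e n"] assms(3)[of n] usq_nonneg[of q p] by simp
  ultimately show ?thesis using arctan_sigma_at_eq2[OF t] by simp
qed

section \<open>The cut-off function\<close>


definition reg_rad :: "heis \<Rightarrow> real \<Rightarrow> heis \<Rightarrow> real" where
  "reg_rad q e p = rad (usq q p + e) (tph q p)"

text \<open>For \<open>e = 0\<close> the quotient would give the value \<open>0\<close> instead of \<open>\<plusminus>\<pi> / 2\<close> on the vertical axis.\<close>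

definition reg_arctan :: "heis \<Rightarrow> real \<Rightarrow> heis \<Rightarrow> real" where
  "reg_arctan q e p = (if e = 0 then arctan_sigma_at q p else arctan (tph q p / (usq q p + e)))"

definition reg_AA :: "heis \<Rightarrow> real \<Rightarrow> heis set \<times> heis \<Rightarrow> real" where
  "reg_AA q e x = gr_AA (usq q (snd x) + e) (tph q (snd x)) (p_uu q x) (p_ut q x) (p_tt q x)"

definition reg_dens :: "heis \<Rightarrow> real \<Rightarrow> heis set \<times> heis \<Rightarrow> real" where
  "reg_dens q e x = dens (usq q (snd x) + e) (tph q (snd x)) (p_uu q x) (p_ut q x) (p_tt q x)"

section \<open>The regularised gauge and compactness of gauge balls\<close>

lemma continuous_usq: "continuous_on S (usq q)"
  and continuous_tph: "continuous_on S (tph q)"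
  by (rule has_derivative_continuous_on, rule has_derivative_at_withinI,
      rule has_derivative_usq has_derivative_tph)+

lemma continuous_reg_rad: "continuous_on S (reg_rad q e)"
  unfolding reg_rad_def[abs_def] rad_def
  by (intro continuous_intros continuous_usq continuous_tph)

lemma reg_rad_0: "reg_rad q 0 = hnorm_at q"
  by (simp add: reg_rad_def hnorm_at_eq fun_eq_iff)

lemma reg_rad_pos: "e > 0 \<Longrightarrow> reg_rad q e p > 0"
  unfolding reg_rad_def using usq_nonneg[of q p] by (intro rad_pos disjI1) linarith

text \<open>This keeps the regularised density below 4 / e, even at the centre.\<close>

lemma reg_rad_ge: "0 \<le> e \<Longrightarrow> e \<le> (reg_rad q e p)\<^sup>2"
proof -
  assume "0 \<le> e"
  have "usq q p + e \<le> (reg_rad q e p)\<^sup>2"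
    by (rule power2_le_imp_le)
      (use rad_pow4[of "usq q p + e" "tph q p"] in \<open>simp_all add: reg_rad_def flip: power_mult\<close>)
  then show ?thesis using usq_nonneg[of q p] by linarith
qed

text \<open>Regularised balls lie inside the gauge balls, so for every e the supports stay in one
  compact set.\<close>

lemma hnorm_at_le_reg_rad: "0 \<le> e \<Longrightarrow> hnorm_at q p \<le> reg_rad q e p"
  unfolding hnorm_at_eq reg_rad_def by (rule rad_mono) auto

text \<open>A gauge ball is a closed subset of a left translate of the compact product of a
  Euclidean ball and an interval, because both |z|^2 and 2 |phi| are at most r^2.\<close>

lemma compact_hnorm_at_le: "compact {p. hnorm_at q p \<le> s}"
proof -
  have cm: "continuous_on S (hmult q)" for S
    unfolding hmult_def
    by (intro continuous_intros bounded_linear.continuous_on[OF bounded_linear_omega_right])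
  have "{p. hnorm_at q p \<le> s} \<subseteq> hmult q ` (cball 0 s \<times> {- s\<^sup>2..s\<^sup>2})"
  proof
    fix p assume p: "p \<in> {p. hnorm_at q p \<le> s}"
    then have s: "0 \<le> s" using order_trans[OF rad_nonneg] by (auto simp: hnorm_at_eq)
    have "(rad (usq q p) (tph q p))\<^sup>2 \<le> s\<^sup>2"
      using p by (intro power_mono) (auto simp: hnorm_at_eq)
    moreover have "usq q p \<le> (rad (usq q p) (tph q p))\<^sup>2"
      by (rule power2_le_imp_le)
        (use rad_pow4[of "usq q p" "tph q p"] in \<open>simp_all flip: power_mult\<close>)
    moreover have "\<bar>tph q p\<bar> \<le> (rad (usq q p) (tph q p))\<^sup>2" by (rule abs_t_le_rad)
    ultimately have "usq q p \<le> s\<^sup>2" and t: "\<bar>tph q p\<bar> \<le> s\<^sup>2" by linarith+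
    then have "norm (fst p - fst q) \<le> s"
      using s by (simp add: usq_def norm_le_square)
    moreover have "p = hmult q (fst p - fst q, tph q p / 2)"
      by (simp add: hmult_def tph_eq prod_eq_iff omega_simps diff_divide_distrib)
    moreover have "- s\<^sup>2 \<le> tph q p / 2" "tph q p / 2 \<le> s\<^sup>2" using t by (auto simp: abs_le_iff)
    ultimately show "p \<in> hmult q ` (cball 0 s \<times> {- s\<^sup>2..s\<^sup>2})"
      by (intro image_eqI[of _ _ "(fst p - fst q, tph q p / 2)"]) (auto simp: dist_norm norm_minus_commute)
  qed
  moreover have "compact (hmult q ` (cball 0 s \<times> {- s\<^sup>2..s\<^sup>2}))"
    by (intro compact_continuous_image cm compact_Times) auto
  moreover have "closed {p. hnorm_at q p \<le> s}"
    using closed_Collect_le[OF continuous_reg_rad[of UNIV q 0] continuous_on_const] by (simp add: reg_rad_0)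
  ultimately show ?thesis
    by (metis compact_Int_closed inf.absorb2)
qed

text \<open>\<open>chi\<close> is given on the closed half line only, while \<open>Ck_on\<close>
  uses two-sided derivatives; hence smoothness on the interior. Near 0 the constant value on [0, 1]
  takes over.\<close>

locale cutoff =
  fixes chi \<eta> :: "real \<Rightarrow> real"
  assumes chi_smooth: "smooth_on {0<..} chi"
    and chi_nonneg: "\<And>t. t \<ge> 0 \<Longrightarrow> chi t \<ge> 0"
    and chi_one: "\<And>t. 0 \<le> t \<Longrightarrow> t \<le> 1 \<Longrightarrow> chi t = 1"
    and chi_zero: "\<And>t. t \<ge> 2 \<Longrightarrow> chi t = 0"
    and eta: "\<eta> \<in> test_functions {1<..<2}"
    and chi_deriv: "\<And>t. t > 0 \<Longrightarrow> - deriv chi t = (\<eta> t)\<^sup>2"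
begin

lemma Ck_chi: "Ck_on k {0<..} chi"
  using chi_smooth by (simp add: smooth_on_def)

lemma DERIV_chi: "t > 0 \<Longrightarrow> (chi has_real_derivative deriv chi t) (at t)"
  using Ck_on_deriv(1)[OF _ Ck_chi[of "Suc 0"]] by simp

lemma Ck_deriv_chi: "Ck_on k {0<..} (deriv chi)"
  using Ck_on_deriv(2)[OF _ Ck_chi[of "Suc k"]] by simp

lemma DERIV_deriv_chi: "t > 0 \<Longrightarrow> (deriv chi has_real_derivative deriv (deriv chi) t) (at t)"
  using Ck_on_deriv(1)[OF _ Ck_deriv_chi[of "Suc 0"]] by simp

lemma continuous_deriv_chi: "continuous_on {0<..} (deriv chi)" "continuous_on {0<..} (deriv (deriv chi))"
  using Ck_deriv_chi[of 0] Ck_on_deriv(2)[OF _ Ck_deriv_chi[of "Suc 0"]] by simp_all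

text \<open>The support of \<open>\<eta>\<close> is closed and lies in (1, 2), so
  \<open>deriv chi\<close> vanishes in a neighbourhood of every other t > 0, the points 1 and 2
  included. This is what gives the second derivative.\<close>

lemma deriv_chi_zero:
  assumes "t > 0" "t \<notin> {1<..<2}"
  shows "deriv chi t = 0" "deriv (deriv chi) t = 0"
proof -
  define V where "V = {0<..} - closure {x. \<eta> x \<noteq> 0}"
  have "open V" by (auto simp: V_def)
  moreover have tV: "t \<in> V" using eta assms by (auto simp: V_def test_functions_def)
  moreover have z: "deriv chi x = 0" if "x \<in> V" for x
  proof -
    have "\<eta> x = 0" using that closure_subset[of "{x. \<eta> x \<noteq> 0}"] by (auto simp: V_def)
    then show ?thesis using chi_deriv[of x] that by (simp add: V_def)
  qed
  ultimately have "(deriv chi has_real_derivative 0) (at t)"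
    using has_field_derivative_transform_within_open[OF DERIV_const[of 0 "at t"], of V "deriv chi"] by auto
  then show "deriv (deriv chi) t = 0" by (rule DERIV_imp_deriv)
  show "deriv chi t = 0" using z tV by simp
qed

lemma deriv_chi_bounded:
  obtains M where "M > 0" "\<And>t. t > 0 \<Longrightarrow> \<bar>deriv chi t\<bar> \<le> M" "\<And>t. t > 0 \<Longrightarrow> \<bar>deriv (deriv chi) t\<bar> \<le> M"
proof -
  have "\<exists>B>0. \<forall>t>0. \<bar>f t\<bar> \<le> B" if f: "continuous_on {0<..} f" "\<And>t. t > 0 \<Longrightarrow> t \<notin> {1<..<2} \<Longrightarrow> f t = 0" for f :: "real \<Rightarrow> real"
  proof -
    have "compact (f ` {1..2})"
      by (intro compact_continuous_image continuous_on_subset[OF f(1)]) auto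
    then obtain B where B: "B > 0" "\<forall>y\<in>f ` {1..2}. norm y \<le> B"
      using compact_imp_bounded bounded_pos by metis
    have "\<bar>f t\<bar> \<le> B" if "t > 0" for t
      using B f(2)[OF that] by (cases "t \<in> {1<..<2}") auto
    then show ?thesis using B(1) by blast
  qed
  from this[OF continuous_deriv_chi(1) deriv_chi_zero(1)] this[OF continuous_deriv_chi(2) deriv_chi_zero(2)]
  obtain B1 B2 where B: "B1 > 0" "\<forall>t>0. \<bar>deriv chi t\<bar> \<le> B1" "B2 > 0" "\<forall>t>0. \<bar>deriv (deriv chi) t\<bar> \<le> B2"
    by auto
  show ?thesis
    by (rule that[of "max B1 B2"]) (use B in \<open>auto simp: le_max_iff_disj\<close>)
qed

lemma chi_antimono:
  assumes "0 < s" "s \<le> t"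
  shows "chi t \<le> chi s"
proof (rule DERIV_nonpos_imp_nonincreasing[OF assms(2)])
  fix x assume x: "s \<le> x" "x \<le> t"
  then have "deriv chi x = - (\<eta> x)\<^sup>2" using chi_deriv[of x] assms(1) by simp
  then show "\<exists>y. (chi has_real_derivative y) (at x) \<and> y \<le> 0"
    using DERIV_chi[of x] assms(1) x by (intro exI[of _ "deriv chi x"]) auto
qed

lemma chi_le_1: "0 \<le> t \<Longrightarrow> chi t \<le> 1"
  using chi_one[of t] chi_antimono[of 1 t] chi_one[of 1] by (cases "t \<le> 1") auto

lemma continuous_chi: "continuous_on {0<..} chi"
  using Ck_chi[of 0] by simp

definition chi1 :: "real \<Rightarrow> real \<Rightarrow> real" where
  "chi1 a r = 1 / a * deriv chi (r / a)"

definition chi2 :: "real \<Rightarrow> real \<Rightarrow> real" where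
  "chi2 a r = 1 / a\<^sup>2 * deriv (deriv chi) (r / a)"

lemma DERIV_chi_scaled:
  assumes "a > 0" "r > 0"
  shows "((\<lambda>r. chi (r / a)) has_real_derivative chi1 a r) (at r)"
    and "(chi1 a has_real_derivative chi2 a r) (at r)"
proof -
  have d: "((\<lambda>r. r / a) has_real_derivative 1 / a) (at r)"
    using assms by (auto intro!: derivative_eq_intros)
  show "((\<lambda>r. chi (r / a)) has_real_derivative chi1 a r) (at r)"
    using DERIV_chain2[OF DERIV_chi d] assms by (simp add: chi1_def mult.commute)
  have "((\<lambda>r. 1 / a * deriv chi (r / a)) has_real_derivative 1 / a * (deriv (deriv chi) (r / a) * (1 / a))) (at r)"
    by (rule DERIV_cmult[OF DERIV_chain2[OF DERIV_deriv_chi d]]) (use assms in simp)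
  then show "(chi1 a has_real_derivative chi2 a r) (at r)"
    by (simp add: chi1_def[abs_def] chi2_def power2_eq_square)
qed

lemma chi12_zero:
  assumes "a > 0" "r > 0" "\<not> (a < r \<and> r < 2 * a)"
  shows "chi1 a r = 0" "chi2 a r = 0"
  using assms deriv_chi_zero[of "r / a"] by (auto simp: chi1_def chi2_def field_simps)

lemma continuous_chi12:
  assumes "a > 0" "continuous_on S f" "\<And>x. x \<in> S \<Longrightarrow> f x > 0"
  shows "continuous_on S (\<lambda>x. chi (f x / a))" "continuous_on S (\<lambda>x. chi1 a (f x))"
    "continuous_on S (\<lambda>x. chi2 a (f x))"
  unfolding chi1_def chi2_def
  by (intro continuous_intros continuous_on_compose2[OF continuous_chi]
      continuous_on_compose2[OF continuous_deriv_chi(1)] continuous_on_compose2[OF continuous_deriv_chi(2)] assms(2);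
      use assms in force)+

lemma tendsto_chi12:
  assumes "a > 0" "r > 0" "f \<longlonglongrightarrow> r"
  shows "(\<lambda>n. chi (f n / a)) \<longlonglongrightarrow> chi (r / a)" "(\<lambda>n. chi1 a (f n)) \<longlonglongrightarrow> chi1 a r"
    "(\<lambda>n. chi2 a (f n)) \<longlonglongrightarrow> chi2 a r"
proof -
  have "isCont (\<lambda>r. chi (r / a)) r" "isCont (chi1 a) r"
    by (rule DERIV_isCont, rule DERIV_chi_scaled[OF assms(1,2)])+
  moreover have "continuous_on {0<..} (chi2 a)"
    using continuous_chi12(3)[OF assms(1), of "{0<..}" "\<lambda>r. r"] by auto
  then have "isCont (chi2 a) r"
    using assms(2) by (simp add: continuous_on_eq_continuous_at[OF open_greaterThan])
  ultimately show "(\<lambda>n. chi (f n / a)) \<longlonglongrightarrow> chi (r / a)" "(\<lambda>n. chi1 a (f n)) \<longlonglongrightarrow> chi1 a r"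
    "(\<lambda>n. chi2 a (f n)) \<longlonglongrightarrow> chi2 a r"
    by (auto intro: isCont_tendsto_compose[OF _ assms(3)])
qed

text \<open>For e = 0, \<open>I1\<close>, \<open>I2\<close>, \<open>I3\<close> are the integrands of
  \<open>Theta\<close>, by \<open>Theta_integrands\<close>; for e > 0 they are the terms produced by
  \<open>div_plane_test\<close>.\<close>

definition I1 :: "heis \<Rightarrow> real \<Rightarrow> real \<Rightarrow> heis set \<times> heis \<Rightarrow> real" where
  "I1 q e a x = th1 (usq q (snd x) + e) (tph q (snd x)) (p_uu q x) (p_ut q x) (p_tt q x)
     (chi1 a (reg_rad q e (snd x)))"

definition I2 :: "heis \<Rightarrow> real \<Rightarrow> real \<Rightarrow> heis set \<times> heis \<Rightarrow> real" where
  "I2 q e a x = th2 (usq q (snd x) + e) (tph q (snd x)) (reg_arctan q e (snd x))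
     (chi1 a (reg_rad q e (snd x)))"

definition I3 :: "heis \<Rightarrow> real \<Rightarrow> real \<Rightarrow> heis set \<times> heis \<Rightarrow> real" where
  "I3 q e a x = th3 (usq q (snd x) + e) (tph q (snd x)) (reg_arctan q e (snd x))
     (p_uu q x) (p_ut q x) (p_tt q x) (chi1 a (reg_rad q e (snd x))) (chi2 a (reg_rad q e (snd x)))"

lemma I_zero:
  assumes "a > 0" "\<not> (a < reg_rad q e (snd x) \<and> reg_rad q e (snd x) < 2 * a)"
  shows "I1 q e a x = 0" "I2 q e a x = 0" "I3 q e a x = 0"
proof -
  have "I1 q e a x = 0 \<and> I2 q e a x = 0 \<and> I3 q e a x = 0"
  proof (cases "reg_rad q e (snd x) = 0")
    \<comment> \<open>The value \<open>deriv chi 0\<close> is unknown, as \<open>chi\<close> is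
      unconstrained on the negative axis. The integrands vanish here through a factor or a
      denominator \<open>rad = 0\<close>.\<close>
    case True
    then have "rad (usq q (snd x) + e) (tph q (snd x)) = 0" by (simp add: reg_rad_def)
    then show ?thesis
      by (simp add: I1_def I2_def I3_def th1_def th2_def th3_def gr_rr_def gr_rA_def)
  next
    case False
    then have "reg_rad q e (snd x) > 0" using rad_nonneg[of "usq q (snd x) + e" "tph q (snd x)"] by (simp add: reg_rad_def less_le)
    from chi12_zero[OF assms(1) this assms(2)]
    show ?thesis by (simp add: I1_def I2_def I3_def th1_def th2_def th3_def)
  qed
  then show "I1 q e a x = 0" "I2 q e a x = 0" "I3 q e a x = 0" by auto
qed

lemma abs_reg_arctan: "\<bar>reg_arctan q e p\<bar> \<le> 2"
proof -
  have a: "\<bar>arctan y\<bar> \<le> 2" for y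
    using arctan_bounded[of y] pi_less_4 by (auto simp: abs_le_iff)
  show ?thesis using a pi_less_4
    by (auto simp: reg_arctan_def arctan_sigma_at_def arctan_sigma_def sgn_if abs_mult)
qed

text \<open>On the support r > a, so |chi1| / r and |chi2| are at most M / a^2. The constant is that
  of the third integrand: with \<open>gr_AA \<le> 4 / r^2\<close>, |A| \<le> 2 and
  \<open>gr_rA\<close> at most 1 / r it is 4 + 2 (1 + 3) = 12.\<close>

lemma I_bounds:
  assumes a: "a > 0" and e: "e \<ge> 0" and x: "x \<in> grass UNIV"
    and M: "\<And>t. t > 0 \<Longrightarrow> \<bar>deriv chi t\<bar> \<le> M" "\<And>t. t > 0 \<Longrightarrow> \<bar>deriv (deriv chi) t\<bar> \<le> M"
  shows "\<bar>I1 q e a x\<bar> \<le> 12 * M / a\<^sup>2" "\<bar>I2 q e a x\<bar> \<le> 12 * M / a\<^sup>2" "\<bar>I3 q e a x\<bar> \<le> 12 * M / a\<^sup>2"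
proof -
  obtain P p where Pp: "x = (P, p)" by (cases x)
  obtain Z1 Z2 where "legendrian_plane p P Z1 Z2" using ex_legendrian_plane x Pp by blast
  then interpret legendrian_plane p P Z1 Z2 .
  define r where "r = reg_rad q e p"
  have M0: "M \<ge> 0" using M(1)[of 1] by linarith
  have "\<bar>I1 q e a x\<bar> \<le> 12 * M / a\<^sup>2 \<and> \<bar>I2 q e a x\<bar> \<le> 12 * M / a\<^sup>2 \<and> \<bar>I3 q e a x\<bar> \<le> 12 * M / a\<^sup>2"
  proof (cases "a < r \<and> r < 2 * a")
    case False
    then show ?thesis using I_zero[OF a, of q e x] M0 by (simp add: Pp r_def)
  next
    case True
    then have r: "r > 0" "a < r" using a by auto
    define u t puu put ptt where d: "u = usq q p + e" "t = tph q p" "puu = p_uu q x" "put = p_ut q x" "ptt = p_tt q x"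
    have rr: "r = rad u t" by (simp add: r_def reg_rad_def d)
    note g = gr_bounds[OF e, of q, folded Pp, folded d, folded rr, OF r(1)]
    define A where "A = reg_arctan q e p"
    have A: "\<bar>A\<bar> \<le> 2" by (simp add: A_def abs_reg_arctan)
    have c1: "\<bar>chi1 a r\<bar> \<le> M / a" and c2: "\<bar>chi2 a r\<bar> \<le> M / a\<^sup>2"
      using M[of "r / a"] a r by (auto simp: chi1_def chi2_def abs_mult divide_right_mono)
    have cr: "\<bar>chi1 a r\<bar> / r \<le> M / a\<^sup>2"
    proof -
      have "\<bar>chi1 a r\<bar> / r \<le> (M / a) / a" using c1 r a M0 by (intro frac_le) auto
      then show ?thesis by (simp add: power2_eq_square)
    qed
    have I1: "\<bar>I1 q e a x\<bar> \<le> 12 * M / a\<^sup>2"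
    proof -
      have "\<bar>I1 q e a x\<bar> = gr_rr u t puu put ptt * (\<bar>chi1 a r\<bar> / r)"
      proof -
        have "I1 q e a x = gr_rr u t puu put ptt / r * chi1 a r"
          by (simp only: I1_def th1_def d Pp snd_conv r_def reg_rad_def)
        then show ?thesis using g(1) r by (simp add: abs_mult)
      qed
      also have "\<dots> \<le> 1 * (\<bar>chi1 a r\<bar> / r)" using g(2) r by (intro mult_right_mono) auto
      also have "\<dots> \<le> 1 * (M / a\<^sup>2)" using cr by simp
      also have "\<dots> \<le> 12 * M / a\<^sup>2" using M0 a by (simp add: divide_right_mono)
      finally show ?thesis .
    qed
    have I2: "\<bar>I2 q e a x\<bar> \<le> 12 * M / a\<^sup>2"
    proof -
      have t: "\<bar>t\<bar> / r\<^sup>2 \<le> 1" using abs_t_le_rad[of t u] r by (simp add: rr)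
      have "\<bar>I2 q e a x\<bar> = (\<bar>t\<bar> / r\<^sup>2) * (\<bar>chi1 a r\<bar> / r) * \<bar>A\<bar>"
      proof -
        have "I2 q e a x = t / r ^ 3 * chi1 a r * A"
          by (simp only: I2_def th2_def d Pp snd_conv r_def reg_rad_def A_def)
        then show ?thesis using r by (simp add: abs_mult eval_nat_numeral)
      qed
      also have "\<dots> \<le> 1 * (M / a\<^sup>2) * 2"
        using t cr A r M0 by (intro mult_mono) auto
      also have "\<dots> \<le> 12 * M / a\<^sup>2" using M0 a by (simp add: divide_right_mono)
      finally show ?thesis .
    qed
    have I3: "\<bar>I3 q e a x\<bar> \<le> 12 * M / a\<^sup>2"
    proof -
      have "\<bar>I3 q e a x\<bar> = \<bar>r * chi1 a r * gr_AA u t puu put ptt + A * (r * chi2 a r - 3 * chi1 a r) * gr_rA u t puu put ptt\<bar>"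
        by (simp only: I3_def th3_def d Pp snd_conv r_def reg_rad_def A_def)
      also have "\<dots> \<le> r * \<bar>chi1 a r\<bar> * gr_AA u t puu put ptt + \<bar>A\<bar> * (r * \<bar>chi2 a r\<bar> + 3 * \<bar>chi1 a r\<bar>) * \<bar>gr_rA u t puu put ptt\<bar>"
      proof -
        have "\<bar>r * chi1 a r * gr_AA u t puu put ptt\<bar> = r * \<bar>chi1 a r\<bar> * gr_AA u t puu put ptt"
          using g(3) r by (simp add: abs_mult)
        moreover have "\<bar>r * chi2 a r - 3 * chi1 a r\<bar> \<le> r * \<bar>chi2 a r\<bar> + 3 * \<bar>chi1 a r\<bar>"
          using abs_triangle_ineq4[of "r * chi2 a r" "3 * chi1 a r"] r by (simp add: abs_mult)
        then have "\<bar>A * (r * chi2 a r - 3 * chi1 a r) * gr_rA u t puu put ptt\<bar>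
          \<le> \<bar>A\<bar> * (r * \<bar>chi2 a r\<bar> + 3 * \<bar>chi1 a r\<bar>) * \<bar>gr_rA u t puu put ptt\<bar>"
          unfolding abs_mult by (intro mult_right_mono mult_left_mono) auto
        ultimately show ?thesis using abs_triangle_ineq by (smt (verit))
      qed
      also have "\<dots> \<le> r * \<bar>chi1 a r\<bar> * (4 / r\<^sup>2) + 2 * (r * \<bar>chi2 a r\<bar> + 3 * \<bar>chi1 a r\<bar>) * (1 / r)"
        using g(4,5) A r by (intro add_mono mult_mono mult_left_mono) auto
      also have "\<dots> = 10 * (\<bar>chi1 a r\<bar> / r) + 2 * \<bar>chi2 a r\<bar>"
        using r by (simp add: field_simps power2_eq_square)
      also have "\<dots> \<le> 10 * (M / a\<^sup>2) + 2 * (M / a\<^sup>2)" using cr c2 by linarith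
      finally show ?thesis by simp
    qed
    show ?thesis using I1 I2 I3 by blast
  qed
  then show "\<bar>I1 q e a x\<bar> \<le> 12 * M / a\<^sup>2" "\<bar>I2 q e a x\<bar> \<le> 12 * M / a\<^sup>2" "\<bar>I3 q e a x\<bar> \<le> 12 * M / a\<^sup>2"
    by auto
qed

end

section \<open>Removing the regularisation\<close>


text \<open>The constant \<open>B\<close> over \<open>K\<close> is an integrable majorant, as the
  measure over \<open>K\<close> is finite. Measurability of \<open>g\<close> comes from the limit,
  which covers integrands containing the extended angle.\<close>

lemma (in grass_radon) dominated_over_compact:
  fixes f :: "nat \<Rightarrow> heis set \<times> heis \<Rightarrow> real"
  assumes K: "compact K"
    and meas: "\<And>n. f n \<in> borel_measurable v"
    and bound: "\<And>n x. x \<in> space v \<Longrightarrow> \<bar>f n x\<bar> \<le> B"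
    and supp: "\<And>n x. x \<in> space v \<Longrightarrow> snd x \<notin> K \<Longrightarrow> f n x = 0"
    and lim: "\<And>x. x \<in> space v \<Longrightarrow> (\<lambda>n. f n x) \<longlonglongrightarrow> g x"
  shows "\<And>n. integrable v (f n)" "integrable v g" "(\<lambda>n. \<integral>x. f n x \<partial>v) \<longlonglongrightarrow> (\<integral>x. g x \<partial>v)"
proof -
  have [measurable]: "g \<in> borel_measurable v" by (rule borel_measurable_LIMSEQ_real[OF lim meas])
  note [measurable] = meas
  define w where "w = (\<lambda>x. indicator (snd -` K \<inter> space v) x * B)"
  have "snd -` K \<inter> space v \<in> sets v"
    by (rule measurable_sets[OF measurable_snd_v]) (use K in \<open>auto intro: borel_closed compact_imp_closed\<close>)
  then have w: "integrable v w"
    unfolding w_def using finite_measure_over_compact[OF K]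
    by (intro integrable_mult_left integrable_real_indicator) auto
  have b: "AE x in v. norm (f n x) \<le> w x" for n
    by (rule AE_I2) (use bound supp in \<open>auto simp: w_def indicator_def\<close>)
  have l: "AE x in v. (\<lambda>n. f n x) \<longlonglongrightarrow> g x" using lim by (intro AE_I2) auto
  have gm: "g \<in> borel_measurable v" by simp
  show "integrable v g" "\<And>n. integrable v (f n)" "(\<lambda>n. \<integral>x. f n x \<partial>v) \<longlonglongrightarrow> (\<integral>x. g x \<partial>v)"
    using integrable_dominated_convergence[OF gm meas w l b]
      integrable_dominated_convergence2[OF gm meas w l b]
      integral_dominated_convergence[OF gm meas w l b] by auto
qed

lemma tendsto_rad [tendsto_intros]:
  assumes "(u \<longlongrightarrow> U) F" "(t \<longlongrightarrow> T) F"
  shows "((\<lambda>x. rad (u x) (t x)) \<longlongrightarrow> rad U T) F"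
  unfolding rad_def by (intro tendsto_intros assms)

lemma hnorm_at_nonneg: "hnorm_at q p \<ge> 0"
  by (simp add: hnorm_at_eq)

lemma tendsto_reg_rad:
  assumes "e \<longlonglongrightarrow> 0"
  shows "(\<lambda>n. reg_rad q (e n) p) \<longlonglongrightarrow> hnorm_at q p"
proof -
  have "(\<lambda>n. rad (usq q p + e n) (tph q p)) \<longlonglongrightarrow> rad (usq q p + 0) (tph q p)"
    by (intro tendsto_intros assms)
  then show ?thesis by (simp add: reg_rad_def hnorm_at_eq)
qed

lemma tendsto_reg_arctan:
  assumes "hnorm_at q p > 0" "e \<longlonglongrightarrow> 0" "\<And>n. e n > 0"
  shows "(\<lambda>n. reg_arctan q (e n) p) \<longlonglongrightarrow> reg_arctan q 0 p"
proof -
  have "e n \<noteq> 0" for n using assms(3)[of n] by simp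
  then show ?thesis using tendsto_arctan_regularised[OF assms] by (simp add: reg_arctan_def)
qed

lemma tendsto_gr:
  assumes "u \<longlonglongrightarrow> U" "rad U T \<noteq> 0"
  shows "(\<lambda>n. gr_rr (u n) T a b c) \<longlonglongrightarrow> gr_rr U T a b c"
    "(\<lambda>n. gr_AA (u n) T a b c) \<longlonglongrightarrow> gr_AA U T a b c"
    "(\<lambda>n. gr_rA (u n) T a b c) \<longlonglongrightarrow> gr_rA U T a b c"
  unfolding gr_rr_def gr_AA_def gr_rA_def
  by (intro tendsto_intros assms; use assms in simp)+

lemma tendsto_reg_AA:
  assumes "hnorm_at q (snd x) > 0" "e \<longlonglongrightarrow> 0"
  shows "(\<lambda>n. reg_AA q (e n) x) \<longlonglongrightarrow> reg_AA q 0 x"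
proof -
  have "(\<lambda>n. usq q (snd x) + e n) \<longlonglongrightarrow> usq q (snd x) + 0" by (intro tendsto_intros assms(2))
  moreover have "rad (usq q (snd x) + 0) (tph q (snd x)) \<noteq> 0" using assms(1) by (simp add: hnorm_at_eq)
  ultimately show ?thesis unfolding reg_AA_def by (rule tendsto_gr(2))
qed

context cutoff
begin

lemma tendsto_I:
  assumes a: "a > 0" and e: "e \<longlonglongrightarrow> 0" "\<And>n. e n > 0"
  shows "(\<lambda>n. I1 q (e n) a x) \<longlonglongrightarrow> I1 q 0 a x" "(\<lambda>n. I2 q (e n) a x) \<longlonglongrightarrow> I2 q 0 a x"
    "(\<lambda>n. I3 q (e n) a x) \<longlonglongrightarrow> I3 q 0 a x"
proof -
  define p where "p = snd x"
  have "(\<lambda>n. I1 q (e n) a x) \<longlonglongrightarrow> I1 q 0 a x \<and> (\<lambda>n. I2 q (e n) a x) \<longlonglongrightarrow> I2 q 0 a x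
    \<and> (\<lambda>n. I3 q (e n) a x) \<longlonglongrightarrow> I3 q 0 a x"
  proof (cases "hnorm_at q p > 0")
    case True
    have u: "(\<lambda>n. usq q p + e n) \<longlonglongrightarrow> usq q p + 0" by (intro tendsto_intros e)
    have r0: "rad (usq q p + 0) (tph q p) \<noteq> 0" using True by (simp add: hnorm_at_eq)
    note r = tendsto_reg_rad[OF e(1), of q p]
    note c = tendsto_chi12(2,3)[OF a True r, folded reg_rad_0]
    note A = tendsto_reg_arctan[OF True e]
    note g = tendsto_gr[OF u r0]
    show ?thesis
      unfolding I1_def I2_def I3_def th1_def th2_def th3_def p_def[symmetric]
      by (intro conjI tendsto_intros u c A g; use r0 in simp)
  next
    \<comment> \<open>At the centre r_e tends to 0, so it eventually lies below the annulus on which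
      the integrands live.\<close>
    case False
    then have z: "hnorm_at q p = 0" using hnorm_at_nonneg[of q p] by simp
    have "eventually (\<lambda>n. reg_rad q (e n) p < a) sequentially"
      using tendsto_reg_rad[OF e(1), of q p] a z by (intro order_tendstoD) auto
    then have ev: "eventually (\<lambda>n. I1 q (e n) a x = 0 \<and> I2 q (e n) a x = 0 \<and> I3 q (e n) a x = 0) sequentially"
      by eventually_elim (use a I_zero p_def in auto)
    have "I1 q 0 a x = 0 \<and> I2 q 0 a x = 0 \<and> I3 q 0 a x = 0"
      using I_zero[OF a, of q 0 x] z a by (auto simp: reg_rad_0 p_def)
    then show ?thesis
      using ev by (auto intro!: tendsto_eventually elim: eventually_mono)
  qed
  then show "(\<lambda>n. I1 q (e n) a x) \<longlonglongrightarrow> I1 q 0 a x" "(\<lambda>n. I2 q (e n) a x) \<longlonglongrightarrow> I2 q 0 a x"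
    "(\<lambda>n. I3 q (e n) a x) \<longlonglongrightarrow> I3 q 0 a x" by auto
qed

lemma Theta_integrands:
  assumes P: "(P, p) \<in> grass UNIV" and a: "a > 0"
  shows "hmetric p (plane_grad P p (hnorm_at q)) (plane_grad P p (hnorm_at q))
            / hnorm_at q p * (1 / a) * deriv chi (hnorm_at q p / a) = I1 q 0 a (P, p)" (is ?I1)
    and "2 * phi_at q p / hnorm_at q p ^ 3 * (1 / a) * deriv chi (hnorm_at q p / a)
            * arctan_sigma_at q p = I2 q 0 a (P, p)" (is ?I2)
    and "hnorm_at q p ^ 4 * hmetric p (plane_grad P p (arctan_sigma_at q))
            (plane_grad P p (\<lambda>x. 1 / hnorm_at q x ^ 3 * (1 / a) * deriv chi (hnorm_at q x / a)
               * arctan_sigma_at q x)) = I3 q 0 a (P, p)" (is ?I3)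
    and "hnorm_at q p > 0 \<Longrightarrow>
       hmetric p (plane_grad P p (arctan_sigma_at q)) (plane_grad P p (arctan_sigma_at q)) = reg_AA q 0 (P, p)"
proof -
  obtain Z1 Z2 where "legendrian_plane p P Z1 Z2" using ex_legendrian_plane[OF P] .
  then interpret legendrian_plane p P Z1 Z2 .
  show ?I2
    by (simp add: I2_def th2_def chi1_def reg_rad_0 reg_arctan_def hnorm_at_eq tph_def)
  define u t r where d: "u = usq q p" "t = tph q p" "r = rad u t"
  have hr: "hnorm_at q p = r" by (simp add: hnorm_at_eq d)
  define h where "h v = (u * Dusq q p v + t * Dtph q p v) / (2 * r ^ 3)" for v
  define k where "k v = (u * Dtph q p v - t * Dusq q p v) / r ^ 4" for v
  note g = gr_eqs[OF d(3) h_def h_def k_def k_def p_eqs]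
  have pos: "?I1 \<and> ?I3 \<and> hmetric p (plane_grad P p (arctan_sigma_at q)) (plane_grad P p (arctan_sigma_at q)) = reg_AA q 0 (P, p)"
    if r: "r > 0"
  proof -
    have dr: "(hnorm_at q has_derivative h) (at p)"
      using has_derivative_hnorm_at[of q p] r by (simp add: hr h_def[abs_def] d)
    have dA: "(arctan_sigma_at q has_derivative k) (at p)"
      using has_derivative_arctan_sigma_at[of q p] r by (simp add: hr k_def[abs_def] d)
    have 1: ?I1
      unfolding hmetric_plane_grad[OF dr dr]
      by (simp add: I1_def th1_def g(1)[folded d(1,2)] chi1_def reg_rad_0 hr flip: d)
    have 2: "hmetric p (plane_grad P p (arctan_sigma_at q)) (plane_grad P p (arctan_sigma_at q)) = reg_AA q 0 (P, p)"
      unfolding hmetric_plane_grad[OF dA dA]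
      by (simp add: reg_AA_def g(2) flip: d)
    have "((\<lambda>y. 1 / y ^ 3) has_real_derivative - 3 / r ^ 4) (at r)"
      by (rule derivative_eq_intros refl | (use r in simp; fail))+
        (use r in \<open>simp add: field_simps eval_nat_numeral\<close>)
    then have d3: "((\<lambda>x. 1 / hnorm_at q x ^ 3) has_derivative (\<lambda>v. - 3 / r ^ 4 * h v)) (at p)"
      by (intro has_derivative_DERIV_compose[OF _ dr]) (simp add: hr)
    have dc: "((\<lambda>x. chi1 a (hnorm_at q x)) has_derivative (\<lambda>v. chi2 a r * h v)) (at p)"
      using DERIV_chi_scaled(2)[OF a r] by (intro has_derivative_DERIV_compose[OF _ dr]) (simp add: hr)
    define E where "E v = 1 / r ^ 3 * chi1 a r * k v + (1 / r ^ 3 * (chi2 a r * h v) + - 3 / r ^ 4 * h v * chi1 a r) * arctan_sigma_at q p" for v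
    have dE: "((\<lambda>x. 1 / hnorm_at q x ^ 3 * (1 / a) * deriv chi (hnorm_at q x / a) * arctan_sigma_at q x) has_derivative E) (at p)"
      using has_derivative_mult[OF has_derivative_mult[OF d3 dc] dA]
      by (simp add: E_def[abs_def] hr chi1_def mult.assoc)
    have kE: "r ^ 4 * (k v * E v) = r * chi1 a r * (k v * k v) + arctan_sigma_at q p * (r * chi2 a r - 3 * chi1 a r) * (h v * k v)" for v
    proof -
      have "r ^ 4 * (1 / r ^ 3) = r" "r ^ 4 * (3 / r ^ 4) = 3" using r by (simp_all add: eval_nat_numeral)
      moreover have "r ^ 4 * (k v * E v) = (r ^ 4 * (1 / r ^ 3)) * chi1 a r * (k v * k v)
         + arctan_sigma_at q p * ((r ^ 4 * (1 / r ^ 3)) * chi2 a r - (r ^ 4 * (3 / r ^ 4)) * chi1 a r) * (h v * k v)"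
        unfolding E_def by (simp add: algebra_simps)
      ultimately show ?thesis by simp
    qed
    have "?I3"
      unfolding hmetric_plane_grad[OF dA dE] hr distrib_left kE
      by (simp add: I3_def th3_def g(2,3) reg_rad_0 reg_arctan_def hr algebra_simps flip: d)
    with 1 2 show ?thesis by simp
  qed
  then show "hnorm_at q p > 0 \<Longrightarrow>
       hmetric p (plane_grad P p (arctan_sigma_at q)) (plane_grad P p (arctan_sigma_at q)) = reg_AA q 0 (P, p)"
    by (simp add: hr)
  have "?I1 \<and> ?I3"
  proof (cases "r > 0")
    \<comment> \<open>At the centre the gradients need not exist; the division by
      \<open>hnorm_at q p\<close> in the first integrand and its fourth power in the third make both
      vanish.\<close>
    case False
    then have "r = 0" using hnorm_at_nonneg[of q p] hr by simp
    moreover have "I1 q 0 a (P, p) = 0" "I3 q 0 a (P, p) = 0"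
      using I_zero[OF a, of q 0 "(P, p)"] a \<open>r = 0\<close> by (auto simp: reg_rad_0 hr)
    ultimately show ?thesis by (simp add: hr)
  qed (use pos in auto)
  then show ?I1 ?I3 by auto
qed

end

locale cutoff_radon = cutoff chi \<eta> + grass_radon v for chi \<eta> v
begin

lemma Theta_eq:
  assumes "a > 0"
  shows "Theta chi v q a = - (\<integral>x. I1 q 0 a x \<partial>v) - (\<integral>x. I2 q 0 a x \<partial>v) + 1 / 4 * (\<integral>x. I3 q 0 a x \<partial>v)"
  unfolding Theta_def
  by (intro arg_cong2[of _ _ _ _ "(+)"] arg_cong2[of _ _ _ _ "(-)"] arg_cong[of _ _ uminus]
      arg_cong[of _ _ "\<lambda>x. 1 / 4 * x"] Bochner_Integration.integral_cong refl)
    (simp_all only: split_paired_all space_v case_prod_conv Theta_integrands[OF _ assms])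

lemma measurable_reg:
  shows "(\<lambda>x. usq q (snd x)) \<in> borel_measurable v" "(\<lambda>x. tph q (snd x)) \<in> borel_measurable v"
    "(\<lambda>x. reg_rad q e (snd x)) \<in> borel_measurable v"
  by (intro measurable_base continuous_usq continuous_tph continuous_reg_rad)+

lemma measurable_chi12:
  assumes "a > 0" "e > 0"
  shows "(\<lambda>x. chi (reg_rad q e (snd x) / a)) \<in> borel_measurable v"
    "(\<lambda>x. chi1 a (reg_rad q e (snd x))) \<in> borel_measurable v"
    "(\<lambda>x. chi2 a (reg_rad q e (snd x))) \<in> borel_measurable v"
  by (rule measurable_base, rule continuous_chi12[OF assms(1) continuous_reg_rad],
      rule reg_rad_pos[OF assms(2)])+

lemma measurable_reg_AA_dens:
  "reg_AA q e \<in> borel_measurable v" "reg_dens q e \<in> borel_measurable v"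
proof -
  note [measurable] = measurable_reg(1,2)[of q] measurable_reg(3)[of q e] measurable_p[of q]
  show "reg_AA q e \<in> borel_measurable v" "reg_dens q e \<in> borel_measurable v"
    unfolding reg_AA_def[abs_def] reg_dens_def[abs_def] dens_def gr_AA_def gr_rr_def reg_rad_def[symmetric]
    by measurable
qed

lemma measurable_I:
  assumes "a > 0" "e > 0"
  shows "I1 q e a \<in> borel_measurable v" "I2 q e a \<in> borel_measurable v" "I3 q e a \<in> borel_measurable v"
proof -
  note [measurable] = measurable_reg(1,2)[of q] measurable_reg(3)[of q e] measurable_p[of q] measurable_chi12[OF assms, of q]
  have [measurable]: "(\<lambda>x. reg_arctan q e (snd x)) \<in> borel_measurable v"
    unfolding reg_arctan_def using assms(2) by simp
  show "I1 q e a \<in> borel_measurable v" "I2 q e a \<in> borel_measurable v" "I3 q e a \<in> borel_measurable v"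
    unfolding I1_def[abs_def] I2_def[abs_def] I3_def[abs_def] th1_def th2_def th3_def gr_AA_def gr_rr_def gr_rA_def reg_rad_def[symmetric]
    by measurable
qed

lemma I_supp:
  assumes "a > 0" "e \<ge> 0" "snd x \<notin> {p. hnorm_at q p \<le> 2 * a}"
  shows "I1 q e a x = 0" "I2 q e a x = 0" "I3 q e a x = 0"
  using I_zero[OF assms(1), of q e x] hnorm_at_le_reg_rad[OF assms(2), of q "snd x"] assms(3) by auto

lemma integral_I:
  assumes a: "a > 0" and e: "e \<longlonglongrightarrow> 0" "\<And>n. e n > 0"
  shows "integrable v (I1 q (e n) a)" "integrable v (I2 q (e n) a)" "integrable v (I3 q (e n) a)"
    "integrable v (I1 q 0 a)" "integrable v (I2 q 0 a)" "integrable v (I3 q 0 a)"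
    "(\<lambda>n. \<integral>x. I1 q (e n) a x \<partial>v) \<longlonglongrightarrow> (\<integral>x. I1 q 0 a x \<partial>v)"
    "(\<lambda>n. \<integral>x. I2 q (e n) a x \<partial>v) \<longlonglongrightarrow> (\<integral>x. I2 q 0 a x \<partial>v)"
    "(\<lambda>n. \<integral>x. I3 q (e n) a x \<partial>v) \<longlonglongrightarrow> (\<integral>x. I3 q 0 a x \<partial>v)"
proof -
  obtain M where M: "\<And>t. t > 0 \<Longrightarrow> \<bar>deriv chi t\<bar> \<le> M" "\<And>t. t > 0 \<Longrightarrow> \<bar>deriv (deriv chi) t\<bar> \<le> M"
    using deriv_chi_bounded by metis
  have e0: "e n \<ge> 0" for n using e(2)[of n] by simp
  note b = I_bounds[OF a e0 _ M, folded space_v]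
  note s = I_supp[OF a e0, of _ q]
  note K = compact_hnorm_at_le[of q "2 * a"]
  note D1 = dominated_over_compact[OF K measurable_I(1)[OF a e(2)] b(1) s(1) tendsto_I(1)[OF a e]]
  note D2 = dominated_over_compact[OF K measurable_I(2)[OF a e(2)] b(2) s(2) tendsto_I(2)[OF a e]]
  note D3 = dominated_over_compact[OF K measurable_I(3)[OF a e(2)] b(3) s(3) tendsto_I(3)[OF a e]]
  show "integrable v (I1 q (e n) a)" "integrable v (I2 q (e n) a)" "integrable v (I3 q (e n) a)"
    "integrable v (I1 q 0 a)" "integrable v (I2 q 0 a)" "integrable v (I3 q 0 a)"
    "(\<lambda>n. \<integral>x. I1 q (e n) a x \<partial>v) \<longlonglongrightarrow> (\<integral>x. I1 q 0 a x \<partial>v)"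
    "(\<lambda>n. \<integral>x. I2 q (e n) a x \<partial>v) \<longlonglongrightarrow> (\<integral>x. I2 q 0 a x \<partial>v)"
    "(\<lambda>n. \<integral>x. I3 q (e n) a x \<partial>v) \<longlonglongrightarrow> (\<integral>x. I3 q 0 a x \<partial>v)"
    by (rule D1 D2 D3; assumption?)+
qed

end

section \<open>Monotonicity\<close>


lemma Ck_on_usq: "Ck_on k UNIV (usq q)"
proof -
  have c: "Ck_on k UNIV (\<lambda>x::heis. fst x $ i + - fst q $ i)" for i
    by (intro Ck_on_add Ck_on_const open_UNIV Ck_on_bounded_linear
        bounded_linear_compose[OF bounded_linear_vec_nth bounded_linear_fst])
  have "usq q = (\<lambda>x. (fst x $ 1 + - fst q $ 1) * (fst x $ 1 + - fst q $ 1)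
      + (fst x $ 2 + - fst q $ 2) * (fst x $ 2 + - fst q $ 2)
      + (fst x $ 3 + - fst q $ 3) * (fst x $ 3 + - fst q $ 3)
      + (fst x $ 4 + - fst q $ 4) * (fst x $ 4 + - fst q $ 4))"
    by (simp add: usq_def fun_eq_iff inner_4)
  then show ?thesis by (simp only:) (intro Ck_on_add Ck_on_mult open_UNIV c)
qed

lemma Ck_on_tph: "Ck_on k UNIV (tph q)"
proof -
  have "tph q = (\<lambda>x. 2 * snd x + (- 2 * omega (fst q) (fst x) + - 2 * snd q))"
    by (simp add: tph_eq fun_eq_iff)
  then show ?thesis
    by (simp only:) (intro Ck_on_add Ck_on_mult Ck_on_const open_UNIV Ck_on_bounded_linear bounded_linear_snd
        bounded_linear_compose[OF bounded_linear_omega_right bounded_linear_fst])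
qed

context cutoff
begin

text \<open>As e > 0, the quotient has a positive denominator and the root a positive argument, so
  \<open>chi\<close> and \<open>root 4\<close> are composed only where they are smooth. The compact
  gauge ball of radius 2 a contains the support.\<close>

lemma regularised_test_function:
  assumes a: "a > 0" and e: "e > 0"
  shows "(\<lambda>x. chi (rad (usq q x + e) (tph q x) / a) * arctan (tph q x / (usq q x + e))) \<in> test_functions UNIV"
proof (rule test_functionI)
  show "compact {p. hnorm_at q p \<le> 2 * a}" by (rule compact_hnorm_at_le)
  show "{x. chi (rad (usq q x + e) (tph q x) / a) * arctan (tph q x / (usq q x + e)) \<noteq> 0}
    \<subseteq> {p. hnorm_at q p \<le> 2 * a}"
  proof (safe, rule ccontr)
    fix x assume "\<not> hnorm_at q x \<le> 2 * a"
    then have "2 * a \<le> rad (usq q x + e) (tph q x)"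
      using hnorm_at_le_reg_rad[of e q x] e by (simp add: reg_rad_def)
    then have "chi (rad (usq q x + e) (tph q x) / a) = 0"
      using a by (intro chi_zero) (simp add: field_simps)
    moreover assume "chi (rad (usq q x + e) (tph q x) / a) * arctan (tph q x / (usq q x + e)) \<noteq> 0"
    ultimately show False by simp
  qed
  have u: "usq q x + e > 0" for x using e usq_nonneg[of q x] by linarith
  have Cu: "Ck_on k UNIV (\<lambda>x. usq q x + e)" for k
    by (intro Ck_on_add Ck_on_usq Ck_on_const open_UNIV)
  have h: "Ck_on k {0<..} (\<lambda>n. chi (root 4 n * (1 / a)))" for k
  proof (rule Ck_on_compose[where h = chi and f = "\<lambda>n. root 4 n * (1 / a)" and T = "{0<..}"])
    show "Ck_on k {0<..} (\<lambda>n. root 4 n * (1 / a))"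
      by (intro Ck_on_mult Ck_on_root Ck_on_const open_greaterThan) simp
  qed (use a in \<open>auto simp: Ck_chi\<close>)
  have 1: "Ck_on k UNIV (\<lambda>x. chi (root 4 ((usq q x + e) * (usq q x + e) + tph q x * tph q x) * (1 / a)))" for k
  proof (rule Ck_on_compose[OF open_UNIV open_greaterThan[of 0] _ h])
    show "(\<lambda>x. (usq q x + e) * (usq q x + e) + tph q x * tph q x) ` UNIV \<subseteq> {0<..}"
      using u by (auto intro!: add_pos_nonneg)
  qed (intro Ck_on_add Ck_on_mult Cu Ck_on_tph open_UNIV)
  have 2: "Ck_on k UNIV (\<lambda>x. arctan (tph q x * inverse (usq q x + e)))" for k
  proof (rule Ck_on_compose[OF open_UNIV open_UNIV _ Ck_on_arctan])
    have "Ck_on k UNIV (\<lambda>x. inverse (usq q x + e))"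
      by (rule Ck_on_compose[OF open_UNIV open_greaterThan[of 0] _ Ck_on_inverse Cu]) (use u in auto)
    then show "Ck_on k UNIV (\<lambda>x. tph q x * inverse (usq q x + e))"
      by (intro Ck_on_mult Ck_on_tph open_UNIV)
  qed auto
  show "smooth_on UNIV (\<lambda>x. chi (rad (usq q x + e) (tph q x) / a) * arctan (tph q x / (usq q x + e)))"
    unfolding smooth_on_def using Ck_on_mult[OF open_UNIV 1 2]
    by (simp add: rad_def power2_eq_square divide_inverse)
qed

end

context cutoff_radon
begin

section \<open>Stationarity and monotonicity at fixed e > 0\<close>

definition reg_Theta :: "heis \<Rightarrow> real \<Rightarrow> real \<Rightarrow> real" where
  "reg_Theta q e a = - (\<integral>x. I1 q e a x \<partial>v) - (\<integral>x. I2 q e a x \<partial>v) + 1 / 4 * (\<integral>x. I3 q e a x \<partial>v)"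

lemma reg_AA_dens_bounds:
  assumes x: "x \<in> space v" and e: "e \<ge> 0" and r: "reg_rad q e (snd x) > 0"
  shows "0 \<le> reg_AA q e x" "reg_AA q e x \<le> reg_dens q e x"
    "reg_dens q e x \<le> 4 / (reg_rad q e (snd x))\<^sup>2"
proof -
  obtain P p where Pp: "x = (P, p)" by (cases x)
  obtain Z1 Z2 where "legendrian_plane p P Z1 Z2" using ex_legendrian_plane x Pp space_v by blast
  then interpret legendrian_plane p P Z1 Z2 .
  show "0 \<le> reg_AA q e x" "reg_AA q e x \<le> reg_dens q e x"
    "reg_dens q e x \<le> 4 / (reg_rad q e (snd x))\<^sup>2"
    using gr_bounds(3,6,7)[OF e, of q] r by (simp_all add: Pp reg_AA_def reg_dens_def reg_rad_def)
qed

text \<open>The bound 4 / e on the density suffices for fixed e, though it degenerates as e tends to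
  0. A constant sequence turns the convergence lemma into an integrability criterion.\<close>

lemma integrable_chi_dens:
  assumes a: "a > 0" and e: "e > 0"
  shows "integrable v (\<lambda>x. chi (reg_rad q e (snd x) / a) * reg_dens q e x)"
proof (rule dominated_over_compact(1)[where f = "\<lambda>n x. chi (reg_rad q e (snd x) / a) * reg_dens q e x"])
  show "compact {p. hnorm_at q p \<le> 2 * a}" by (rule compact_hnorm_at_le)
  show "(\<lambda>x. chi (reg_rad q e (snd x) / a) * reg_dens q e x) \<in> borel_measurable v"
    by (intro borel_measurable_times measurable_chi12 measurable_reg_AA_dens a e)
  show "\<bar>chi (reg_rad q e (snd x) / a) * reg_dens q e x\<bar> \<le> 1 * (4 / e)" if x: "x \<in> space v" for x
  proof -
    have r: "reg_rad q e (snd x) > 0" by (rule reg_rad_pos[OF e])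
    note b = reg_AA_dens_bounds[OF x _ r]
    have "reg_dens q e x \<le> 4 / (reg_rad q e (snd x))\<^sup>2" using b(3) e by simp
    also have "\<dots> \<le> 4 / e" using reg_rad_ge[of e q "snd x"] e r[THEN zero_less_power] by (intro divide_left_mono mult_pos_pos) auto
    finally have "reg_dens q e x \<le> 4 / e" .
    moreover have "0 \<le> reg_dens q e x" using b(1,2) e by linarith
    ultimately show ?thesis
      unfolding abs_mult using r a chi_nonneg[of "reg_rad q e (snd x) / a"] chi_le_1[of "reg_rad q e (snd x) / a"]
      by (intro mult_mono) auto
  qed
  show "chi (reg_rad q e (snd x) / a) * reg_dens q e x = 0" if "snd x \<notin> {p. hnorm_at q p \<le> 2 * a}" for x
  proof -
    have "2 * a \<le> reg_rad q e (snd x)"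
      using hnorm_at_le_reg_rad[of e q "snd x"] that e by auto
    then show ?thesis using a by (simp add: chi_zero field_simps)
  qed
qed (rule tendsto_const)

lemma reg_Theta_eq:
  assumes H: "HSLV UNIV v" and a: "a > 0" and e: "e > 0"
  shows "reg_Theta q e a = (\<integral>x. chi (reg_rad q e (snd x) / a) * reg_dens q e x \<partial>v)"
proof -
  let ?F = "\<lambda>x. chi (rad (usq q x + e) (tph q x) / a) * arctan (tph q x / (usq q x + e))"
  \<comment> \<open>\<open>integral_I\<close> speaks about null sequences; this one has e as its
    term at n = 0.\<close>
  have "e / real (Suc n) > 0" "(\<lambda>n. e / real (Suc n)) \<longlonglongrightarrow> 0" for n
    using e LIMSEQ_Suc[OF lim_const_over_n[of e]] by auto
  from integral_I(1-3)[OF a this(2,1), of q 0]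
  have i: "integrable v (I1 q e a)" "integrable v (I2 q e a)" "integrable v (I3 q e a)" by simp_all
  have "0 = (\<integral>(P, p). div_plane P p (ham_field ?F) \<partial>v)"
    using H regularised_test_function[OF a e] by (simp add: HSLV_def)
  also have "\<dots> = (\<integral>x. (- I1 q e a x - I2 q e a x + 1 / 4 * I3 q e a x)
      - chi (reg_rad q e (snd x) / a) * reg_dens q e x \<partial>v)"
  proof (rule Bochner_Integration.integral_cong[OF refl])
    fix x assume x: "x \<in> space v"
    obtain P p where Pp: "x = (P, p)" by (cases x)
    have e0: "e \<noteq> 0" using e by simp
    show "(case x of (P, p) \<Rightarrow> div_plane P p (ham_field ?F)) =
      (- I1 q e a x - I2 q e a x + 1 / 4 * I3 q e a x) - chi (reg_rad q e (snd x) / a) * reg_dens q e x"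
      using div_plane_test[of P p UNIV e "\<lambda>r. chi (r / a)" "chi1 a" "chi2 a" q] x e DERIV_chi_scaled[OF a]
      by (simp add: Pp space_v I1_def I2_def I3_def reg_rad_def reg_arctan_def reg_dens_def e0)
  qed
  \<comment> \<open>Splitting the vanishing integral is legitimate because each term is integrable
    by itself.\<close>
  also have "\<dots> = reg_Theta q e a - (\<integral>x. chi (reg_rad q e (snd x) / a) * reg_dens q e x \<partial>v)"
    unfolding reg_Theta_def using i integrable_chi_dens[OF a e, of q] by simp
  finally show ?thesis by simp
qed

lemma tendsto_reg_Theta:
  assumes "a > 0" "e \<longlonglongrightarrow> 0" "\<And>n. e n > 0"
  shows "(\<lambda>n. reg_Theta q (e n) a) \<longlonglongrightarrow> Theta chi v q a"
  unfolding Theta_eq[OF assms(1)] reg_Theta_def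
  by (intro tendsto_intros integral_I[OF assms])

lemma chi_diff_nonneg:
  assumes "0 < a" "a < b" "r > 0"
  shows "0 \<le> chi (r / b) - chi (r / a)"
  using chi_antimono[of "r / b" "r / a"] assms by (simp add: frac_le)

lemma reg_Theta_nonneg:
  assumes H: "HSLV UNIV v" and a: "a > 0" and e: "e > 0"
  shows "0 \<le> reg_Theta q e a"
  unfolding reg_Theta_eq[OF assms]
proof (rule Bochner_Integration.integral_nonneg)
  fix x assume x: "x \<in> space v"
  have r: "reg_rad q e (snd x) > 0" by (rule reg_rad_pos[OF e])
  have "0 \<le> reg_dens q e x" using reg_AA_dens_bounds(1,2)[OF x _ r] e by linarith
  then show "0 \<le> chi (reg_rad q e (snd x) / a) * reg_dens q e x"
    using r a by (intro mult_nonneg_nonneg chi_nonneg) auto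
qed

text \<open>The difference is the integral of chi (r / b) - chi (r / a) against the density. This
  weight is nonnegative since \<open>chi\<close> decreases, and the density dominates
  \<open>reg_AA\<close>. The nonnegative integral is the form that Fatou's lemma takes up.\<close>

lemma nn_integral_reg_AA_le:
  assumes H: "HSLV UNIV v" and a: "0 < a" "a < b" and e: "e > 0"
  shows "0 \<le> reg_Theta q e b - reg_Theta q e a"
    and "(\<integral>\<^sup>+x. ennreal ((chi (reg_rad q e (snd x) / b) - chi (reg_rad q e (snd x) / a)) * reg_AA q e x) \<partial>v)
      \<le> ennreal (reg_Theta q e b - reg_Theta q e a)"
proof -
  have b: "b > 0" using a by simp
  let ?J = "\<lambda>x. (chi (reg_rad q e (snd x) / b) - chi (reg_rad q e (snd x) / a)) * reg_dens q e x"
  have J: "integrable v ?J" "reg_Theta q e b - reg_Theta q e a = (\<integral>x. ?J x \<partial>v)"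
    using integrable_chi_dens[OF a(1) e, of q] integrable_chi_dens[OF b e, of q]
    by (simp_all add: reg_Theta_eq[OF H _ e] a b left_diff_distrib)
  have r: "reg_rad q e p > 0" for p by (rule reg_rad_pos[OF e])
  have le: "(chi (reg_rad q e (snd x) / b) - chi (reg_rad q e (snd x) / a)) * reg_AA q e x \<le> ?J x"
    "0 \<le> ?J x" if x: "x \<in> space v" for x
  proof -
    note d = reg_AA_dens_bounds(1,2)[OF x less_imp_le[OF e] r]
    show "(chi (reg_rad q e (snd x) / b) - chi (reg_rad q e (snd x) / a)) * reg_AA q e x \<le> ?J x"
      using d chi_diff_nonneg[OF a r] by (intro mult_left_mono) auto
    show "0 \<le> ?J x"
      using order_trans[OF d] chi_diff_nonneg[OF a r] by (intro mult_nonneg_nonneg) auto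
  qed
  show "0 \<le> reg_Theta q e b - reg_Theta q e a"
    unfolding J(2) using le(2) by (intro Bochner_Integration.integral_nonneg)
  have "(\<integral>\<^sup>+x. ennreal ((chi (reg_rad q e (snd x) / b) - chi (reg_rad q e (snd x) / a)) * reg_AA q e x) \<partial>v)
    \<le> (\<integral>\<^sup>+x. ennreal (?J x) \<partial>v)"
    using le(1) by (intro nn_integral_mono ennreal_leI)
  also have "\<dots> = ennreal (\<integral>x. ?J x \<partial>v)"
    using J(1) le(2) by (intro nn_integral_eq_integral AE_I2)
  finally show "(\<integral>\<^sup>+x. ennreal ((chi (reg_rad q e (snd x) / b) - chi (reg_rad q e (snd x) / a)) * reg_AA q e x) \<partial>v)
      \<le> ennreal (reg_Theta q e b - reg_Theta q e a)" by (simp only: J(2))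
qed

section \<open>Letting e tend to 0\<close>

lemma measurable_hnorm_at: "(\<lambda>x. hnorm_at q (snd x)) \<in> borel_measurable v"
  using measurable_reg(3)[of q 0] by (simp add: reg_rad_0)

lemma measurable_AA: "(\<lambda>x. indicator {x. hnorm_at q (snd x) > 0} x * reg_AA q 0 x) \<in> borel_measurable v"
proof (rule borel_measurable_LIMSEQ_real)
  note [measurable] = measurable_hnorm_at[of q] measurable_reg_AA_dens(1)
  show "(\<lambda>x. indicator {x. hnorm_at q (snd x) > 0} x * reg_AA q (1 / real (Suc n)) x) \<in> borel_measurable v" for n
    by measurable
  show "(\<lambda>n. indicator {x. hnorm_at q (snd x) > 0} x * reg_AA q (1 / real (Suc n)) x)
     \<longlonglongrightarrow> indicator {x. hnorm_at q (snd x) > 0} x * reg_AA q 0 x" for x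
    using tendsto_reg_AA[of q x "\<lambda>n. 1 / real (Suc n)"] LIMSEQ_Suc[OF lim_1_over_n]
    by (cases "hnorm_at q (snd x) > 0") (simp_all add: indicator_def)
qed

text \<open>The first two claims are limits of inequalities at fixed e. For the third, Fatou's lemma
  keeps the part of the energy on which the limiting weight is exactly 1.\<close>

lemma Theta_mono:
  assumes H: "HSLV UNIV v" and a: "0 < a"
  shows "0 \<le> Theta chi v q a" and "a < b \<Longrightarrow> Theta chi v q a \<le> Theta chi v q b"
    and "a < b \<Longrightarrow> (\<integral>\<^sup>+x. ennreal (indicator {x. 2 * a \<le> hnorm_at q (snd x) \<and> hnorm_at q (snd x) < b} x * reg_AA q 0 x) \<partial>v)
      \<le> ennreal (Theta chi v q b - Theta chi v q a)"
proof -
  define e where "e n = 1 / real (Suc n)" for n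
  have e: "e \<longlonglongrightarrow> 0" "\<And>n. e n > 0"
    unfolding e_def using LIMSEQ_Suc[OF lim_1_over_n] by auto
  note T = tendsto_reg_Theta[OF _ e]
  show "0 \<le> Theta chi v q a"
    by (rule LIMSEQ_le_const[OF T[OF a]]) (use reg_Theta_nonneg[OF H a e(2)] in auto)
  assume ab: "a < b"
  have b: "b > 0" using a ab by simp
  have Td: "(\<lambda>n. reg_Theta q (e n) b - reg_Theta q (e n) a) \<longlonglongrightarrow> Theta chi v q b - Theta chi v q a"
    by (intro tendsto_diff T a b)
  have "0 \<le> Theta chi v q b - Theta chi v q a"
    by (rule LIMSEQ_le_const[OF Td]) (use nn_integral_reg_AA_le(1)[OF H a ab e(2)] in auto)
  then show "Theta chi v q a \<le> Theta chi v q b" by simp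
  define w where "w n x = ennreal ((chi (reg_rad q (e n) (snd x) / b) - chi (reg_rad q (e n) (snd x) / a)) * reg_AA q (e n) x)" for n x
  have [measurable]: "w n \<in> borel_measurable v" for n
    unfolding w_def
    by (intro borel_measurable_diff borel_measurable_times measurable_chi12 measurable_reg_AA_dens a b e measurable_compose[OF _ measurable_ennreal])
  have "(\<integral>\<^sup>+x. ennreal (indicator {x. 2 * a \<le> hnorm_at q (snd x) \<and> hnorm_at q (snd x) < b} x * reg_AA q 0 x) \<partial>v)
    \<le> (\<integral>\<^sup>+x. liminf (\<lambda>n. w n x) \<partial>v)"
  proof (rule nn_integral_mono)
    fix x assume x: "x \<in> space v"
    show "ennreal (indicator {x. 2 * a \<le> hnorm_at q (snd x) \<and> hnorm_at q (snd x) < b} x * reg_AA q 0 x) \<le> liminf (\<lambda>n. w n x)"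
    proof (cases "2 * a \<le> hnorm_at q (snd x) \<and> hnorm_at q (snd x) < b")
      case True
      then have r: "hnorm_at q (snd x) > 0" using a by simp
      note rl = tendsto_reg_rad[OF e(1), of q "snd x"]
      have "(\<lambda>n. w n x) \<longlonglongrightarrow> ennreal ((chi (hnorm_at q (snd x) / b) - chi (hnorm_at q (snd x) / a)) * reg_AA q 0 x)"
        unfolding w_def
        by (intro tendsto_ennrealI tendsto_intros tendsto_chi12(1)[OF b r rl] tendsto_chi12(1)[OF a r rl]
            tendsto_reg_AA[OF r e(1)])
      \<comment> \<open>The bound r < b puts r / b on the plateau of \<open>chi\<close>, and 2 a
        \<le> r puts r / a beyond its support; the limiting weight is 1 - 0.\<close>
      moreover have "chi (hnorm_at q (snd x) / b) = 1" using True r b by (intro chi_one) auto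
      moreover have "chi (hnorm_at q (snd x) / a) = 0" using True a by (intro chi_zero) (simp add: field_simps)
      ultimately have "(\<lambda>n. w n x) \<longlonglongrightarrow> ennreal (reg_AA q 0 x)" by simp
      then have "liminf (\<lambda>n. w n x) = ennreal (reg_AA q 0 x)" by (rule lim_imp_Liminf[rotated]) simp
      then show ?thesis using True by simp
    qed simp
  qed
  also have "\<dots> \<le> liminf (\<lambda>n. \<integral>\<^sup>+x. w n x \<partial>v)"
    by (rule nn_integral_liminf) simp
  also have "\<dots> \<le> liminf (\<lambda>n. ennreal (reg_Theta q (e n) b - reg_Theta q (e n) a))"
    unfolding w_def by (intro Liminf_mono always_eventually allI nn_integral_reg_AA_le(2)[OF H a ab e(2)])
  also have "\<dots> = ennreal (Theta chi v q b - Theta chi v q a)"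
    by (rule lim_imp_Liminf[OF _ tendsto_ennrealI[OF Td]]) simp
  finally show "(\<integral>\<^sup>+x. ennreal (indicator {x. 2 * a \<le> hnorm_at q (snd x) \<and> hnorm_at q (snd x) < b} x * reg_AA q 0 x) \<partial>v)
      \<le> ennreal (Theta chi v q b - Theta chi v q a)" .
qed

text \<open>The sets {2 a \<le> r < b} exhaust {0 < r < b} as a tends to 0. The fibre over q is
  never reached, so mass that \<open>v\<close> may have there does no harm.\<close>

lemma nn_integral_AA_le:
  assumes H: "HSLV UNIV v" and b: "b > 0" and \<theta>: "\<And>a. a > 0 \<Longrightarrow> \<theta> \<le> Theta chi v q a"
  shows "(\<integral>\<^sup>+x. ennreal (indicator {x. 0 < hnorm_at q (snd x) \<and> hnorm_at q (snd x) < b} x * reg_AA q 0 x) \<partial>v)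
    \<le> ennreal (Theta chi v q b - \<theta>)"
proof -
  \<comment> \<open>The shift by two gives \<open>a n < b\<close> from n = 0 on.\<close>
  define a where "a n = b / real (Suc (Suc n))" for n
  have a: "a n > 0" "a n < b" for n
    using b divide_strict_left_mono[of 1 "real (Suc (Suc n))" b] by (auto simp: a_def)
  have a0: "a \<longlonglongrightarrow> 0"
    unfolding a_def using LIMSEQ_Suc[OF LIMSEQ_Suc[OF lim_const_over_n[of b]]] by simp
  define w where "w n x = ennreal (indicator {x. 2 * a n \<le> hnorm_at q (snd x) \<and> hnorm_at q (snd x) < b} x * reg_AA q 0 x)" for n x
  have [measurable]: "w n \<in> borel_measurable v" for n
  proof -
    note [measurable] = measurable_hnorm_at[of q] measurable_AA[of q]
    have "(\<lambda>x. ennreal (indicator {x. 2 * a n \<le> hnorm_at q (snd x) \<and> hnorm_at q (snd x) < b} x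
       * (indicator {x. hnorm_at q (snd x) > 0} x * reg_AA q 0 x))) \<in> borel_measurable v"
      by measurable
    moreover have "w n = (\<lambda>x. ennreal (indicator {x. 2 * a n \<le> hnorm_at q (snd x) \<and> hnorm_at q (snd x) < b} x
       * (indicator {x. hnorm_at q (snd x) > 0} x * reg_AA q 0 x)))"
      using a(1)[of n] by (auto simp: w_def fun_eq_iff indicator_def)
    ultimately show ?thesis by simp
  qed
  have "(\<integral>\<^sup>+x. ennreal (indicator {x. 0 < hnorm_at q (snd x) \<and> hnorm_at q (snd x) < b} x * reg_AA q 0 x) \<partial>v)
    \<le> (\<integral>\<^sup>+x. liminf (\<lambda>n. w n x) \<partial>v)"
  proof (rule nn_integral_mono)
    fix x
    show "ennreal (indicator {x. 0 < hnorm_at q (snd x) \<and> hnorm_at q (snd x) < b} x * reg_AA q 0 x) \<le> liminf (\<lambda>n. w n x)"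
    proof (cases "0 < hnorm_at q (snd x) \<and> hnorm_at q (snd x) < b")
      case True
      have "eventually (\<lambda>n. a n < hnorm_at q (snd x) / 2) sequentially"
        using order_tendstoD(2)[OF a0, of "hnorm_at q (snd x) / 2"] True by simp
      then have "eventually (\<lambda>n. w n x = ennreal (reg_AA q 0 x)) sequentially"
        by eventually_elim (use True in \<open>simp add: w_def\<close>)
      then have "liminf (\<lambda>n. w n x) = ennreal (reg_AA q 0 x)"
        by (intro lim_imp_Liminf tendsto_eventually) auto
      then show ?thesis using True by simp
    qed simp
  qed
  also have "\<dots> \<le> liminf (\<lambda>n. \<integral>\<^sup>+x. w n x \<partial>v)"
    by (rule nn_integral_liminf) simp
  also have "\<dots> \<le> liminf (\<lambda>n::nat. ennreal (Theta chi v q b - \<theta>))"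
  proof (intro Liminf_mono always_eventually allI)
    fix n
    have "(\<integral>\<^sup>+x. w n x \<partial>v) \<le> ennreal (Theta chi v q b - Theta chi v q (a n))"
      unfolding w_def by (rule Theta_mono(3)[OF H a])
    also have "\<dots> \<le> ennreal (Theta chi v q b - \<theta>)" using \<theta>[OF a(1)[of n]] by (intro ennreal_leI) simp
    finally show "(\<integral>\<^sup>+x. w n x \<partial>v) \<le> ennreal (Theta chi v q b - \<theta>)" .
  qed
  finally show ?thesis by (simp add: Liminf_const)
qed

text \<open>By monotonicity and nonnegativity the limit at 0 is the infimum; its being a lower bound
  is what \<open>nn_integral_AA_le\<close> asks for.\<close>

lemma Theta_tendsto:
  assumes H: "HSLV UNIV v"
  obtains \<theta> where "\<theta> \<ge> 0" "(Theta chi v q \<longlongrightarrow> \<theta>) (at_right 0)" "\<And>a. a > 0 \<Longrightarrow> \<theta> \<le> Theta chi v q a"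
proof -
  define \<theta> where "\<theta> = Inf (Theta chi v q ` {0<..})"
  have bdd: "bdd_below (Theta chi v q ` {0<..})"
    using Theta_mono(1)[OF H, of _ q] by (intro bdd_belowI[of _ 0]) auto
  have le: "\<theta> \<le> Theta chi v q a" if "a > 0" for a
    unfolding \<theta>_def using that by (intro cInf_lower bdd) auto
  have nn: "\<theta> \<ge> 0" unfolding \<theta>_def using Theta_mono(1)[OF H, of _ q] by (intro cInf_greatest) auto
  have "(Theta chi v q \<longlongrightarrow> \<theta>) (at_right 0)"
  proof (rule order_tendstoI)
    fix y assume y: "y < \<theta>"
    show "eventually (\<lambda>a. y < Theta chi v q a) (at_right 0)"
      unfolding eventually_at_right_field using le y by (intro exI[of _ 1]) force
  next
    fix y assume "\<theta> < y"
    then obtain a0 where a0: "a0 > 0" "Theta chi v q a0 < y"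
      unfolding \<theta>_def using cInf_lessD[of "Theta chi v q ` {0<..}" y] by auto
    show "eventually (\<lambda>a. Theta chi v q a < y) (at_right 0)"
      unfolding eventually_at_right_field
      using a0 Theta_mono(2)[OF H, of _ a0 q] by (intro exI[of _ a0]) force
  qed
  with nn le that show ?thesis by blast
qed

text \<open>Each of the three integrands is at most 12 M / b^2 on the annulus, and the third carries
  the factor 1 / 4: 12 + 12 + 3 = 27.\<close>

lemma Theta_le:
  assumes b: "b > 0" and M: "\<And>t. t > 0 \<Longrightarrow> \<bar>deriv chi t\<bar> \<le> M" "\<And>t. t > 0 \<Longrightarrow> \<bar>deriv (deriv chi) t\<bar> \<le> M"
  shows "ennreal (Theta chi v q b) \<le> ennreal (27 * M / b\<^sup>2) *
    emeasure (weight UNIV v) (hball q (2 * b) - closure (hball q b))"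
proof -
  have M0: "M \<ge> 0" using M(1)[of 1] by linarith
  note [measurable] = measurable_hnorm_at[of q]
  \<comment> \<open>Strict inequalities are possible because the integrands already vanish at r = b
    and r = 2 b.\<close>
  define A where "A = {x \<in> space v. b < hnorm_at q (snd x) \<and> hnorm_at q (snd x) < 2 * b}"
  have A [measurable]: "A \<in> sets v" unfolding A_def by measurable
  have "emeasure v A \<le> emeasure v (snd -` {p. hnorm_at q p \<le> 2 * b} \<inter> space v)"
    by (intro emeasure_mono measurable_sets[OF measurable_snd_v] borel_closed compact_imp_closed compact_hnorm_at_le)
      (auto simp: A_def)
  also have "\<dots> < \<infinity>" by (rule finite_measure_over_compact[OF compact_hnorm_at_le])
  finally have fin: "emeasure v A < \<infinity>" .
  have le: "\<bar>\<integral>x. f x \<partial>v\<bar> \<le> 12 * M / b\<^sup>2 * measure v A"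
    if f: "integrable v f" "\<And>x. x \<in> space v \<Longrightarrow> \<bar>f x\<bar> \<le> 12 * M / b\<^sup>2"
      "\<And>x. x \<in> space v \<Longrightarrow> x \<notin> A \<Longrightarrow> f x = 0" for f
  proof -
    have "\<bar>\<integral>x. f x \<partial>v\<bar> \<le> (\<integral>x. \<bar>f x\<bar> \<partial>v)" by (rule integral_abs_bound)
    also have "\<dots> \<le> (\<integral>x. 12 * M / b\<^sup>2 * indicator A x \<partial>v)"
    proof (rule integral_mono)
      show "integrable v (\<lambda>x. 12 * M / b\<^sup>2 * indicator A x)"
        using fin by (intro integrable_mult_right integrable_real_indicator A) auto
      show "\<bar>f x\<bar> \<le> 12 * M / b\<^sup>2 * indicator A x" if "x \<in> space v" for x
        using f(2,3)[OF that] by (cases "x \<in> A") auto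
    qed (use f(1) in simp)
    also have "\<dots> = 12 * M / b\<^sup>2 * measure v A" using A fin by (simp add: measure_def)
    finally show ?thesis .
  qed
  have e: "(\<lambda>n. 1 / real (Suc n)) \<longlonglongrightarrow> 0" "\<And>n. 1 / real (Suc n) > 0"
    using LIMSEQ_Suc[OF lim_1_over_n] by auto
  have z: "I1 q 0 b x = 0 \<and> I2 q 0 b x = 0 \<and> I3 q 0 b x = 0" if "x \<in> space v" "x \<notin> A" for x
    using I_zero[OF b, of q 0 x] that by (auto simp: A_def reg_rad_0)
  note bd = I_bounds[OF b order_refl _ M, folded space_v]
  have "\<bar>\<integral>x. I1 q 0 b x \<partial>v\<bar> \<le> 12 * M / b\<^sup>2 * measure v A"
    by (rule le) (use integral_I(4)[OF b e] bd(1) z in auto)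
  moreover have "\<bar>\<integral>x. I2 q 0 b x \<partial>v\<bar> \<le> 12 * M / b\<^sup>2 * measure v A"
    by (rule le) (use integral_I(5)[OF b e] bd(2) z in auto)
  moreover have "\<bar>\<integral>x. I3 q 0 b x \<partial>v\<bar> \<le> 12 * M / b\<^sup>2 * measure v A"
    by (rule le) (use integral_I(6)[OF b e] bd(3) z in auto)
  moreover define m where "m = M / b\<^sup>2 * measure v A"
  moreover have "12 * M / b\<^sup>2 * measure v A = 12 * m" "27 * M / b\<^sup>2 * measure v A = 27 * m" by (simp_all add: m_def)
  ultimately have "Theta chi v q b \<le> 27 * M / b\<^sup>2 * measure v A"
    unfolding Theta_eq[OF b] by linarith
  then have "ennreal (Theta chi v q b) \<le> ennreal (27 * M / b\<^sup>2) * ennreal (measure v A)"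
    using M0 by (simp add: ennreal_leI flip: ennreal_mult)
  also have "ennreal (measure v A) = emeasure v A" using fin by (simp add: emeasure_eq_ennreal_measure)
  also have "emeasure v A \<le> emeasure (weight UNIV v) (hball q (2 * b) - closure (hball q b))"
  proof -
    have "open (hball q (2 * b))"
      unfolding hball_def using open_Collect_less[OF continuous_reg_rad[of UNIV q 0] continuous_on_const] by (simp add: reg_rad_0)
    then have S: "hball q (2 * b) - closure (hball q b) \<in> sets borel" by (intro sets.Diff borel_open borel_closed closed_closure)
    \<comment> \<open>Removing the topological closure removes at most {r \<le> b}, so
      \<open>A\<close> lies over the remaining set.\<close>
    have cl: "closure (hball q b) \<subseteq> {p. hnorm_at q p \<le> b}"
      by (rule closure_minimal) (auto simp: hball_def intro: compact_imp_closed compact_hnorm_at_le)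
    have "emeasure (weight UNIV v) (hball q (2 * b) - closure (hball q b))
      = emeasure v (snd -` (hball q (2 * b) - closure (hball q b)) \<inter> space v)"
      unfolding weight_def
      by (rule emeasure_distr)
        (simp_all add: S measurable_snd_v measurable_cong_sets[OF refl sets_restrict_UNIV])
    moreover have "A \<subseteq> snd -` (hball q (2 * b) - closure (hball q b)) \<inter> space v"
      using cl by (force simp: A_def hball_def)
    ultimately show ?thesis
      using emeasure_mono[OF _ measurable_sets[OF measurable_snd_v S]] by simp
  qed
  finally show ?thesis by (simp add: mult_left_mono)
qed

end

theorem theoremI2:
  fixes chi \<eta> :: "real \<Rightarrow> real"
  assumes chi_smooth: "smooth_on {0<..} chi"
    and chi_nonneg: "\<And>t. t \<ge> 0 \<Longrightarrow> chi t \<ge> 0"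
    and chi_one: "\<And>t. 0 \<le> t \<Longrightarrow> t \<le> 1 \<Longrightarrow> chi t = 1"
    and chi_zero: "\<And>t. t \<ge> 2 \<Longrightarrow> chi t = 0"
    and eta: "\<eta> \<in> test_functions {1<..<2}"
    and chi_deriv: "\<And>t. t > 0 \<Longrightarrow> - deriv chi t = (\<eta> t)\<^sup>2"
  shows "\<exists>C::real. C > 0 \<and> (\<forall>v. HSLV UNIV v \<longrightarrow> (\<forall>q.
           (\<forall>a b. 0 < a \<and> a < b \<longrightarrow> 0 \<le> Theta chi v q a \<and> Theta chi v q a \<le> Theta chi v q b) \<and>
           (\<exists>\<theta>\<ge>0. (Theta chi v q \<longlongrightarrow> \<theta>) (at_right 0) \<and>
             (\<forall>b>0.
               ennreal \<theta> +
               (\<integral>\<^sup>+(P, p)\<in>{(P, p). 0 < hnorm_at q p \<and> hnorm_at q p < b}.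
                  ennreal (hmetric p (plane_grad P p (arctan_sigma_at q))
                                    (plane_grad P p (arctan_sigma_at q))) \<partial>v)
               \<le> ennreal (C / b\<^sup>2) *
                 emeasure (weight UNIV v) (hball q (2 * b) - closure (hball q b))))))"
proof -
  interpret cutoff chi \<eta> by (rule cutoff.intro) (fact assms)+
  obtain M where M: "M > 0" "\<And>t. t > 0 \<Longrightarrow> \<bar>deriv chi t\<bar> \<le> M"
    "\<And>t. t > 0 \<Longrightarrow> \<bar>deriv (deriv chi) t\<bar> \<le> M"
    using deriv_chi_bounded by blast
  show ?thesis
  \<comment> \<open>\<open>M\<close> bounds the first two derivatives of \<open>chi\<close> and is
    fixed before the varifold and the centre.\<close>
  proof (rule exI[of _ "27 * M"], intro conjI allI impI)
    show "27 * M > 0" using M(1) by simp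
    fix v :: "(heis set \<times> heis) measure" and q
    assume H: "HSLV UNIV v"
    interpret cutoff_radon chi \<eta> v
      by unfold_locales (use H in \<open>simp add: HSLV_def\<close>)
    show "0 \<le> Theta chi v q a" "Theta chi v q a \<le> Theta chi v q b" if "0 < a \<and> a < b" for a b
      using Theta_mono(1,2)[OF H] that by auto
    obtain \<theta> where \<theta>: "\<theta> \<ge> 0" "(Theta chi v q \<longlongrightarrow> \<theta>) (at_right 0)" "\<And>a. a > 0 \<Longrightarrow> \<theta> \<le> Theta chi v q a"
      using Theta_tendsto[OF H, of q] by blast
    have "ennreal \<theta> +
               (\<integral>\<^sup>+(P, p)\<in>{(P, p). 0 < hnorm_at q p \<and> hnorm_at q p < b}.
                  ennreal (hmetric p (plane_grad P p (arctan_sigma_at q))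
                                    (plane_grad P p (arctan_sigma_at q))) \<partial>v)
               \<le> ennreal (27 * M / b\<^sup>2) *
                 emeasure (weight UNIV v) (hball q (2 * b) - closure (hball q b))" (is "_ + ?I \<le> ?R") if b: "b > 0" for b
    proof -
      have "?I = (\<integral>\<^sup>+x. ennreal (indicator {x. 0 < hnorm_at q (snd x) \<and> hnorm_at q (snd x) < b} x * reg_AA q 0 x) \<partial>v)"
        by (rule nn_integral_cong) (auto simp: space_v indicator_def Theta_integrands(4)[OF _ b])
      also have "\<dots> \<le> ennreal (Theta chi v q b - \<theta>)" by (rule nn_integral_AA_le[OF H b \<theta>(3)])
      finally have "ennreal \<theta> + ?I \<le> ennreal \<theta> + ennreal (Theta chi v q b - \<theta>)" by (rule add_left_mono)
      \<comment> \<open>\<open>ennreal\<close> truncates negative numbers, so the two terms add up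
        because the limit is at most \<open>Theta chi v q b\<close>.\<close>
      also have "\<dots> = ennreal (Theta chi v q b)" using \<theta>(1) \<theta>(3)[OF b] by (simp flip: ennreal_plus)
      also have "\<dots> \<le> ?R" by (rule Theta_le[OF b M(2,3)])
      finally show ?thesis .
    qed
    with \<theta> show "\<exists>\<theta>\<ge>0. (Theta chi v q \<longlongrightarrow> \<theta>) (at_right 0) \<and>
             (\<forall>b>0.
               ennreal \<theta> +
               (\<integral>\<^sup>+(P, p)\<in>{(P, p). 0 < hnorm_at q p \<and> hnorm_at q p < b}.
                  ennreal (hmetric p (plane_grad P p (arctan_sigma_at q))
                                    (plane_grad P p (arctan_sigma_at q))) \<partial>v)
               \<le> ennreal (27 * M / b\<^sup>2) *
                 emeasure (weight UNIV v) (hball q (2 * b) - closure (hball q b)))" by blast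
  qed
qed

end
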